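(* There is an absolute constant $c_\xi>0$ such that the following holds. Let $f,g:\mathbb{R}^{d_x}\times\mathbb{R}^{d_y}\to\mathbb{R}$ and their stochastic gradient oracles satisfy Assumptions 1--5 listed in the context, and run Algorithm F$^2$SA (described in the context) with positive step sizes $\{\alpha_k\},\{\gamma_k\}$, multiplier increments $\delta_k\ge 0$, an integer $T\ge 1$, and $\xi>0$. Write $\beta_k:=\alpha_k\lambda_k$. Suppose that $\lambda_0\ge 2l_{f,1}/\mu_g$ and that for all $k\ge 0$ $$\beta_k\le\gamma_k\le\min\Big(\frac{1}{4l_{g,1}},\frac{1}{4T\mu_g}\Big),\qquad \alpha_k\le\min\Big(\frac{1}{8l_{f,1}},\frac{1}{2\xi l_{F,1}}\Big),$$ $$\frac{\xi}{T}<c_\xi\,\mu_g\cdot\max\big(l_{g,1}l_{*,0}^2,\ l_{*,1}\sqrt{M}\big)^{-1},\qquad \frac{\delta_k}{\lambda_k}\le\frac{T\mu_g\beta_k}{16}.$$ Then there are instance-dependent constants $C_1,C_2,C_3,C_4$ (in particular not depending on $K$) such that for every $K\ge 1$ the iterates satisfy $$\sum_{k=0}^{K-1}\xi\alpha_k\,\mathbb{E}\big[\|\nabla F(x_k)\|^2\big]\le C_1\sum_{k=0}^{K-1}\xi\alpha_k\lambda_k^{-2}+C_2\sigma_f^2\sum_{k=0}^{K-1}\alpha_k^2\lambda_k+C_3\sigma_g^2\sum_{k=0}^{K-1}\gamma_k^2\lambda_k+C_4 .$$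
   Context: Bilevel problem: minimize $F(x):=f(x,y^*(x))$ over $x\in X:=\mathbb{R}^{d_x}$, where $y^*(x):=\arg\min_{y\in\mathbb{R}^{d_y}}g(x,y)$; it is assumed that $F^*:=\inf_x F(x)>-\infty$. $\|\cdot\|$ is the Euclidean norm (operator norm for matrices). Assumption 1: $f$ is continuously differentiable and $l_{f,1}$-smooth jointly in $(x,y)$ (i.e. $\nabla f$ is $l_{f,1}$-Lipschitz); $g$ is continuously differentiable and $l_{g,1}$-smooth jointly in $(x,y)$; $\|\nabla_y f(x,y)\|\le l_{f,0}$ for all $x,y$. Assumption 2: for every $x$, $g(x,\cdot)$ is $\mu_g$-strongly convex with $\mu_g>0$; $g$ is twice continuously differentiable and $\nabla^2 g$ is $l_{g,2}$-Lipschitz jointly in $(x,y)$. Assumption 3: gradients are accessed via unbiased estimators $\nabla f(x,y;\zeta)$, $\nabla g(x,y;\phi)$ with $\mathbb{E}[\nabla f(x,y;\zeta)]=\nabla f(x,y)$, $\mathbb{E}[\nabla g(x,y;\phi)]=\nabla g(x,y)$, $\mathbb{E}\|\nabla f(x,y;\zeta)-\nabla f(x,y)\|^2\le\sigma_f^2$, $\mathbb{E}\|\nabla g(x,y;\phi)-\nabla g(x,y)\|^2\le\sigma_g^2$. Assumption 4: $\|\nabla_x f(x,y)\|\le l_{f,0}$ and $\|\nabla_x g(x,y)\|\le l_{g,0}$ for all $x,y$. Assumption 5: $f$ is twice continuously differentiable and $\nabla^2 f$ is $l_{f,2}$-Lipschitz in $(x,y)$. Constants: for $\lambda\ge 2l_{f,1}/\mu_g$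 ($\lambda>0$) let $\mathcal{L}_\lambda(x,y):=f(x,y)+\lambda(g(x,y)-g(x,y^*(x)))$ and $y_\lambda^*(x):=\arg\min_y\mathcal{L}_\lambda(x,y)$ (unique). $l_{\lambda,0}$ is a Lipschitz constant of $x\mapsto y_{\lambda'}^*(x)$ valid for all $\lambda'\ge\lambda$, with $l_{\lambda,0}\le 3l_{g,1}/\mu_g$; $l_{\lambda,1}$ is a Lipschitz constant of $x\mapsto\nabla y_{\lambda'}^*(x)$ valid for all $\lambda'\ge\lambda$, with $l_{\lambda,1}\le 32(l_{g,2}+\lambda^{-1}l_{f,2})l_{g,1}^2/\mu_g^3$. $l_{*,0}:=\max(1,l_{\lambda_0,0})$, $l_{*,1}:=l_{\lambda_0,1}$, $M:=\max(l_{f,0}^2+\sigma_f^2,\ l_{g,0}^2+\sigma_g^2)$, and $l_{F,1}$ is a Lipschitz constant of $\nabla F$. Algorithm F$^2$SA, with inputs $\{\alpha_k,\gamma_k\}$, $\{\delta_k\}$, $T$, $\xi$, $\lambda_0,x_0,y_0,z_0$: for $k=0,1,\dots,K-1$: set $z_{k,0}=z_k$, $y_{k,0}=y_k$; for $t=0,\dots,T-1$ set $z_{k,t+1}=z_{k,t}-\gamma_k\nabla_y g(x_k,z_{k,t};\phi_z^{k,t})$ and $y_{k,t+1}=y_{k,t}-\alpha_k\big(\nabla_y f(x_k,y_{k,t};\zeta_y^{k,t})+\lambda_k\nabla_y g(x_k,y_{k,t};\phi_y^{k,t})\big)$; then $z_{k+1}=z_{k,T}$, $y_{k+1}=y_{k,T}$,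 $x_{k+1}=x_k-\xi\alpha_k\big(\nabla_x f(x_k,y_{k+1};\zeta_x^k)+\lambda_k(\nabla_x g(x_k,y_{k+1};\phi_{xy}^k)-\nabla_x g(x_k,z_{k+1};\phi_{xz}^k))\big)$, and $\lambda_{k+1}=\lambda_k+\delta_k$. All samples $\zeta,\phi$ are independent. "Instance-dependent constant" means a constant depending only on the instance (Lipschitz, smoothness, strong-convexity and moment parameters $l_{f,i},l_{g,i},\mu_g,l_{F,1},M$, etc., the fixed inputs $T,\xi,\lambda_0$, and the initialization $x_0,y_0,z_0$). *)

theory Defs
  imports "HOL-Probability.Probability"
begin

section \<open>Gradients, Jacobians, Hessians\<close>

definition nabla :: "('v::euclidean_space \<Rightarrow> real) \<Rightarrow> 'v \<Rightarrow> 'v" where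
  "nabla h v = (THE D. GDERIV h v :> D)"

text \<open>The derivative as a bounded linear map, so that norms and Lipschitz constants of Jacobians
  and of Hessians (derivatives of \<^const>\<open>nabla\<close>) refer to the operator norm.\<close>

definition deriv_map :: "('u::euclidean_space \<Rightarrow> 'v::euclidean_space) \<Rightarrow> 'u \<Rightarrow> 'u \<Rightarrow>\<^sub>L 'v" where
  "deriv_map h u = Blinfun (frechet_derivative h (at u))"

definition l_smooth :: "real \<Rightarrow> ('v::euclidean_space \<Rightarrow> real) \<Rightarrow> bool" where
  "l_smooth l h \<longleftrightarrow>
     h differentiable_on UNIV \<and> continuous_on UNIV (nabla h) \<and> l-lipschitz_on UNIV (nabla h)"

definition C2_with_Lipschitz_Hessian :: "real \<Rightarrow> ('v::euclidean_space \<Rightarrow> real) \<Rightarrow> bool" where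
  "C2_with_Lipschitz_Hessian l h \<longleftrightarrow>
     h differentiable_on UNIV \<and> nabla h differentiable_on UNIV \<and>
     continuous_on UNIV (deriv_map (nabla h)) \<and> l-lipschitz_on UNIV (deriv_map (nabla h))"

definition strongly_convex :: "real \<Rightarrow> ('v::euclidean_space \<Rightarrow> real) \<Rightarrow> bool" where
  "strongly_convex \<mu> h \<longleftrightarrow>
     (\<forall>u v. \<forall>t\<in>{0..1}. h ((1 - t) *\<^sub>R u + t *\<^sub>R v)
        \<le> (1 - t) * h u + t * h v - \<mu> / 2 * t * (1 - t) * (norm (u - v))\<^sup>2)"


section \<open>The bilevel problem\<close>

text \<open>The objectives are functions on the product space \<open>'a \<times> 'b\<close>, whose norm is the
  Euclidean one.  Since they are jointly differentiable, their partial gradients with respect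
  to \<open>x\<close> and \<open>y\<close> are \<open>fst\<close> and \<open>snd\<close> of the joint gradient.\<close>

definition ystar :: "('a::euclidean_space \<times> 'b::euclidean_space \<Rightarrow> real) \<Rightarrow> 'a \<Rightarrow> 'b" where
  "ystar g x = arg_min (\<lambda>y. g (x, y)) (\<lambda>_. True)"

definition hyper_obj ::
  "('a::euclidean_space \<times> 'b::euclidean_space \<Rightarrow> real) \<Rightarrow> ('a \<times> 'b \<Rightarrow> real) \<Rightarrow> 'a \<Rightarrow> real" where
  "hyper_obj f g x = f (x, ystar g x)"

definition lagr ::
  "('a::euclidean_space \<times> 'b::euclidean_space \<Rightarrow> real) \<Rightarrow> ('a \<times> 'b \<Rightarrow> real) \<Rightarrow> real
    \<Rightarrow> 'a \<times> 'b \<Rightarrow> real" where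
  "lagr f g l = (\<lambda>(x, y). f (x, y) + l * (g (x, y) - g (x, ystar g x)))"

definition ystar_lam ::
  "('a::euclidean_space \<times> 'b::euclidean_space \<Rightarrow> real) \<Rightarrow> ('a \<times> 'b \<Rightarrow> real) \<Rightarrow> real \<Rightarrow> 'a \<Rightarrow> 'b" where
  "ystar_lam f g l = ystar (lagr f g l)"

definition bilevel_assms ::
  "('a::euclidean_space \<times> 'b::euclidean_space \<Rightarrow> real) \<Rightarrow> ('a \<times> 'b \<Rightarrow> real)
    \<Rightarrow> real \<Rightarrow> real \<Rightarrow> real \<Rightarrow> real \<Rightarrow> real \<Rightarrow> real \<Rightarrow> real \<Rightarrow> bool" where
  "bilevel_assms f g lf0 lf1 lf2 lg0 lg1 lg2 \<mu> \<longleftrightarrow>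
     l_smooth lf1 f \<and> l_smooth lg1 g \<and>
     (\<forall>p. norm (snd (nabla f p)) \<le> lf0) \<and>
     \<mu> > 0 \<and> (\<forall>x. strongly_convex \<mu> (\<lambda>y. g (x, y))) \<and>
     C2_with_Lipschitz_Hessian lg2 g \<and>
     (\<forall>p. norm (fst (nabla f p)) \<le> lf0) \<and> (\<forall>p. norm (fst (nabla g p)) \<le> lg0) \<and>
     C2_with_Lipschitz_Hessian lf2 f \<and>
     bdd_below (range (hyper_obj f g))"

text \<open>\<open>lF1\<close>, \<open>ll0\<close>, \<open>ll1\<close> are Lipschitz constants of the gradient of the hyper-objective,
  of the penalised solution maps and of their Jacobians, the latter two uniformly in
  all multipliers from \<open>l0\<close> on.\<close>

definition derived_constants ::
  "('a::euclidean_space \<times> 'b::euclidean_space \<Rightarrow> real) \<Rightarrow> ('a \<times> 'b \<Rightarrow> real)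
    \<Rightarrow> real \<Rightarrow> real \<Rightarrow> real \<Rightarrow> real \<Rightarrow> real \<Rightarrow> real \<Rightarrow> real \<Rightarrow> real \<Rightarrow> bool" where
  "derived_constants f g lf2 lg1 lg2 \<mu> l0 lF1 ll0 ll1 \<longleftrightarrow>
     lF1-lipschitz_on UNIV (nabla (hyper_obj f g)) \<and>
     (\<forall>l\<ge>l0. ll0-lipschitz_on UNIV (ystar_lam f g l)) \<and>
     ll0 \<le> 3 * lg1 / \<mu> \<and>
     (\<forall>l\<ge>l0. ystar_lam f g l differentiable_on UNIV \<and>
        ll1-lipschitz_on UNIV (deriv_map (ystar_lam f g l))) \<and>
     ll1 \<le> 32 * (lg2 + lf2 / l0) * lg1\<^sup>2 / \<mu> ^ 3"


section \<open>Stochastic gradients\<close>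

text \<open>\<open>D\<close> is the law of one sample, \<open>G p s\<close> the estimate at \<open>p\<close> from the sample \<open>s\<close>.
  Joint measurability is what makes the iterates random variables.\<close>

definition unbiased_oracle ::
  "'z measure \<Rightarrow> ('v::euclidean_space \<Rightarrow> 'z \<Rightarrow> 'v) \<Rightarrow> ('v \<Rightarrow> real) \<Rightarrow> real \<Rightarrow> bool" where
  "unbiased_oracle D G h \<sigma> \<longleftrightarrow>
     prob_space D \<and> (\<lambda>(p, s). G p s) \<in> borel_measurable (borel \<Otimes>\<^sub>M D) \<and>
     (\<forall>p. integrable D (G p) \<and> (\<integral>s. G p s \<partial>D) = nabla h p \<and>
          integrable D (\<lambda>s. (norm (G p s - nabla h p))\<^sup>2) \<and>
          (\<integral>s. (norm (G p s - nabla h p))\<^sup>2 \<partial>D) \<le> \<sigma>\<^sup>2)"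

datatype sample =
  Zeta_y nat nat | Zeta_x nat | Phi_y nat nat | Phi_z nat nat | Phi_xy nat | Phi_xz nat

text \<open>Samples for \<open>f\<close> and for \<open>g\<close> are values of one type \<open>'z\<close>; no generality is lost, as
  two sample types can be replaced by their disjoint sum.\<close>

fun sample_law :: "'z measure \<Rightarrow> 'z measure \<Rightarrow> sample \<Rightarrow> 'z measure" where
  "sample_law Df Dg (Zeta_y k t) = Df"
| "sample_law Df Dg (Zeta_x k) = Df"
| "sample_law Df Dg (Phi_y k t) = Dg"
| "sample_law Df Dg (Phi_z k t) = Dg"
| "sample_law Df Dg (Phi_xy k) = Dg"
| "sample_law Df Dg (Phi_xz k) = Dg"

definition independent_samples ::
  "'w measure \<Rightarrow> 'z measure \<Rightarrow> 'z measure \<Rightarrow> (sample \<Rightarrow> 'w \<Rightarrow> 'z) \<Rightarrow> bool" where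
  "independent_samples P Df Dg S \<longleftrightarrow>
     prob_space P \<and>
     prob_space.indep_vars P (sample_law Df Dg) S UNIV \<and>
     (\<forall>i. distr P (sample_law Df Dg i) (S i) = sample_law Df Dg i)"


section \<open>The algorithm\<close>

primrec lam :: "real \<Rightarrow> (nat \<Rightarrow> real) \<Rightarrow> nat \<Rightarrow> real" where
  "lam l0 \<delta> 0 = l0"
| "lam l0 \<delta> (Suc k) = lam l0 \<delta> k + \<delta> k"

text \<open>In the following, \<open>s\<close> is one realisation of all samples.\<close>

primrec z_inner ::
  "('a \<times> 'b::euclidean_space \<Rightarrow> 'z \<Rightarrow> 'a \<times> 'b) \<Rightarrow> real \<Rightarrow> (sample \<Rightarrow> 'z) \<Rightarrow> nat
    \<Rightarrow> 'a \<Rightarrow> 'b \<Rightarrow> nat \<Rightarrow> 'b" where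
  "z_inner Gg \<gamma> s k x z 0 = z"
| "z_inner Gg \<gamma> s k x z (Suc t) =
     (let w = z_inner Gg \<gamma> s k x z t in w - \<gamma> *\<^sub>R snd (Gg (x, w) (s (Phi_z k t))))"

primrec y_inner ::
  "('a \<times> 'b::euclidean_space \<Rightarrow> 'z \<Rightarrow> 'a \<times> 'b) \<Rightarrow> ('a \<times> 'b \<Rightarrow> 'z \<Rightarrow> 'a \<times> 'b)
    \<Rightarrow> real \<Rightarrow> real \<Rightarrow> (sample \<Rightarrow> 'z) \<Rightarrow> nat \<Rightarrow> 'a \<Rightarrow> 'b \<Rightarrow> nat \<Rightarrow> 'b" where
  "y_inner Gf Gg \<alpha> l s k x y 0 = y"
| "y_inner Gf Gg \<alpha> l s k x y (Suc t) =
     (let w = y_inner Gf Gg \<alpha> l s k x y t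
      in w - \<alpha> *\<^sub>R (snd (Gf (x, w) (s (Zeta_y k t))) + l *\<^sub>R snd (Gg (x, w) (s (Phi_y k t)))))"

primrec F2SA ::
  "('a::euclidean_space \<times> 'b::euclidean_space \<Rightarrow> 'z \<Rightarrow> 'a \<times> 'b)
    \<Rightarrow> ('a \<times> 'b \<Rightarrow> 'z \<Rightarrow> 'a \<times> 'b)
    \<Rightarrow> (nat \<Rightarrow> real) \<Rightarrow> (nat \<Rightarrow> real) \<Rightarrow> (nat \<Rightarrow> real) \<Rightarrow> nat \<Rightarrow> real \<Rightarrow> real
    \<Rightarrow> 'a \<Rightarrow> 'b \<Rightarrow> 'b \<Rightarrow> (sample \<Rightarrow> 'z) \<Rightarrow> nat \<Rightarrow> 'a \<times> 'b \<times> 'b" where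
  "F2SA Gf Gg \<alpha> \<gamma> \<delta> T \<xi> l0 x0 y0 z0 s 0 = (x0, y0, z0)"
| "F2SA Gf Gg \<alpha> \<gamma> \<delta> T \<xi> l0 x0 y0 z0 s (Suc k) =
     (case F2SA Gf Gg \<alpha> \<gamma> \<delta> T \<xi> l0 x0 y0 z0 s k of (x, y, z) \<Rightarrow>
       let l = lam l0 \<delta> k;
           z' = z_inner Gg (\<gamma> k) s k x z T;
           y' = y_inner Gf Gg (\<alpha> k) l s k x y T;
           x' = x - (\<xi> * \<alpha> k) *\<^sub>R
                 (fst (Gf (x, y') (s (Zeta_x k)))
                  + l *\<^sub>R (fst (Gg (x, y') (s (Phi_xy k))) - fst (Gg (x, z') (s (Phi_xz k)))))
       in (x', y', z'))"


section \<open>Constants in the step-size conditions\<close>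

text \<open>The constant in the bound on \<open>\<xi> / T\<close> has to be absolute, that is, the same for all
  dimensions.  Dimensions are types here, and a quantifier \<open>\<exists>c\<close> inside a statement would let
  the constant depend on them.  It is therefore given by an explicit numeral.\<close>

definition c_xi :: real where
  "c_xi = 1 / 1000"

definition moment_bound :: "real \<Rightarrow> real \<Rightarrow> real \<Rightarrow> real \<Rightarrow> real" where
  "moment_bound lf0 \<sigma>f lg0 \<sigma>g = max (lf0\<^sup>2 + \<sigma>f\<^sup>2) (lg0\<^sup>2 + \<sigma>g\<^sup>2)"

text \<open>The two bounds on \<open>\<alpha> k\<close> are written without division, so that a smoothness constant
  zero imposes no bound (whereas \<open>1 / 0 = 0\<close> would be contradictory).\<close>

definition step_conditions ::
  "(nat \<Rightarrow> real) \<Rightarrow> (nat \<Rightarrow> real) \<Rightarrow> (nat \<Rightarrow> real) \<Rightarrow> nat \<Rightarrow> real \<Rightarrow> real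
    \<Rightarrow> real \<Rightarrow> real \<Rightarrow> real \<Rightarrow> real \<Rightarrow> bool" where
  "step_conditions \<alpha> \<gamma> \<delta> T \<xi> l0 lf1 lg1 \<mu> lF1 \<longleftrightarrow>
     (\<forall>k. let l = lam l0 \<delta> k; \<beta> = \<alpha> k * l in
        \<alpha> k > 0 \<and> \<gamma> k > 0 \<and> \<delta> k \<ge> 0 \<and>
        \<beta> \<le> \<gamma> k \<and> \<gamma> k \<le> min (1 / (4 * lg1)) (1 / (4 * real T * \<mu>)) \<and>
        8 * lf1 * \<alpha> k \<le> 1 \<and> 2 * \<xi> * lF1 * \<alpha> k \<le> 1 \<and>
        \<delta> k / l \<le> real T * \<mu> * \<beta> / 16)"

end

theory Submission
  imports Defs
begin

text \<open>
  For a multiplier \<open>\<lambda>\<close> let \<open>y*\<^sub>\<lambda>(x)\<close> be the minimiser of \<open>f(x, \<cdot>) + \<lambda> g(x, \<cdot>)\<close> and \<open>y*(x)\<close> that of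
  \<open>g(x, \<cdot>)\<close>; let \<open>F\<close> be the hyper-objective and \<open>\<beta>\<^sub>k = \<alpha>\<^sub>k \<lambda>\<^sub>k\<close>.  The theorem holds because the potential
  \<open>E F(x\<^sub>k) + w \<lambda>\<^sub>k (E|y\<^sub>k - y*\<^sub>\<lambda>(x\<^sub>k)|\<^sup>2 + E|z\<^sub>k - y*(x\<^sub>k)|\<^sup>2) + d / \<lambda>\<^sub>k\<close>, where \<open>\<lambda> = \<lambda>\<^sub>k\<close> in \<open>y*\<^sub>\<lambda>\<close>,
  decreases in each outer iteration by \<open>\<xi> \<alpha>\<^sub>k / 2 E|\<nabla>F(x\<^sub>k)|\<^sup>2\<close>, up to the summands on the right-hand
  side of the claim (lemma \<open>potential_decrease\<close>).  As \<open>F\<close> is bounded below, summation over \<open>k\<close>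
  finishes the proof.  Five effects enter the balance.

  \<^item> Bias.  The gradient of \<open>x \<mapsto> min\<^sub>y (f + \<lambda> (g - min g))\<close> differs from \<open>\<nabla>F\<close> by \<open>O(1/\<lambda>)\<close>
    (\<open>penalised_grad_bias\<close>); this is the sum with \<open>C1\<close>.  The direction used by the algorithm differs
    from that gradient by at most \<open>O(\<lambda>)\<close> times the distances of \<open>y\<close> and \<open>z\<close> to their targets (\<open>gradient_error\<close>).
  \<^item> Contraction.  \<open>T\<close> inner steps shrink the squared distances by the factor \<open>1 - 7/16 s\<close>, where
    \<open>s = T \<mu> \<beta>\<^sub>k\<close> (\<open>y_gap_end_le\<close>, \<open>z_gap_end_le\<close>).  A part of this pays for the
    error of the direction.
  \<^item> Motion of the targets with \<open>x\<close> (\<open>cond_noise_tracking\<close>).  The targets are Lipschitz with a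
    quadratic Taylor remainder.  Therefore their mean motion is of the order of the mean direction,
    and the noise of the \<open>x\<close>-step enters in second order only.  The mean direction is absorbed by the
    negative multiple of its square in the descent inequality of \<open>F\<close>, because \<open>\<xi> / T\<close> is small.
  \<^item> Growth of the multiplier.  It moves \<open>y*\<^sub>\<lambda>\<close> by a multiple of \<open>1/\<lambda>\<^sub>k - 1/\<lambda>\<^sub>k\<^sub>+\<^sub>1\<close>
    (\<open>ystar_lam_change\<close>), which telescopes and is the reason for the term \<open>d / \<lambda>\<^sub>k\<close>.
  \<^item> Variance of the samples (\<open>noise_terms\<close>); these are the sums with \<open>C2\<close> and \<open>C3\<close>.

  The differentiability of \<open>y*\<close> is obtained from that of \<open>y*\<^sub>\<lambda>\<close>: the constants are uniform in
  the multiplier and survive the limit \<open>\<lambda> \<rightarrow> \<infinity>\<close>.  Conditional expectations enter through the notion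
  \<open>cond_noise\<close> of noise that is centred and of bounded variance given the current iterates.
\<close>


section \<open>Gradients and quadratic bounds\<close>

lemma GDERIV_nabla:
  fixes h :: "'v::euclidean_space \<Rightarrow> real"
  assumes "h differentiable (at v)"
  shows "GDERIV h v :> nabla h v"
proof -
  obtain h' where h': "(h has_derivative h') (at v)"
    using assms by (auto simp: differentiable_def)
  interpret h': bounded_linear h'
    using h' by (rule has_derivative_bounded_linear)
  define D where "D = (\<Sum>b\<in>Basis. h' b *\<^sub>R b)"
  have "h' = (\<lambda>d. d \<bullet> D)"
  proof
    fix d
    have "h' d = h' (\<Sum>b\<in>Basis. (d \<bullet> b) *\<^sub>R b)" by (simp add: euclidean_representation)
    also have "\<dots> = d \<bullet> D"
      by (simp add: D_def h'.sum h'.scaleR inner_sum_right mult.commute)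
    finally show "h' d = d \<bullet> D" .
  qed
  then have D: "GDERIV h v :> D" using h' by (simp add: gderiv_def)
  have "E = D" if "GDERIV h v :> E" for E
  proof -
    have "(\<lambda>d. d \<bullet> E) = (\<lambda>d. d \<bullet> D)"
      using D that unfolding gderiv_def by (metis has_derivative_unique)
    then show "E = D" by (metis inner_commute vector_eq_ldot)
  qed
  then show ?thesis unfolding nabla_def using D by (metis theI)
qed

lemma nabla_unique:
  fixes h :: "'v::euclidean_space \<Rightarrow> real"
  assumes "GDERIV h v :> D"
  shows "nabla h v = D"
proof -
  have "h differentiable (at v)" using assms by (auto simp: gderiv_def differentiable_def)
  then have "GDERIV h v :> nabla h v" by (rule GDERIV_nabla)
  then have "(\<lambda>d. d \<bullet> nabla h v) = (\<lambda>d. d \<bullet> D)"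
    using assms unfolding gderiv_def by (metis has_derivative_unique)
  then show ?thesis by (metis inner_commute vector_eq_ldot)
qed

lemma GDERIV_along_line:
  fixes h :: "'v::euclidean_space \<Rightarrow> real"
  assumes "h differentiable_on UNIV"
  shows "((\<lambda>t. h (v + t *\<^sub>R d)) has_real_derivative nabla h (v + t *\<^sub>R d) \<bullet> d) (at t)"
proof -
  have "(h has_derivative (\<lambda>e. e \<bullet> nabla h (v + t *\<^sub>R d))) (at (v + t *\<^sub>R d))"
    using assms GDERIV_nabla unfolding gderiv_def differentiable_on_def by auto
  moreover have "((\<lambda>t. v + t *\<^sub>R d) has_derivative (\<lambda>s. s *\<^sub>R d)) (at t)"
    by (auto intro!: derivative_eq_intros)
  ultimately have "((\<lambda>t. h (v + t *\<^sub>R d)) has_derivative (\<lambda>s. (s *\<^sub>R d) \<bullet> nabla h (v + t *\<^sub>R d))) (at t)"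
    using has_derivative_compose by blast
  then show ?thesis
    by (simp add: has_field_derivative_def inner_commute mult_commute_abs)
qed

text \<open>The descent lemma.  The factor \<open>1/2\<close> is what leaves half of the strong convexity of \<open>\<lambda> g\<close> to
  \<open>f + \<lambda> g\<close>, and a negative multiple of the squared direction in the descent of \<open>F\<close>.\<close>

lemma quadratic_upper_bound:
  fixes h :: "'v::euclidean_space \<Rightarrow> real"
  assumes h: "h differentiable_on UNIV" and L: "L-lipschitz_on UNIV (nabla h)"
  shows "h u \<le> h v + nabla h v \<bullet> (u - v) + L / 2 * (norm (u - v))\<^sup>2"
proof -
  define d where "d = u - v"
  define \<psi> where "\<psi> t = h (v + t *\<^sub>R d) - t * (nabla h v \<bullet> d) - L / 2 * t\<^sup>2 * (norm d)\<^sup>2" for t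
  have "\<psi> 1 \<le> \<psi> 0"
  proof (rule DERIV_nonpos_imp_nonincreasing[where f = \<psi> and a = 0 and b = 1])
    show "0 \<le> (1::real)" by simp
    fix t :: real assume t: "0 \<le> t" "t \<le> 1"
    have "(nabla h (v + t *\<^sub>R d) - nabla h v) \<bullet> d \<le> norm (nabla h (v + t *\<^sub>R d) - nabla h v) * norm d"
      by (rule norm_cauchy_schwarz)
    also have "\<dots> \<le> (L * norm (t *\<^sub>R d)) * norm d"
      using lipschitz_onD[OF L, of "v + t *\<^sub>R d" v] by (intro mult_right_mono) (auto simp: dist_norm)
    finally have "nabla h (v + t *\<^sub>R d) \<bullet> d - nabla h v \<bullet> d - L * t * (norm d)\<^sup>2 \<le> 0"
      using t by (simp add: inner_diff_left power2_eq_square algebra_simps)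
    moreover have "DERIV \<psi> t :> nabla h (v + t *\<^sub>R d) \<bullet> d - nabla h v \<bullet> d - L * t * (norm d)\<^sup>2"
      unfolding \<psi>_def by (auto intro!: derivative_eq_intros GDERIV_along_line[OF h])
    ultimately show "\<exists>y. DERIV \<psi> t :> y \<and> y \<le> 0" by blast
  qed
  then show ?thesis by (simp add: \<psi>_def d_def)
qed

lemma quadratic_lower_bound:
  fixes h :: "'v::euclidean_space \<Rightarrow> real"
  assumes h: "h differentiable_on UNIV" and L: "L-lipschitz_on UNIV (nabla h)"
  shows "h v + nabla h v \<bullet> (u - v) - L / 2 * (norm (u - v))\<^sup>2 \<le> h u"
proof -
  have neg: "nabla (\<lambda>w. - h w) = (\<lambda>w. - nabla h w)"
    using h by (auto intro!: nabla_unique GDERIV_minus GDERIV_nabla simp: differentiable_on_def)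
  have "- h u \<le> - h v + (- nabla h v) \<bullet> (u - v) + L / 2 * (norm (u - v))\<^sup>2"
    using quadratic_upper_bound[of "\<lambda>w. - h w" L u v] h L
    by (auto simp: neg lipschitz_on_minus)
  then show ?thesis by simp
qed

section \<open>Strongly convex functions with quadratic upper bounds\<close>

text \<open>Strong convexity and smoothness of \<open>h\<close> with gradient \<open>G\<close>, expressed by quadratic bounds.  The
  lower-level objective and the Lagrangian, as functions of \<open>y\<close> at a fixed \<open>x\<close>, are used in this form.\<close>

definition quad_bounded :: "real \<Rightarrow> real \<Rightarrow> ('v::euclidean_space \<Rightarrow> real) \<Rightarrow> ('v \<Rightarrow> 'v) \<Rightarrow> bool" where
  "quad_bounded m L h G \<longleftrightarrow> 0 < m \<and> continuous_on UNIV h \<and>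
     (\<forall>u v. h u + G u \<bullet> (v - u) + m / 2 * (norm (v - u))\<^sup>2 \<le> h v \<and>
            h v \<le> h u + G u \<bullet> (v - u) + L / 2 * (norm (v - u))\<^sup>2)"

lemma quad_bounded_le:
  fixes h :: "'v::euclidean_space \<Rightarrow> real"
  assumes "quad_bounded m L h G"
  shows "m \<le> L"
proof -
  obtain b :: 'v where "b \<in> Basis" using nonempty_Basis by blast
  then have "norm b = 1" by simp
  moreover have "h 0 + G 0 \<bullet> (b - 0) + m / 2 * (norm (b - 0))\<^sup>2 \<le> h 0 + G 0 \<bullet> (b - 0) + L / 2 * (norm (b - 0))\<^sup>2"
    using assms unfolding quad_bounded_def by (meson order_trans)
  ultimately show ?thesis by simp
qed

lemma quad_bounded_has_minimiser:
  fixes h :: "'v::euclidean_space \<Rightarrow> real"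
  assumes q: "quad_bounded m L h G"
  shows "\<exists>y. \<forall>v. h y \<le> h v"
proof -
  have m: "m > 0" and c: "continuous_on UNIV h"
    and lo: "h 0 + G 0 \<bullet> v + m / 2 * (norm v)\<^sup>2 \<le> h v" for v
    using q unfolding quad_bounded_def by (auto dest: spec[of _ 0])
  \<comment> \<open>Outside this radius the quadratic term of the lower bound at \<open>0\<close> beats the linear one.\<close>
  define R where "R = 2 * norm (G 0) / m"
  have "R \<ge> 0" using m by (simp add: R_def)
  obtain y where y: "y \<in> cball 0 R" "\<And>v. v \<in> cball 0 R \<Longrightarrow> h y \<le> h v"
    using continuous_attains_inf[of "cball 0 R" h] c \<open>R \<ge> 0\<close>
    by (metis cball_eq_empty compact_cball continuous_on_subset linorder_not_less subset_UNIV)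
  have "h y \<le> h v" for v
  proof (cases "v \<in> cball 0 R")
    case False
    then have "norm v > R" by simp
    then have "norm (G 0) * norm v \<le> m / 2 * norm v * norm v"
      using m by (intro mult_right_mono) (auto simp: R_def field_simps)
    moreover have "- (G 0 \<bullet> v) \<le> norm (G 0) * norm v"
      using norm_cauchy_schwarz[of "- G 0" v] by simp
    ultimately have "h 0 \<le> h v"
      using lo[of v] by (simp add: power2_eq_square)
    then show ?thesis using y(2)[of 0] \<open>R \<ge> 0\<close> by simp
  qed (use y in auto)
  then show ?thesis by blast
qed

text \<open>The minimum lies below the value after a gradient step of length \<open>1/L\<close>.\<close>

lemma quad_bounded_gradient_gap:
  fixes h :: "'v::euclidean_space \<Rightarrow> real"
  assumes q: "quad_bounded m L h G" and y: "\<And>v. h y \<le> h v"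
  shows "(norm (G u))\<^sup>2 \<le> 2 * L * (h u - h y)"
proof -
  have L: "L > 0" using quad_bounded_le[OF q] q by (simp add: quad_bounded_def)
  have "h y \<le> h (u - (1 / L) *\<^sub>R G u)" by (rule y)
  also have "\<dots> \<le> h u + G u \<bullet> (- (1 / L) *\<^sub>R G u) + L / 2 * (norm (- (1 / L) *\<^sub>R G u))\<^sup>2"
    using q[unfolded quad_bounded_def, THEN conjunct2, THEN conjunct2, rule_format, of u "u - (1 / L) *\<^sub>R G u"]
    by simp
  also have "\<dots> = h u - (norm (G u))\<^sup>2 / (2 * L)"
    using L by (simp add: power2_norm_eq_inner[symmetric] field_simps power2_eq_square dot_square_norm)
  finally show ?thesis using L by (simp add: field_simps)
qed

lemma quad_bounded_stationary:
  assumes q: "quad_bounded m L h G" and y: "\<And>v. h y \<le> h v"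
  shows "G y = 0"
  using quad_bounded_gradient_gap[OF q y, of y] by simp

lemma quad_bounded_strongly_monotone:
  assumes q: "quad_bounded m L h G"
  shows "m * (norm (u - v))\<^sup>2 \<le> (G u - G v) \<bullet> (u - v)"
proof -
  have "h u + G u \<bullet> (v - u) + m / 2 * (norm (v - u))\<^sup>2 \<le> h v"
       "h v + G v \<bullet> (u - v) + m / 2 * (norm (u - v))\<^sup>2 \<le> h u"
    using q by (auto simp: quad_bounded_def)
  then show ?thesis
    by (simp add: norm_minus_commute inner_diff_left inner_diff_right)
qed

lemma quad_bounded_dist_le_gradient:
  assumes q: "quad_bounded m L h G" and y: "\<And>v. h y \<le> h v"
  shows "norm (u - y) \<le> norm (G u) / m"
proof -
  have m: "m > 0" using q by (simp add: quad_bounded_def)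
  have "m * norm (u - y) * norm (u - y) \<le> norm (G u) * norm (u - y)"
    using quad_bounded_strongly_monotone[OF q, of u y] quad_bounded_stationary[OF q y]
      norm_cauchy_schwarz[of "G u" "u - y"] by (simp add: power2_eq_square)
  then show ?thesis using m
    by (cases "norm (u - y) = 0") (auto simp: field_simps)
qed

lemma norm_diff_scaleR_sq:
  fixes a b :: "'v::real_inner"
  shows "(norm (a - r *\<^sub>R b))\<^sup>2 = (norm a)\<^sup>2 - 2 * r * (a \<bullet> b) + r\<^sup>2 * (norm b)\<^sup>2"
  unfolding power2_norm_eq_inner
  by (simp add: inner_diff_left inner_diff_right inner_commute power2_eq_square algebra_simps)

text \<open>Strong convexity provides the gap \<open>h u - h y\<close> in the cross term.  By \<open>quad_bounded_gradient_gap\<close>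
  it pays for the quadratic term \<open>a\<^sup>2 |G u|\<^sup>2\<close>.\<close>

lemma quad_bounded_gradient_step:
  assumes q: "quad_bounded m L h G" and y: "\<And>v. h y \<le> h v"
    and a: "0 \<le> a" "a * L \<le> 1"
  shows "(norm (u - a *\<^sub>R G u - y))\<^sup>2 \<le> (1 - a * m) * (norm (u - y))\<^sup>2"
proof -
  have "h u + G u \<bullet> (y - u) + m / 2 * (norm (y - u))\<^sup>2 \<le> h y"
    using q by (auto simp: quad_bounded_def)
  then have 1: "h u - h y + m / 2 * (norm (u - y))\<^sup>2 \<le> (u - y) \<bullet> G u"
    by (simp add: norm_minus_commute inner_diff_left inner_diff_right inner_commute)
  have "a\<^sup>2 * (norm (G u))\<^sup>2 \<le> a\<^sup>2 * (2 * L * (h u - h y))"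
    using quad_bounded_gradient_gap[OF q y, of u] by (intro mult_left_mono) auto
  also have "\<dots> = (a * L) * (2 * a * (h u - h y))" by (simp add: power2_eq_square)
  also have "\<dots> \<le> 1 * (2 * a * (h u - h y))"
    using a y[of u] by (intro mult_right_mono) auto
  finally have 2: "a\<^sup>2 * (norm (G u))\<^sup>2 \<le> 2 * a * (h u - h y)" by simp
  have "(norm (u - a *\<^sub>R G u - y))\<^sup>2 = (norm ((u - y) - a *\<^sub>R G u))\<^sup>2"
    by (simp add: algebra_simps)
  also have "\<dots> = (norm (u - y))\<^sup>2 - 2 * a * ((u - y) \<bullet> G u) + a\<^sup>2 * (norm (G u))\<^sup>2"
    by (rule norm_diff_scaleR_sq)
  also have "\<dots> \<le> (norm (u - y))\<^sup>2 - 2 * a * (h u - h y + m / 2 * (norm (u - y))\<^sup>2) + 2 * a * (h u - h y)"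
    using mult_left_mono[OF 1, of "2 * a"] a 2 by linarith
  also have "\<dots> = (1 - a * m) * (norm (u - y))\<^sup>2" by (simp add: algebra_simps)
  finally show ?thesis .
qed

text \<open>The convexity inequality at \<open>u + t (v - u)\<close>, divided by \<open>t\<close>, in the limit \<open>t \<rightarrow> 0\<close>.\<close>

lemma strongly_convex_gradient_bound:
  fixes h :: "'v::euclidean_space \<Rightarrow> real"
  assumes sc: "strongly_convex \<mu> h" and G: "GDERIV h u :> G"
  shows "h u + G \<bullet> (v - u) + \<mu> / 2 * (norm (v - u))\<^sup>2 \<le> h v"
proof -
  define d where "d = v - u"
  have "((\<lambda>t. u + t *\<^sub>R d) has_derivative (\<lambda>s. s *\<^sub>R d)) (at 0)"
    by (auto intro!: derivative_eq_intros)
  moreover have "(h has_derivative (\<lambda>e. e \<bullet> G)) (at (u + 0 *\<^sub>R d))"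
    using G by (simp add: gderiv_def)
  ultimately have "((\<lambda>t. h (u + t *\<^sub>R d)) has_derivative (\<lambda>s. (s *\<^sub>R d) \<bullet> G)) (at 0)"
    using has_derivative_compose by blast
  then have "((\<lambda>t. h (u + t *\<^sub>R d)) has_real_derivative (G \<bullet> d)) (at 0)"
    by (simp add: has_field_derivative_def inner_commute mult_commute_abs)
  then have "((\<lambda>t. (h (u + t *\<^sub>R d) - h u) / t) \<longlongrightarrow> G \<bullet> d) (at 0)"
    by (simp add: DERIV_def)
  then have lim: "((\<lambda>t. (h (u + t *\<^sub>R d) - h u) / t) \<longlongrightarrow> G \<bullet> d) (at_right 0)"
    by (rule filterlim_mono) (auto simp: at_within_le_at)
  have lim2: "((\<lambda>t. h v - h u - \<mu> / 2 * (1 - t) * (norm d)\<^sup>2) \<longlongrightarrow> h v - h u - \<mu> / 2 * (1 - 0) * (norm d)\<^sup>2) (at_right 0)"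
    by (intro tendsto_intros)
  have "eventually (\<lambda>t. (h (u + t *\<^sub>R d) - h u) / t \<le> h v - h u - \<mu> / 2 * (1 - t) * (norm d)\<^sup>2) (at_right (0::real))"
  proof -
    have "eventually (\<lambda>t. t \<in> {0<..<1}) (at_right (0::real))"
      by (rule eventually_at_right_real) simp
    then show ?thesis
    proof eventually_elim
      case (elim t)
      have "h ((1 - t) *\<^sub>R u + t *\<^sub>R v) \<le> (1 - t) * h u + t * h v - \<mu> / 2 * t * (1 - t) * (norm (u - v))\<^sup>2"
        using sc elim by (auto simp: strongly_convex_def)
      moreover have "(1 - t) *\<^sub>R u + t *\<^sub>R v = u + t *\<^sub>R d" by (simp add: d_def algebra_simps)
      ultimately have "h (u + t *\<^sub>R d) - h u \<le> t * (h v - h u - \<mu> / 2 * (1 - t) * (norm d)\<^sup>2)"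
        by (simp add: d_def norm_minus_commute algebra_simps)
      then show ?case using elim by (simp add: field_simps)
    qed
  qed
  then have "G \<bullet> d \<le> h v - h u - \<mu> / 2 * (1 - 0) * (norm d)\<^sup>2"
    by (rule tendsto_le[OF _ lim2 lim, rotated]) simp
  then show ?thesis by (simp add: d_def)
qed

section \<open>Symmetry of the second derivative\<close>

lemma deriv_map_has_derivative:
  assumes "\<phi> differentiable_on UNIV"
  shows "(\<phi> has_derivative deriv_map \<phi> w) (at w)"
proof -
  have "(\<phi> has_derivative frechet_derivative \<phi> (at w)) (at w)"
    using assms by (simp add: differentiable_on_def frechet_derivative_works)
  then show ?thesis unfolding deriv_map_def
    by (simp add: bounded_linear_Blinfun_apply has_derivative_bounded_linear)
qed

lemma deriv_map_Taylor:
  fixes \<phi> :: "'u::euclidean_space \<Rightarrow> 'v::euclidean_space"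
  assumes d: "\<phi> differentiable_on UNIV" and L: "L-lipschitz_on UNIV (deriv_map \<phi>)"
  shows "norm (\<phi> v - \<phi> u - deriv_map \<phi> u (v - u)) \<le> L * (norm (v - u))\<^sup>2"
proof -
  let ?S = "closed_segment u v"
  have "norm (\<phi> v - \<phi> u - deriv_map \<phi> u (v - u)) \<le> norm (v - u) * (L * norm (v - u))"
  proof (rule differentiable_bound_linearization[where S = ?S])
    show "u + t *\<^sub>R (v - u) \<in> ?S" if "t \<in> {0..1}" for t
      using that by (auto simp: in_segment algebra_simps intro!: exI[of _ t])
    show "(\<phi> has_derivative deriv_map \<phi> w) (at w within ?S)" for w
      using deriv_map_has_derivative[OF d] by (rule has_derivative_at_withinI)
    fix w assume w: "w \<in> ?S"
    have "onorm (\<lambda>i. deriv_map \<phi> w i - deriv_map \<phi> u i) = norm (deriv_map \<phi> w - deriv_map \<phi> u)"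
      by (simp add: norm_blinfun.rep_eq minus_blinfun.rep_eq)
    also have "\<dots> \<le> L * norm (w - u)"
      using lipschitz_onD[OF L, of w u] by (simp add: dist_norm)
    also have "\<dots> \<le> L * norm (v - u)"
      using w lipschitz_on_nonneg[OF L] segment_bound(1)[of w u v]
      by (intro mult_left_mono) auto
    finally show "onorm (blinfun_apply (deriv_map \<phi> w) - blinfun_apply (deriv_map \<phi> u)) \<le> L * norm (v - u)"
      by (simp add: fun_diff_def)
  qed auto
  then show ?thesis by (simp add: power2_eq_square mult_ac)
qed

lemma le_of_le_add_small:
  fixes a b c :: real
  assumes "\<And>t. 0 < t \<Longrightarrow> t \<le> 1 \<Longrightarrow> a \<le> b + t * c"
  shows "a \<le> b"
proof (rule field_le_epsilon)
  fix e :: real assume "e > 0"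
  define t where "t = min 1 (e / (\<bar>c\<bar> + 1))"
  have t: "0 < t" "t \<le> 1" using \<open>e > 0\<close> by (auto simp: t_def)
  have "t * c \<le> t * (\<bar>c\<bar> + 1)" using t by (intro mult_left_mono) auto
  also have "\<dots> \<le> e / (\<bar>c\<bar> + 1) * (\<bar>c\<bar> + 1)" by (intro mult_right_mono) (auto simp: t_def)
  finally have "t * c \<le> e" by simp
  then show "a \<le> b + e" using assms[OF t] by simp
qed

text \<open>The mean value theorem in direction \<open>b\<close>, applied to \<open>w \<mapsto> h (w + a) - h w\<close>.  The error is of
  third order in \<open>(a, b)\<close>.\<close>

lemma second_difference_bound:
  fixes h :: "'v::euclidean_space \<Rightarrow> real"
  assumes h: "h differentiable_on UNIV" and d: "nabla h differentiable_on UNIV"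
    and L: "L-lipschitz_on UNIV (deriv_map (nabla h))"
  shows "\<bar>h (u + a + b) - h (u + a) - h (u + b) + h u - deriv_map (nabla h) u a \<bullet> b\<bar>
           \<le> L * ((norm a)\<^sup>2 * norm b + norm a * (norm b)\<^sup>2)"
proof -
  let ?H = "deriv_map (nabla h)"
  have L0: "L \<ge> 0" using L by (rule lipschitz_on_nonneg)
  obtain s where s: "0 < s" "s < 1"
    and eq: "(h (u + a + 1 *\<^sub>R b) - h (u + 1 *\<^sub>R b)) - (h (u + a + 0 *\<^sub>R b) - h (u + 0 *\<^sub>R b))
       = (1 - 0) * (nabla h (u + a + s *\<^sub>R b) \<bullet> b - nabla h (u + s *\<^sub>R b) \<bullet> b)"
    using MVT2[of 0 1 "\<lambda>s. h (u + a + s *\<^sub>R b) - h (u + s *\<^sub>R b)"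
        "\<lambda>s. nabla h (u + a + s *\<^sub>R b) \<bullet> b - nabla h (u + s *\<^sub>R b) \<bullet> b"]
    by (fastforce intro!: derivative_eq_intros GDERIV_along_line[OF h])
  let ?v = "u + s *\<^sub>R b"
  have "norm (nabla h (?v + a) - nabla h ?v - ?H ?v a) \<le> L * (norm a)\<^sup>2"
    using deriv_map_Taylor[OF d L, of "?v + a" ?v] by simp
  moreover have "norm (?H ?v a - ?H u a) \<le> L * norm b * norm a"
  proof -
    have "norm (?H ?v a - ?H u a) \<le> norm (?H ?v - ?H u) * norm a"
      by (metis blinfun.diff_left norm_blinfun)
    also have "norm (?H ?v - ?H u) \<le> L * norm (s *\<^sub>R b)"
      using lipschitz_onD[OF L, of ?v u] by (simp add: dist_norm)
    also have "\<dots> \<le> L * norm b"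
      using s L0 by (intro mult_left_mono) (auto intro!: mult_left_le_one_le)
    finally show ?thesis by (simp add: mult_right_mono)
  qed
  ultimately have "norm (nabla h (?v + a) - nabla h ?v - ?H u a) \<le> L * (norm a)\<^sup>2 + L * norm b * norm a"
    using norm_triangle_ineq[of "nabla h (?v + a) - nabla h ?v - ?H ?v a" "?H ?v a - ?H u a"] by simp
  then have "norm (nabla h (?v + a) - nabla h ?v - ?H u a) * norm b \<le> (L * (norm a)\<^sup>2 + L * norm b * norm a) * norm b"
    by (rule mult_right_mono) simp
  then have "\<bar>(nabla h (?v + a) - nabla h ?v - ?H u a) \<bullet> b\<bar> \<le> (L * (norm a)\<^sup>2 + L * norm b * norm a) * norm b"
    using Cauchy_Schwarz_ineq2 order_trans by blast
  moreover have "?v + a = u + a + s *\<^sub>R b" by (simp add: algebra_simps)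
  ultimately show ?thesis
    using eq by (simp add: inner_diff_left algebra_simps power2_eq_square)
qed

text \<open>The second difference is symmetric in \<open>a\<close> and \<open>b\<close>.  Scaling both by \<open>t\<close> isolates the second
  derivative at the order \<open>t\<^sup>2\<close>, against an error \<open>O(t\<^sup>3)\<close>.\<close>

lemma hessian_symmetric:
  fixes h :: "'v::euclidean_space \<Rightarrow> real"
  assumes "C2_with_Lipschitz_Hessian L h"
  shows "deriv_map (nabla h) u a \<bullet> b = deriv_map (nabla h) u b \<bullet> a"
proof -
  let ?H = "deriv_map (nabla h) u"
  have h: "h differentiable_on UNIV" "nabla h differentiable_on UNIV"
    "L-lipschitz_on UNIV (deriv_map (nabla h))"
    using assms by (auto simp: C2_with_Lipschitz_Hessian_def)
  define C where "C = L * ((norm a)\<^sup>2 * norm b + norm a * (norm b)\<^sup>2)"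
  have "\<bar>?H a \<bullet> b - ?H b \<bullet> a\<bar> \<le> 0 + t * (2 * C)" if t: "0 < t" for t :: real
  proof -
    have 1: "\<bar>h (u + t *\<^sub>R a + t *\<^sub>R b) - h (u + t *\<^sub>R a) - h (u + t *\<^sub>R b) + h u - t\<^sup>2 * (?H a \<bullet> b)\<bar> \<le> t ^ 3 * C"
      using second_difference_bound[OF h, of u "t *\<^sub>R a" "t *\<^sub>R b"] t
      by (simp add: C_def blinfun.scaleR_right power2_eq_square power3_eq_cube algebra_simps)
    have 2: "\<bar>h (u + t *\<^sub>R b + t *\<^sub>R a) - h (u + t *\<^sub>R b) - h (u + t *\<^sub>R a) + h u - t\<^sup>2 * (?H b \<bullet> a)\<bar> \<le> t ^ 3 * C"
      using second_difference_bound[OF h, of u "t *\<^sub>R b" "t *\<^sub>R a"] t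
      by (simp add: C_def blinfun.scaleR_right power2_eq_square power3_eq_cube algebra_simps)
    have e: "u + t *\<^sub>R b + t *\<^sub>R a = u + t *\<^sub>R a + t *\<^sub>R b" by simp
    have "\<bar>t\<^sup>2 * (?H a \<bullet> b) - t\<^sup>2 * (?H b \<bullet> a)\<bar> \<le> 2 * (t ^ 3 * C)"
      using 1 2 unfolding e by linarith
    also have "\<bar>t\<^sup>2 * (?H a \<bullet> b) - t\<^sup>2 * (?H b \<bullet> a)\<bar> = t\<^sup>2 * \<bar>?H a \<bullet> b - ?H b \<bullet> a\<bar>"
      by (simp only: right_diff_distrib[symmetric] abs_mult) simp
    also have "2 * (t ^ 3 * C) = t\<^sup>2 * (t * (2 * C))"
      by (simp add: power3_eq_cube power2_eq_square)
    finally have "t\<^sup>2 * \<bar>?H a \<bullet> b - ?H b \<bullet> a\<bar> \<le> t\<^sup>2 * (t * (2 * C))" .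
    then show ?thesis using t by simp
  qed
  then have "\<bar>?H a \<bullet> b - ?H b \<bullet> a\<bar> \<le> 0" by (rule le_of_le_add_small)
  then show ?thesis by simp
qed

section \<open>Maps with a quadratic Taylor remainder\<close>

text \<open>A Lipschitz Jacobian is used only through the remainder of the first-order expansion.  In this form
  it passes to pointwise limits.\<close>

definition taylor_map ::
  "real \<Rightarrow> real \<Rightarrow> ('u::euclidean_space \<Rightarrow> 'v::euclidean_space) \<Rightarrow> ('u \<Rightarrow> 'u \<Rightarrow>\<^sub>L 'v) \<Rightarrow> bool" where
  "taylor_map L0 L1 \<phi> D \<longleftrightarrow> L0-lipschitz_on UNIV \<phi> \<and> 0 \<le> L1 \<and>
     (\<forall>x x'. norm (\<phi> x' - \<phi> x - D x (x' - x)) \<le> L1 * (norm (x' - x))\<^sup>2)"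

lemma taylor_map_continuous:
  "taylor_map L0 L1 \<phi> D \<Longrightarrow> continuous_on UNIV \<phi>"
  unfolding taylor_map_def using lipschitz_on_continuous_on by blast

lemma taylor_map_has_derivative:
  assumes "taylor_map L0 L1 \<phi> D"
  shows "(\<phi> has_derivative D x) (at x)"
proof (rule has_derivativeI_sandwich[of 1])
  show "bounded_linear (D x)" by (rule blinfun.bounded_linear_right)
  show "norm (\<phi> y - \<phi> x - D x (y - x)) / norm (y - x) \<le> L1 * norm (y - x)" if "y \<noteq> x" for y
    using assms that by (simp add: taylor_map_def divide_le_eq power2_eq_square mult_ac)
  show "((\<lambda>y. L1 * norm (y - x)) \<longlongrightarrow> 0) (at x)"
    by (auto intro!: tendsto_eq_intros)
qed simp

lemma taylor_map_derivative_bound: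
  assumes "taylor_map L0 L1 \<phi> D"
  shows "norm (D x d) \<le> L0 * norm d"
proof (rule le_of_le_add_small[where c = "L1 * (norm d)\<^sup>2"])
  fix t :: real assume t: "0 < t"
  have "norm (\<phi> (x + t *\<^sub>R d) - \<phi> x - D x (t *\<^sub>R d)) \<le> L1 * (norm (t *\<^sub>R d))\<^sup>2"
    using assms unfolding taylor_map_def by (metis add_diff_cancel_left')
  moreover have "norm (\<phi> (x + t *\<^sub>R d) - \<phi> x) \<le> L0 * norm (t *\<^sub>R d)"
    using assms lipschitz_onD[of L0 UNIV \<phi> "x + t *\<^sub>R d" x] by (simp add: taylor_map_def dist_norm)
  ultimately have "norm (D x (t *\<^sub>R d)) \<le> L0 * norm (t *\<^sub>R d) + L1 * (norm (t *\<^sub>R d))\<^sup>2"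
    using norm_triangle_ineq4[of "\<phi> (x + t *\<^sub>R d) - \<phi> x" "\<phi> (x + t *\<^sub>R d) - \<phi> x - D x (t *\<^sub>R d)"]
    by simp
  then have "t * norm (D x d) \<le> t * (L0 * norm d + t * (L1 * (norm d)\<^sup>2))"
    using t by (simp add: blinfun.scaleR_right power2_eq_square algebra_simps)
  then show "norm (D x d) \<le> L0 * norm d + t * (L1 * (norm d)\<^sup>2)" using t by simp
qed

text \<open>The derivative is a pointwise limit of difference quotients, which are continuous.\<close>

lemma taylor_map_derivative_measurable:
  assumes T: "taylor_map L0 L1 \<phi> D"
  shows "(\<lambda>x. D x d) \<in> borel_measurable borel"
proof (rule borel_measurable_LIMSEQ_metric)
  let ?q = "\<lambda>n x. real (Suc n) *\<^sub>R (\<phi> (x + (1 / real (Suc n)) *\<^sub>R d) - \<phi> x)"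
  have c: "continuous_on UNIV \<phi>" using T by (rule taylor_map_continuous)
  show "?q n \<in> borel_measurable borel" for n
    by (intro borel_measurable_continuous_onI continuous_intros continuous_on_compose2[OF c]) auto
  show "(\<lambda>n. ?q n x) \<longlonglongrightarrow> D x d" for x
  proof (rule LIM_zero_cancel, rule Lim_null_comparison)
    have "norm (?q n x - D x d) \<le> L1 * (norm d)\<^sup>2 / real (Suc n)" for n
    proof -
      let ?t = "1 / real (Suc n)"
      have "norm (\<phi> (x + ?t *\<^sub>R d) - \<phi> x - D x (?t *\<^sub>R d)) \<le> L1 * (norm (?t *\<^sub>R d))\<^sup>2"
        using T unfolding taylor_map_def by (metis add_diff_cancel_left')
      moreover have "?q n x - D x d = real (Suc n) *\<^sub>R (\<phi> (x + ?t *\<^sub>R d) - \<phi> x - D x (?t *\<^sub>R d))"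
        by (simp add: blinfun.scaleR_right scaleR_diff_right)
      ultimately have "norm (?q n x - D x d) \<le> real (Suc n) * (L1 * (norm (?t *\<^sub>R d))\<^sup>2)"
        by (simp add: mult_left_mono del: of_nat_Suc)
      also have "\<dots> = L1 * (norm d)\<^sup>2 / real (Suc n)"
        by (simp add: power2_eq_square field_simps del: of_nat_Suc)
      finally show ?thesis .
    qed
    then show "\<forall>\<^sub>F n in sequentially. norm (?q n x - D x d) \<le> L1 * (norm d)\<^sup>2 / real (Suc n)"
      by simp
    show "(\<lambda>n. L1 * (norm d)\<^sup>2 / real (Suc n)) \<longlonglongrightarrow> 0"
      by (rule LIMSEQ_Suc, rule lim_const_over_n)
  qed
qed

text \<open>At a fixed point the derivatives are bounded by \<open>L0\<close>, so they converge along a subsequence, and the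
  remainder estimate is preserved in the limit.\<close>

lemma taylor_map_limit:
  fixes \<phi> :: "'u::euclidean_space \<Rightarrow> 'v::euclidean_space"
  assumes T: "\<And>n. taylor_map L0 L1 (\<phi>n n) (D n)" and lim: "\<And>x. (\<lambda>n. \<phi>n n x) \<longlonglongrightarrow> \<phi> x"
  shows "\<exists>D'. taylor_map L0 L1 \<phi> D'"
proof -
  have L: "L0 \<ge> 0" "L1 \<ge> 0" using T[of 0] lipschitz_on_nonneg by (auto simp: taylor_map_def)
  have "\<exists>A. \<forall>x'. norm (\<phi> x' - \<phi> x - blinfun_apply A (x' - x)) \<le> L1 * (norm (x' - x))\<^sup>2" for x
  proof -
    have "bounded (range (\<lambda>n. D n x))"
      unfolding bounded_iff
      by (auto intro!: exI[of _ L0] norm_blinfun_bound L taylor_map_derivative_bound[OF T])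
    then obtain A r where r: "strict_mono (r :: nat \<Rightarrow> nat)" and A: "((\<lambda>n. D n x) \<circ> r) \<longlonglongrightarrow> A"
      using bounded_imp_convergent_subsequence by blast
    have "norm (\<phi> x' - \<phi> x - blinfun_apply A (x' - x)) \<le> L1 * (norm (x' - x))\<^sup>2" for x'
    proof (rule LIMSEQ_le_const2)
      have *: "(\<lambda>n. \<phi>n (r n) x) \<longlonglongrightarrow> \<phi> x" for x
        using LIMSEQ_subseq_LIMSEQ[OF lim r] by (simp add: o_def)
      show "(\<lambda>n. norm (\<phi>n (r n) x' - \<phi>n (r n) x - D (r n) x (x' - x))) \<longlonglongrightarrow> norm (\<phi> x' - \<phi> x - blinfun_apply A (x' - x))"
        using A by (intro tendsto_intros *) (auto simp: o_def)
      show "\<exists>N. \<forall>n\<ge>N. norm (\<phi>n (r n) x' - \<phi>n (r n) x - D (r n) x (x' - x)) \<le> L1 * (norm (x' - x))\<^sup>2"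
        using T by (auto simp: taylor_map_def)
    qed
    then show ?thesis by blast
  qed
  then obtain D' where "\<And>x x'. norm (\<phi> x' - \<phi> x - blinfun_apply (D' x) (x' - x)) \<le> L1 * (norm (x' - x))\<^sup>2"
    by metis
  moreover have "L0-lipschitz_on UNIV \<phi>"
  proof (rule lipschitz_onI)
    fix x y
    show "dist (\<phi> x) (\<phi> y) \<le> L0 * dist x y"
    proof (rule LIMSEQ_le_const2)
      show "(\<lambda>n. dist (\<phi>n n x) (\<phi>n n y)) \<longlonglongrightarrow> dist (\<phi> x) (\<phi> y)"
        by (intro tendsto_intros lim)
      show "\<exists>N. \<forall>n\<ge>N. dist (\<phi>n n x) (\<phi>n n y) \<le> L0 * dist x y"
        using T lipschitz_onD unfolding taylor_map_def by blast
    qed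
  qed (rule L)
  ultimately show ?thesis using L by (auto simp: taylor_map_def)
qed


section \<open>The lower-level problem and its penalised version\<close>

locale bilevel =
  fixes f g :: "'a::euclidean_space \<times> 'b::euclidean_space \<Rightarrow> real"
    and lf0 lf1 lf2 lg0 lg1 lg2 \<mu> l0 lF1 ll0 ll1 :: real
  assumes bilevel: "bilevel_assms f g lf0 lf1 lf2 lg0 lg1 lg2 \<mu>"
    and derived: "derived_constants f g lf2 lg1 lg2 \<mu> l0 lF1 ll0 ll1"
    and l0_pos: "l0 > 0" and l0_ge: "l0 \<ge> 2 * lf1 / \<mu>"
begin

lemma mu_pos: "\<mu> > 0"
  using bilevel by (simp add: bilevel_assms_def)

lemma f_smooth: "f differentiable_on UNIV" "lf1-lipschitz_on UNIV (nabla f)"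
  and g_smooth: "g differentiable_on UNIV" "lg1-lipschitz_on UNIV (nabla g)"
  using bilevel by (auto simp: bilevel_assms_def l_smooth_def)

lemma lf1_nonneg: "lf1 \<ge> 0"
  using f_smooth(2) by (rule lipschitz_on_nonneg)

lemma norm_nabla_y_f: "norm (snd (nabla f p)) \<le> lf0"
  using bilevel unfolding bilevel_assms_def by blast

lemma lf0_nonneg: "lf0 \<ge> 0"
  using norm_nabla_y_f norm_ge_zero order_trans by blast

lemma lf1_le: "l0 \<le> l \<Longrightarrow> lf1 \<le> l * \<mu> / 2"
proof -
  assume "l0 \<le> l"
  then have "2 * lf1 / \<mu> \<le> l" using l0_ge by simp
  then show ?thesis using mu_pos by (simp add: field_simps)
qed

lemma g_quad_bounded: "quad_bounded \<mu> lg1 (\<lambda>y. g (x, y)) (\<lambda>y. snd (nabla g (x, y)))"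
proof -
  have sc: "strongly_convex \<mu> (\<lambda>y. g (x, y))" using bilevel by (simp add: bilevel_assms_def)
  have "GDERIV (\<lambda>y. g (x, y)) u :> snd (nabla g (x, u))" for u
  proof -
    have "(g has_derivative (\<lambda>e. e \<bullet> nabla g (x, u))) (at (x, u))"
      using g_smooth(1) GDERIV_nabla by (auto simp: gderiv_def differentiable_on_def)
    moreover have "((\<lambda>y. (x, y)) has_derivative (\<lambda>d. (0, d))) (at u)"
      by (auto intro!: derivative_eq_intros)
    ultimately have "((\<lambda>y. g (x, y)) has_derivative (\<lambda>d. (0, d) \<bullet> nabla g (x, u))) (at u)"
      using has_derivative_compose by blast
    then show ?thesis by (simp add: gderiv_def inner_prod_def)
  qed
  then have lo: "g (x, u) + snd (nabla g (x, u)) \<bullet> (v - u) + \<mu> / 2 * (norm (v - u))\<^sup>2 \<le> g (x, v)" for u v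
    using strongly_convex_gradient_bound[OF sc] by blast
  have up: "g (x, v) \<le> g (x, u) + snd (nabla g (x, u)) \<bullet> (v - u) + lg1 / 2 * (norm (v - u))\<^sup>2" for u v
    using quadratic_upper_bound[OF g_smooth, of "(x, v)" "(x, u)"]
    by (simp add: inner_prod_def norm_prod_def)
  have "continuous_on UNIV (\<lambda>y. g (x, y))"
    by (intro continuous_on_compose2[OF differentiable_imp_continuous_on[OF g_smooth(1)]] continuous_intros) auto
  with lo up mu_pos show ?thesis by (simp add: quad_bounded_def)
qed

lemma mu_le_lg1: "\<mu> \<le> lg1"
  using quad_bounded_le[OF g_quad_bounded] .

text \<open>As \<open>l \<ge> 2 lf1 / \<mu>\<close>, the function \<open>f\<close> destroys at most half of the strong convexity of \<open>l g\<close>.\<close>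

lemma lagr_quad_bounded:
  assumes l: "l0 \<le> l"
  shows "quad_bounded (l * \<mu> / 2) (lf1 + l * lg1) (\<lambda>y. lagr f g l (x, y))
           (\<lambda>y. snd (nabla f (x, y)) + l *\<^sub>R snd (nabla g (x, y)))"
  unfolding quad_bounded_def
proof (intro conjI allI)
  have l': "l > 0" using l l0_pos by simp
  then show "0 < l * \<mu> / 2" using mu_pos by simp
  show "continuous_on UNIV (\<lambda>y. lagr f g l (x, y))"
    unfolding lagr_def
    by (simp, intro continuous_intros
          continuous_on_compose2[OF differentiable_imp_continuous_on[OF f_smooth(1)]]
          continuous_on_compose2[OF differentiable_imp_continuous_on[OF g_smooth(1)]]) auto
  fix u v :: 'b
  let ?n = "(norm (v - u))\<^sup>2"
  have fl: "f (x, u) + snd (nabla f (x, u)) \<bullet> (v - u) - lf1 / 2 * ?n \<le> f (x, v)"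
    using quadratic_lower_bound[OF f_smooth, of "(x, u)" "(x, v)"]
    by (simp add: inner_prod_def norm_prod_def)
  have fu: "f (x, v) \<le> f (x, u) + snd (nabla f (x, u)) \<bullet> (v - u) + lf1 / 2 * ?n"
    using quadratic_upper_bound[OF f_smooth, of "(x, v)" "(x, u)"]
    by (simp add: inner_prod_def norm_prod_def)
  have gl: "g (x, u) + snd (nabla g (x, u)) \<bullet> (v - u) + \<mu> / 2 * ?n \<le> g (x, v)"
   and gu: "g (x, v) \<le> g (x, u) + snd (nabla g (x, u)) \<bullet> (v - u) + lg1 / 2 * ?n"
    using g_quad_bounded[of x] by (auto simp: quad_bounded_def)
  have "lf1 * ?n \<le> l * \<mu> / 2 * ?n" by (intro mult_right_mono lf1_le l) simp
  then show "lagr f g l (x, u) + (snd (nabla f (x, u)) + l *\<^sub>R snd (nabla g (x, u))) \<bullet> (v - u)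
        + l * \<mu> / 2 / 2 * ?n \<le> lagr f g l (x, v)"
    using fl mult_left_mono[OF gl, of l] l'
    by (simp add: lagr_def inner_add_left algebra_simps)
  show "lagr f g l (x, v) \<le> lagr f g l (x, u) + (snd (nabla f (x, u)) + l *\<^sub>R snd (nabla g (x, u))) \<bullet> (v - u)
        + (lf1 + l * lg1) / 2 * ?n"
    using fu mult_left_mono[OF gu, of l] l'
    by (simp add: lagr_def inner_add_left add_divide_distrib algebra_simps)
qed

lemma ystar_minimal:
  assumes "quad_bounded m L (\<lambda>y. h (x, y)) G"
  shows "h (x, ystar h x) \<le> h (x, y)"
proof -
  obtain y0 where "\<forall>v. h (x, y0) \<le> h (x, v)"
    using quad_bounded_has_minimiser[OF assms] by blast
  then have "is_arg_min (\<lambda>y. h (x, y)) (\<lambda>_. True) y0" by (simp add: is_arg_min_linorder)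
  then have "is_arg_min (\<lambda>y. h (x, y)) (\<lambda>_. True) (ystar h x)"
    unfolding ystar_def arg_min_def by (rule someI)
  then show ?thesis by (simp add: is_arg_min_linorder)
qed

lemmas ystar_g_minimal = ystar_minimal[where h = g, OF g_quad_bounded]

lemma ystar_lam_minimal:
  assumes "l0 \<le> l"
  shows "lagr f g l (x, ystar_lam f g l x) \<le> lagr f g l (x, y)"
  unfolding ystar_lam_def by (rule ystar_minimal[OF lagr_quad_bounded[OF assms]])

lemma nabla_y_g_ystar: "snd (nabla g (x, ystar g x)) = 0"
  by (rule quad_bounded_stationary[OF g_quad_bounded]) (rule ystar_g_minimal)

lemma nabla_y_ystar_lam:
  assumes "l0 \<le> l"
  shows "snd (nabla f (x, ystar_lam f g l x)) + l *\<^sub>R snd (nabla g (x, ystar_lam f g l x)) = 0"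
  by (rule quad_bounded_stationary[OF lagr_quad_bounded[OF assms]]) (rule ystar_lam_minimal[OF assms])

text \<open>At \<open>y*\<^sub>l(x)\<close> the gradient \<open>\<nabla>\<^sub>y g = - \<nabla>\<^sub>y f / l\<close> has norm at most \<open>lf0 / l\<close>; strong convexity
  turns this into a distance to the minimiser of \<open>g\<close>.\<close>

lemma ystar_lam_dist:
  assumes l: "l0 \<le> l"
  shows "norm (ystar_lam f g l x - ystar g x) \<le> lf0 / (\<mu> * l)"
proof -
  let ?y = "ystar_lam f g l x"
  have l': "l > 0" using l l0_pos by simp
  have "l *\<^sub>R snd (nabla g (x, ?y)) = - snd (nabla f (x, ?y))"
    using nabla_y_ystar_lam[OF l, of x] by (simp add: eq_neg_iff_add_eq_0 add.commute)
  then have "l * norm (snd (nabla g (x, ?y))) \<le> lf0"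
    using norm_nabla_y_f[of "(x, ?y)"] l' by (metis abs_of_pos norm_minus_cancel norm_scaleR)
  then have "norm (snd (nabla g (x, ?y))) \<le> lf0 / l" using l' by (simp add: field_simps)
  then have "norm (snd (nabla g (x, ?y))) / \<mu> \<le> lf0 / l / \<mu>"
    using mu_pos by (intro divide_right_mono) auto
  moreover have "norm (?y - ystar g x) \<le> norm (snd (nabla g (x, ?y))) / \<mu>"
    by (rule quad_bounded_dist_le_gradient[OF g_quad_bounded]) (rule ystar_g_minimal)
  ultimately show ?thesis by (simp add: mult.commute)
qed

text \<open>The same argument for the Lagrangian with multiplier \<open>l\<close>, whose gradient at \<open>y*\<^sub>l'(x)\<close> is
  \<open>(1 - l/l') \<nabla>\<^sub>y f\<close>.  The bound is a multiple of \<open>1/l - 1/l'\<close>, so it is summable along increasing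
  multipliers.\<close>

lemma ystar_lam_change:
  assumes l: "l0 \<le> l" and ll: "l \<le> l'"
  shows "norm (ystar_lam f g l' x - ystar_lam f g l x) \<le> 2 * lf0 * (l' - l) / (\<mu> * l * l')"
proof -
  let ?y = "ystar_lam f g l' x"
  let ?r = "snd (nabla f (x, ?y)) + l *\<^sub>R snd (nabla g (x, ?y))"
  have l': "l > 0" "l' > 0" using l ll l0_pos by simp_all
  have st: "snd (nabla g (x, ?y)) = - (1 / l') *\<^sub>R snd (nabla f (x, ?y))"
  proof -
    have "l' *\<^sub>R snd (nabla g (x, ?y)) = - snd (nabla f (x, ?y))"
      using nabla_y_ystar_lam[of l' x] l ll by (simp add: eq_neg_iff_add_eq_0 add.commute)
    then have "(1 / l') *\<^sub>R (l' *\<^sub>R snd (nabla g (x, ?y))) = (1 / l') *\<^sub>R (- snd (nabla f (x, ?y)))"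
      by simp
    then show ?thesis using l' by simp
  qed
  have "?r = ((l' - l) / l') *\<^sub>R snd (nabla f (x, ?y))"
    unfolding st using l' by (simp add: diff_divide_distrib scaleR_diff_left)
  then have "norm ?r = (l' - l) / l' * norm (snd (nabla f (x, ?y)))"
    using l' ll by simp
  also have "\<dots> \<le> (l' - l) / l' * lf0"
    using l' ll by (intro mult_left_mono norm_nabla_y_f) auto
  finally have "norm ?r \<le> (l' - l) / l' * lf0" .
  then have "norm ?r / (l * \<mu> / 2) \<le> (l' - l) / l' * lf0 / (l * \<mu> / 2)"
    using mu_pos l' by (intro divide_right_mono) auto
  moreover have "norm (?y - ystar_lam f g l x) \<le> norm ?r / (l * \<mu> / 2)"
    by (rule quad_bounded_dist_le_gradient[OF lagr_quad_bounded[OF l]]) (rule ystar_lam_minimal[OF l])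
  moreover have "(l' - l) / l' * lf0 / (l * \<mu> / 2) = 2 * lf0 * (l' - l) / (\<mu> * l * l')"
    by (simp add: mult_ac)
  ultimately show ?thesis by linarith
qed

lemma ystar_lam_taylor:
  assumes l: "l0 \<le> l"
  shows "taylor_map ll0 ll1 (ystar_lam f g l) (deriv_map (ystar_lam f g l))"
proof -
  have *: "ll0-lipschitz_on UNIV (ystar_lam f g l)" "ystar_lam f g l differentiable_on UNIV"
    "ll1-lipschitz_on UNIV (deriv_map (ystar_lam f g l))"
    using derived l by (auto simp: derived_constants_def)
  then show ?thesis
    using deriv_map_Taylor lipschitz_on_nonneg unfolding taylor_map_def by blast
qed

text \<open>\<open>y*\<close> is the limit of \<open>y*\<^sub>l\<close> for \<open>l \<rightarrow> \<infinity>\<close>, and \<open>ll0\<close>, \<open>ll1\<close> do not depend on \<open>l\<close>.\<close>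

lemma ystar_taylor_ex: "\<exists>D. taylor_map ll0 ll1 (ystar g) D"
proof (rule taylor_map_limit)
  show "taylor_map ll0 ll1 (ystar_lam f g (l0 + real n)) (deriv_map (ystar_lam f g (l0 + real n)))" for n
    by (rule ystar_lam_taylor) simp
  show "(\<lambda>n. ystar_lam f g (l0 + real n) x) \<longlonglongrightarrow> ystar g x" for x
  proof (rule LIM_zero_cancel, rule Lim_null_comparison)
    show "\<forall>\<^sub>F n in sequentially. norm (ystar_lam f g (l0 + real n) x - ystar g x) \<le> lf0 / (\<mu> * (l0 + real n))"
      by (intro always_eventually allI ystar_lam_dist) simp
    show "(\<lambda>n. lf0 / (\<mu> * (l0 + real n))) \<longlonglongrightarrow> 0"
      using mu_pos
      by (intro real_tendsto_divide_at_top tendsto_const filterlim_tendsto_pos_mult_at_top[OF tendsto_const]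
           filterlim_tendsto_add_at_top[OF tendsto_const filterlim_real_sequentially]) auto
  qed
qed

definition Dystar :: "'a \<Rightarrow> 'a \<Rightarrow>\<^sub>L 'b" where
  "Dystar = (SOME D. taylor_map ll0 ll1 (ystar g) D)"

lemma ystar_taylor: "taylor_map ll0 ll1 (ystar g) Dystar"
  unfolding Dystar_def by (rule someI_ex[OF ystar_taylor_ex])

lemma ll0_nonneg: "ll0 \<ge> 0" and ll1_nonneg: "ll1 \<ge> 0"
  using ystar_taylor lipschitz_on_nonneg by (auto simp: taylor_map_def)


section \<open>The hypergradient and the bias of the penalised gradient\<close>

lemma graph_has_derivative:
  "((\<lambda>x. (x, ystar g x)) has_derivative (\<lambda>d. (d, Dystar x d))) (at x)"
  using taylor_map_has_derivative[OF ystar_taylor] by (auto intro!: derivative_eq_intros)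

lemma hyper_obj_has_derivative:
  "(hyper_obj f g has_derivative (\<lambda>d. (d, Dystar x d) \<bullet> nabla f (x, ystar g x))) (at x)"
proof -
  have "(f has_derivative (\<lambda>e. e \<bullet> nabla f (x, ystar g x))) (at (x, ystar g x))"
    using f_smooth(1) GDERIV_nabla by (auto simp: gderiv_def differentiable_on_def)
  then have "((\<lambda>x. f (x, ystar g x)) has_derivative (\<lambda>d. (d, Dystar x d) \<bullet> nabla f (x, ystar g x))) (at x)"
    using has_derivative_compose[OF graph_has_derivative] by blast
  then show ?thesis by (simp add: hyper_obj_def[abs_def])
qed

lemma hyper_obj_differentiable: "hyper_obj f g differentiable_on UNIV"
  using hyper_obj_has_derivative by (auto simp: differentiable_on_def differentiable_def)

lemma nabla_hyper_obj_inner: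
  "nabla (hyper_obj f g) x \<bullet> d = nabla f (x, ystar g x) \<bullet> (d, Dystar x d)"
proof -
  have "(hyper_obj f g has_derivative (\<lambda>d. d \<bullet> nabla (hyper_obj f g) x)) (at x)"
    using hyper_obj_differentiable GDERIV_nabla by (auto simp: gderiv_def differentiable_on_def)
  then have "(\<lambda>d. d \<bullet> nabla (hyper_obj f g) x) = (\<lambda>d. (d, Dystar x d) \<bullet> nabla f (x, ystar g x))"
    using hyper_obj_has_derivative has_derivative_unique by blast
  from fun_cong[OF this, of d] show ?thesis by (simp add: inner_commute)
qed

text \<open>The derivative of the stationarity condition \<open>\<nabla>\<^sub>y g(x, y*(x)) = 0\<close> in direction \<open>d\<close>.\<close>

lemma hessian_g_graph_tangent:
  "deriv_map (nabla g) (x, ystar g x) (d, Dystar x d) \<bullet> (0, v) = 0"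
proof -
  have "nabla g differentiable_on UNIV"
    using bilevel by (simp add: bilevel_assms_def C2_with_Lipschitz_Hessian_def)
  note deriv_map_has_derivative[OF this]
  then have "((\<lambda>x. nabla g (x, ystar g x)) has_derivative (\<lambda>d. deriv_map (nabla g) (x, ystar g x) (d, Dystar x d))) (at x)"
    using has_derivative_compose[OF graph_has_derivative] by blast
  then have "((\<lambda>x. nabla g (x, ystar g x) \<bullet> (0, v)) has_derivative
      (\<lambda>d. deriv_map (nabla g) (x, ystar g x) (d, Dystar x d) \<bullet> (0, v))) (at x)"
    by (rule has_derivative_inner_left)
  then have "((\<lambda>x. 0) has_derivative (\<lambda>d. deriv_map (nabla g) (x, ystar g x) (d, Dystar x d) \<bullet> (0, v))) (at x)"
    by (simp add: inner_prod_def nabla_y_g_ystar)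
  then have "(\<lambda>d. deriv_map (nabla g) (x, ystar g x) (d, Dystar x d) \<bullet> (0, v)) = (\<lambda>d. 0)"
    by (rule has_derivative_unique[OF _ has_derivative_const])
  then show ?thesis by (rule fun_cong)
qed

text \<open>By the envelope theorem, this is the gradient of the minimum over \<open>y\<close> of the Lagrangian.\<close>

definition penalised_grad :: "real \<Rightarrow> 'a \<Rightarrow> 'a" where
  "penalised_grad l x = fst (nabla f (x, ystar_lam f g l x))
     + l *\<^sub>R (fst (nabla g (x, ystar_lam f g l x)) - fst (nabla g (x, ystar g x)))"

definition bias_const :: real where
  "bias_const = (lf1 * lf0 / \<mu> + lg2 * lf0\<^sup>2 / \<mu>\<^sup>2) * (1 + ll0)"

text \<open>Let \<open>v = y*\<^sub>l(x) - y*(x) = O(1/l)\<close> and \<open>A\<close> the derivative of \<open>y*\<close> at \<open>x\<close>.  The difference of the two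
  gradients in direction \<open>d\<close> is the inner product of \<open>(d, A d)\<close> with
  \<open>\<nabla>f(x, y*\<^sub>l(x)) - \<nabla>f(x, y*(x)) + l \<rho>\<close>, where \<open>\<rho> = O(|v|\<^sup>2)\<close> is the Taylor remainder of \<open>\<nabla>g\<close>.  The
  terms linear in \<open>v\<close> cancel: by symmetry of the Hessian they are given by the derivative of the
  stationarity condition, which is zero, and the stationarity of \<open>y*\<^sub>l(x)\<close> exchanges \<open>l \<nabla>\<^sub>y g\<close> for \<open>- \<nabla>\<^sub>y f\<close>.\<close>

lemma penalised_grad_bias:
  assumes l: "l0 \<le> l"
  shows "norm (penalised_grad l x - nabla (hyper_obj f g) x) \<le> bias_const / l"
proof -
  have l': "l > 0" using l l0_pos by simp
  let ?y = "ystar_lam f g l x" and ?ys = "ystar g x"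
  let ?H = "deriv_map (nabla g) (x, ?ys)"
  define v where "v = ?y - ?ys"
  define \<rho> where "\<rho> = nabla g (x, ?y) - nabla g (x, ?ys) - ?H (0, v)"
  define r where "r = nabla f (x, ?y) - nabla f (x, ?ys) + l *\<^sub>R \<rho>"
  have g2: "C2_with_Lipschitz_Hessian lg2 g" using bilevel by (simp add: bilevel_assms_def)
  then have g2': "nabla g differentiable_on UNIV" "lg2-lipschitz_on UNIV (deriv_map (nabla g))"
    by (auto simp: C2_with_Lipschitz_Hessian_def)
  have lg2: "lg2 \<ge> 0" using g2'(2) by (rule lipschitz_on_nonneg)
  have nv: "norm v \<le> lf0 / (\<mu> * l)" unfolding v_def by (rule ystar_lam_dist[OF l])
  have \<rho>: "norm \<rho> \<le> lg2 * (norm v)\<^sup>2"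
    using deriv_map_Taylor[OF g2', of "(x, ?y)" "(x, ?ys)"] by (simp add: \<rho>_def v_def norm_prod_def)
  have inner: "(penalised_grad l x - nabla (hyper_obj f g) x) \<bullet> d = r \<bullet> (d, Dystar x d)" for d
  proof -
    let ?e = "Dystar x d"
    have "?H (0, v) \<bullet> (d, ?e) = ?H (d, ?e) \<bullet> (0, v)"
      by (rule hessian_symmetric[OF g2])
    then have H0: "?H (0, v) \<bullet> (d, ?e) = 0" using hessian_g_graph_tangent by simp
    have 1: "(nabla g (x, ?y) - nabla g (x, ?ys)) \<bullet> (d, ?e) = \<rho> \<bullet> (d, ?e)"
      using H0 by (simp add: \<rho>_def inner_diff_left)
    have "(snd (nabla f (x, ?y)) + l *\<^sub>R snd (nabla g (x, ?y))) \<bullet> ?e = 0"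
      using nabla_y_ystar_lam[OF l, of x] by simp
    then have 2: "l * (snd (nabla g (x, ?y)) \<bullet> ?e) = - (snd (nabla f (x, ?y)) \<bullet> ?e)"
      by (simp add: inner_add_left)
    have "penalised_grad l x \<bullet> d = fst (nabla f (x, ?y)) \<bullet> d
        + l * ((nabla g (x, ?y) - nabla g (x, ?ys)) \<bullet> (d, ?e)) - l * (snd (nabla g (x, ?y)) \<bullet> ?e)"
      by (simp add: penalised_grad_def inner_prod_def nabla_y_g_ystar inner_add_left inner_diff_left algebra_simps)
    also have "\<dots> = nabla f (x, ?y) \<bullet> (d, ?e) + l * (\<rho> \<bullet> (d, ?e))"
      unfolding 1 2 by (simp add: inner_prod_def)
    finally show ?thesis
      by (simp add: inner_diff_left nabla_hyper_obj_inner r_def inner_add_left)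
  qed
  have "norm r \<le> norm (nabla f (x, ?y) - nabla f (x, ?ys)) + norm (l *\<^sub>R \<rho>)"
    unfolding r_def by (rule norm_triangle_ineq)
  also have "\<dots> \<le> lf1 * norm v + l * (lg2 * (norm v)\<^sup>2)"
  proof (rule add_mono)
    show "norm (nabla f (x, ?y) - nabla f (x, ?ys)) \<le> lf1 * norm v"
      using lipschitz_onD[OF f_smooth(2), of "(x, ?y)" "(x, ?ys)"] by (simp add: dist_norm v_def norm_prod_def)
    show "norm (l *\<^sub>R \<rho>) \<le> l * (lg2 * (norm v)\<^sup>2)" using \<rho> l' by simp
  qed
  also have "\<dots> \<le> lf1 * (lf0 / (\<mu> * l)) + l * (lg2 * (lf0 / (\<mu> * l))\<^sup>2)"
    using nv lf1_nonneg lg2 l' by (intro add_mono mult_left_mono power_mono) auto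
  also have "\<dots> = (lf1 * lf0 / \<mu> + lg2 * lf0\<^sup>2 / \<mu>\<^sup>2) / l"
    using l' mu_pos by (simp add: field_simps power2_eq_square)
  finally have nr: "norm r \<le> (lf1 * lf0 / \<mu> + lg2 * lf0\<^sup>2 / \<mu>\<^sup>2) / l" .
  define w where "w = penalised_grad l x - nabla (hyper_obj f g) x"
  have "norm (w, Dystar x w) \<le> norm w + norm (Dystar x w)"
    by (rule norm_Pair_le)
  also have "\<dots> \<le> (1 + ll0) * norm w"
    using taylor_map_derivative_bound[OF ystar_taylor, of x w] by (simp add: algebra_simps)
  finally have nw: "norm (w, Dystar x w) \<le> (1 + ll0) * norm w" .
  have "norm w * norm w = r \<bullet> (w, Dystar x w)"
    using inner[of w] by (simp add: w_def power2_norm_eq_inner[symmetric] power2_eq_square[symmetric])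
  also have "\<dots> \<le> norm r * norm (w, Dystar x w)" by (rule norm_cauchy_schwarz)
  also have "\<dots> \<le> (lf1 * lf0 / \<mu> + lg2 * lf0\<^sup>2 / \<mu>\<^sup>2) / l * ((1 + ll0) * norm w)"
    using nr nw order_trans[OF norm_ge_zero nr] by (intro mult_mono) auto
  finally have "norm w * norm w \<le> bias_const / l * norm w"
    by (simp add: bias_const_def)
  moreover have "bias_const / l \<ge> 0"
    using lf0_nonneg lf1_nonneg lg2 mu_pos l' ll0_nonneg by (simp add: bias_const_def)
  ultimately show ?thesis unfolding w_def[symmetric]
    by (metis mult_le_cancel_right_pos mult_zero_right norm_ge_zero order_less_le norm_zero)
qed

end


section \<open>Square-integrable random variables and conditionally centred noise\<close>

definition sqint :: "'w measure \<Rightarrow> ('w \<Rightarrow> 'v::euclidean_space) \<Rightarrow> bool" where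
  "sqint P X \<longleftrightarrow> X \<in> borel_measurable P \<and> integrable P (\<lambda>\<omega>. (norm (X \<omega>))\<^sup>2)"

lemma sqint_measurable: "sqint P X \<Longrightarrow> X \<in> borel_measurable P"
  and sqint_integrable: "sqint P X \<Longrightarrow> integrable P (\<lambda>\<omega>. (norm (X \<omega>))\<^sup>2)"
  unfolding sqint_def by blast+

lemma sqintI: "\<lbrakk>X \<in> borel_measurable P; integrable P (\<lambda>\<omega>. (norm (X \<omega>))\<^sup>2)\<rbrakk> \<Longrightarrow> sqint P X"
  unfolding sqint_def by blast

lemma norm_add_sq_le: "(norm (a + b))\<^sup>2 \<le> 2 * (norm a)\<^sup>2 + 2 * (norm (b :: 'v::real_normed_vector))\<^sup>2"
proof -
  have "(norm (a + b))\<^sup>2 \<le> (norm a + norm b)\<^sup>2"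
    by (intro power_mono norm_triangle_ineq) simp
  also have "\<dots> \<le> 2 * (norm a)\<^sup>2 + 2 * (norm b)\<^sup>2"
    using sum_squares_bound[of "norm a" "norm b"] by (simp add: power2_sum)
  finally show ?thesis .
qed

text \<open>The weights are those by which each error term costs a sixteenth of the rate \<open>s\<close> of the inner loops.\<close>

lemma weighted_young:
  fixes a b s :: real
  assumes "s > 0"
  shows "2 * a * b \<le> s / 16 * a\<^sup>2 + 16 / s * b\<^sup>2"
proof -
  have "0 \<le> s / 16 * (a - 16 / s * b)\<^sup>2" using assms by simp
  also have "\<dots> = s / 16 * a\<^sup>2 + 16 / s * b\<^sup>2 - 2 * a * b"
    using assms by (simp add: power2_eq_square field_simps)
  finally show ?thesis by simp
qed

lemma sqint_inner_integrable:
  assumes "sqint P X" "sqint P Y"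
  shows "integrable P (\<lambda>\<omega>. X \<omega> \<bullet> Y \<omega>)"
proof (rule Bochner_Integration.integrable_bound)
  show "integrable P (\<lambda>\<omega>. (norm (X \<omega>))\<^sup>2 + (norm (Y \<omega>))\<^sup>2)"
    by (intro Bochner_Integration.integrable_add sqint_integrable assms)
  show "(\<lambda>\<omega>. X \<omega> \<bullet> Y \<omega>) \<in> borel_measurable P"
    by (intro borel_measurable_inner sqint_measurable assms)
  show "AE \<omega> in P. norm (X \<omega> \<bullet> Y \<omega>) \<le> norm ((norm (X \<omega>))\<^sup>2 + (norm (Y \<omega>))\<^sup>2)"
  proof (rule AE_I2)
    fix \<omega>
    have "\<bar>X \<omega> \<bullet> Y \<omega>\<bar> \<le> norm (X \<omega>) * norm (Y \<omega>)" by (rule Cauchy_Schwarz_ineq2)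
    moreover have "0 \<le> norm (X \<omega>) * norm (Y \<omega>)" by simp
    ultimately have "\<bar>X \<omega> \<bullet> Y \<omega>\<bar> \<le> (norm (X \<omega>))\<^sup>2 + (norm (Y \<omega>))\<^sup>2"
      using sum_squares_bound[of "norm (X \<omega>)" "norm (Y \<omega>)"] by linarith
    also have "\<dots> \<le> norm ((norm (X \<omega>))\<^sup>2 + (norm (Y \<omega>))\<^sup>2)" unfolding real_norm_def by (rule abs_ge_self)
    finally show "norm (X \<omega> \<bullet> Y \<omega>) \<le> norm ((norm (X \<omega>))\<^sup>2 + (norm (Y \<omega>))\<^sup>2)"
      by (simp only: real_norm_def)
  qed
qed

lemma sqint_scaleR:
  assumes "sqint P X"
  shows "sqint P (\<lambda>\<omega>. r *\<^sub>R X \<omega>)"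
proof (rule sqintI)
  show "(\<lambda>\<omega>. r *\<^sub>R X \<omega>) \<in> borel_measurable P" using sqint_measurable[OF assms] by simp
  have "integrable P (\<lambda>\<omega>. r\<^sup>2 * (norm (X \<omega>))\<^sup>2)" using sqint_integrable[OF assms] by simp
  then show "integrable P (\<lambda>\<omega>. (norm (r *\<^sub>R X \<omega>))\<^sup>2)" by (simp add: power_mult_distrib)
qed

lemma fst_borel_measurable: "fst \<in> borel_measurable (borel :: ('u::euclidean_space \<times> 'v::euclidean_space) measure)"
  by (intro borel_measurable_continuous_onI continuous_intros)

lemma snd_borel_measurable: "snd \<in> borel_measurable (borel :: ('u::euclidean_space \<times> 'v::euclidean_space) measure)"
  by (intro borel_measurable_continuous_onI continuous_intros)

context prob_space
begin

lemma sqint_const: "sqint M (\<lambda>\<omega>. c)"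
  by (rule sqintI) simp_all

lemma sqint_bound:
  assumes X: "X \<in> borel_measurable M" and Y: "sqint M Y"
    and le: "\<And>\<omega>. norm (X \<omega>) \<le> A + B * norm (Y \<omega>)"
  shows "sqint M X"
proof (rule sqintI[OF X], rule Bochner_Integration.integrable_bound)
  show "integrable M (\<lambda>\<omega>. 2 * A\<^sup>2 + 2 * (B\<^sup>2 * (norm (Y \<omega>))\<^sup>2))"
    using sqint_integrable[OF Y] by simp
  show "(\<lambda>\<omega>. (norm (X \<omega>))\<^sup>2) \<in> borel_measurable M" using X by measurable
  have "(norm (X \<omega>))\<^sup>2 \<le> 2 * A\<^sup>2 + 2 * (B\<^sup>2 * (norm (Y \<omega>))\<^sup>2)" for \<omega>
  proof -
    have "(norm (X \<omega>))\<^sup>2 \<le> (A + B * norm (Y \<omega>))\<^sup>2"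
      by (intro power_mono le) simp
    also have "\<dots> \<le> 2 * A\<^sup>2 + 2 * (B * norm (Y \<omega>))\<^sup>2"
      using sum_squares_bound[of A "B * norm (Y \<omega>)"] by (simp add: power2_sum)
    finally show ?thesis by (simp add: power_mult_distrib)
  qed
  then show "AE \<omega> in M. norm ((norm (X \<omega>))\<^sup>2) \<le> norm (2 * A\<^sup>2 + 2 * (B\<^sup>2 * (norm (Y \<omega>))\<^sup>2))"
    by simp
qed

lemma sqint_add:
  assumes X: "sqint M X" and Y: "sqint M Y"
  shows "sqint M (\<lambda>\<omega>. X \<omega> + Y \<omega>)"
proof (rule sqintI[OF borel_measurable_add[OF sqint_measurable[OF X] sqint_measurable[OF Y]]],
    rule Bochner_Integration.integrable_bound)
  note [measurable] = sqint_measurable[OF X] sqint_measurable[OF Y]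
  show "integrable M (\<lambda>\<omega>. 2 * (norm (X \<omega>))\<^sup>2 + 2 * (norm (Y \<omega>))\<^sup>2)"
    using sqint_integrable[OF X] sqint_integrable[OF Y] by simp
  show "(\<lambda>\<omega>. (norm (X \<omega> + Y \<omega>))\<^sup>2) \<in> borel_measurable M"
    by measurable
  show "AE \<omega> in M. norm ((norm (X \<omega> + Y \<omega>))\<^sup>2) \<le> norm (2 * (norm (X \<omega>))\<^sup>2 + 2 * (norm (Y \<omega>))\<^sup>2)"
    by (rule AE_I2) (use norm_add_sq_le in auto)
qed

lemma sqint_diff:
  assumes X: "sqint M X" and Y: "sqint M Y"
  shows "sqint M (\<lambda>\<omega>. X \<omega> - Y \<omega>)"
  using sqint_add[OF X sqint_scaleR[OF Y, of "-1"]] by simp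

lemma sqint_Pair:
  assumes X: "sqint M X" and Y: "sqint M Y"
  shows "sqint M (\<lambda>\<omega>. (X \<omega>, Y \<omega>))"
proof (rule sqintI)
  show "(\<lambda>\<omega>. (X \<omega>, Y \<omega>)) \<in> borel_measurable M"
    by (intro borel_measurable_Pair sqint_measurable assms)
  show "integrable M (\<lambda>\<omega>. (norm (X \<omega>, Y \<omega>))\<^sup>2)"
    using sqint_integrable[OF X] sqint_integrable[OF Y] by (simp add: norm_prod_def)
qed

lemma sqint_fst:
  fixes X :: "'a \<Rightarrow> 'u::euclidean_space \<times> 'v::euclidean_space"
  assumes X: "sqint M X"
  shows "sqint M (\<lambda>\<omega>. fst (X \<omega>))"
  by (rule sqint_bound[OF measurable_compose[OF sqint_measurable[OF X] fst_borel_measurable] X, where A = 0 and B = 1])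
    (metis add_0 mult_1 norm_fst_le prod.collapse)

lemma sqint_snd:
  fixes X :: "'a \<Rightarrow> 'u::euclidean_space \<times> 'v::euclidean_space"
  assumes X: "sqint M X"
  shows "sqint M (\<lambda>\<omega>. snd (X \<omega>))"
  by (rule sqint_bound[OF measurable_compose[OF sqint_measurable[OF X] snd_borel_measurable] X, where A = 0 and B = 1])
    (metis add_0 mult_1 norm_snd_le prod.collapse)

lemma sqint_lipschitz:
  assumes X: "sqint M X" and h: "L-lipschitz_on UNIV h"
  shows "sqint M (\<lambda>\<omega>. h (X \<omega>))"
proof (rule sqint_bound[OF _ X])
  have "continuous_on UNIV h" using h by (rule lipschitz_on_continuous_on)
  then show "(\<lambda>\<omega>. h (X \<omega>)) \<in> borel_measurable M"
    by (rule borel_measurable_continuous_on[OF _ sqint_measurable[OF X]])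
  fix \<omega>
  have "norm (h (X \<omega>)) \<le> norm (h 0) + norm (h (X \<omega>) - h 0)"
    using norm_triangle_ineq[of "h 0" "h (X \<omega>) - h 0"] by simp
  also have "norm (h (X \<omega>) - h 0) \<le> L * norm (X \<omega>)"
    using lipschitz_onD[OF h, of "X \<omega>" 0] by (simp add: dist_norm)
  finally show "norm (h (X \<omega>)) \<le> norm (h 0) + L * norm (X \<omega>)" by simp
qed

lemma sqint_norm_integrable:
  assumes "sqint M X"
  shows "integrable M (\<lambda>\<omega>. norm (X \<omega>))"
proof (rule Bochner_Integration.integrable_bound)
  show "integrable M (\<lambda>\<omega>. 1 + (norm (X \<omega>))\<^sup>2)" using sqint_integrable[OF assms] by simp
  have "norm (norm x) \<le> norm (1 + (norm x)\<^sup>2)" for x :: 'b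
  proof -
    have "norm x \<le> 1 + (norm x)\<^sup>2"
      using sum_squares_bound[of 1 "norm x"] norm_ge_zero[of x]
      unfolding one_power2 mult_1_right by linarith
    then show ?thesis by simp
  qed
  then show "AE \<omega> in M. norm (norm (X \<omega>)) \<le> norm (1 + (norm (X \<omega>))\<^sup>2)" by simp
  show "(\<lambda>\<omega>. norm (X \<omega>)) \<in> borel_measurable M" using sqint_measurable[OF assms] by simp
qed

text \<open>Given \<open>X\<close>, the noise \<open>n\<close> is centred and its second moment is at most \<open>V\<close>.  Both properties are
  tested against functions of \<open>X\<close>, because the estimates below multiply the noise by such functions.\<close>

definition cond_noise ::
  "('a \<Rightarrow> 's::euclidean_space) \<Rightarrow> ('a \<Rightarrow> 'v::euclidean_space) \<Rightarrow> real \<Rightarrow> bool" where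
  "cond_noise X n V \<longleftrightarrow> n \<in> borel_measurable M \<and>
     (\<forall>u. u \<in> borel_measurable borel \<longrightarrow> sqint M (\<lambda>\<omega>. u (X \<omega>)) \<longrightarrow> (\<integral>\<omega>. u (X \<omega>) \<bullet> n \<omega> \<partial>M) = 0) \<and>
     (\<forall>c. c \<in> borel_measurable borel \<longrightarrow> (\<forall>s. 0 \<le> c s) \<longrightarrow> integrable M (\<lambda>\<omega>. c (X \<omega>)) \<longrightarrow>
        integrable M (\<lambda>\<omega>. c (X \<omega>) * (norm (n \<omega>))\<^sup>2) \<and>
        (\<integral>\<omega>. c (X \<omega>) * (norm (n \<omega>))\<^sup>2 \<partial>M) \<le> V * (\<integral>\<omega>. c (X \<omega>) \<partial>M))"

abbreviation "mean_sq U \<equiv> (\<integral>\<omega>. (norm (U \<omega>))\<^sup>2 \<partial>M)"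

lemma cond_noise_measurable: "cond_noise X n V \<Longrightarrow> n \<in> borel_measurable M"
  unfolding cond_noise_def by blast

lemma cond_noise_centred:
  assumes "cond_noise X n V" "u \<in> borel_measurable borel" "sqint M (\<lambda>\<omega>. u (X \<omega>))"
  shows "(\<integral>\<omega>. u (X \<omega>) \<bullet> n \<omega> \<partial>M) = 0"
  using assms(1)[unfolded cond_noise_def, THEN conjunct2, THEN conjunct1, rule_format, OF assms(2,3)] .

lemma cond_noise_weighted:
  assumes n: "cond_noise X n V" and c: "c \<in> borel_measurable borel" "\<And>s. 0 \<le> c s" "integrable M (\<lambda>\<omega>. c (X \<omega>))"
  shows "integrable M (\<lambda>\<omega>. c (X \<omega>) * (norm (n \<omega>))\<^sup>2)"
    and "(\<integral>\<omega>. c (X \<omega>) * (norm (n \<omega>))\<^sup>2 \<partial>M) \<le> V * (\<integral>\<omega>. c (X \<omega>) \<partial>M)"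
  using n[unfolded cond_noise_def, THEN conjunct2, THEN conjunct2, rule_format, OF c] by blast+

lemma cond_noise_sqint:
  assumes n: "cond_noise X n V"
  shows "sqint M n" and "mean_sq (\<lambda>\<omega>. n \<omega>) \<le> V"
proof -
  have w: "integrable M (\<lambda>\<omega>. 1 * (norm (n \<omega>))\<^sup>2)"
    "(\<integral>\<omega>. 1 * (norm (n \<omega>))\<^sup>2 \<partial>M) \<le> V * (\<integral>\<omega>. 1 \<partial>M)"
    by (rule cond_noise_weighted[OF n, of "\<lambda>_. 1"]; simp)+
  show "sqint M n"
    by (rule sqintI[OF cond_noise_measurable[OF n]]) (use w(1) in simp)
  show "mean_sq (\<lambda>\<omega>. n \<omega>) \<le> V"
    using w(2) by (simp add: prob_space)
qed

text \<open>Second moments are inherited through pointwise domination; this is common to all closure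
  properties of \<open>cond_noise\<close>.\<close>

lemma cond_noise_dominated:
  fixes X :: "'a \<Rightarrow> 's::euclidean_space"
  assumes n1: "cond_noise X n1 V1" and n2: "cond_noise X n2 V2"
    and ab: "0 \<le> a" "0 \<le> b" and V: "a * V1 + b * V2 \<le> V"
    and n: "n \<in> borel_measurable M"
    and le: "\<And>\<omega>. (norm (n \<omega>))\<^sup>2 \<le> a * (norm (n1 \<omega>))\<^sup>2 + b * (norm (n2 \<omega>))\<^sup>2"
    and centred: "\<And>u. \<lbrakk>u \<in> borel_measurable borel; sqint M (\<lambda>\<omega>. u (X \<omega>))\<rbrakk> \<Longrightarrow> (\<integral>\<omega>. u (X \<omega>) \<bullet> n \<omega> \<partial>M) = 0"
  shows "cond_noise X n V"
  unfolding cond_noise_def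
proof (intro conjI allI impI n centred)
  fix c :: "'s \<Rightarrow> real"
  assume c: "c \<in> borel_measurable borel" "\<forall>s. 0 \<le> c s" "integrable M (\<lambda>\<omega>. c (X \<omega>))"
  note w1 = cond_noise_weighted[OF n1 c(1) c(2)[rule_format] c(3)]
    and w2 = cond_noise_weighted[OF n2 c(1) c(2)[rule_format] c(3)]
  let ?b = "\<lambda>\<omega>. a * (c (X \<omega>) * (norm (n1 \<omega>))\<^sup>2) + b * (c (X \<omega>) * (norm (n2 \<omega>))\<^sup>2)"
  have cle: "c (X \<omega>) * (norm (n \<omega>))\<^sup>2 \<le> ?b \<omega>" for \<omega>
    using mult_left_mono[OF le[of \<omega>], of "c (X \<omega>)"] c(2) by (simp add: algebra_simps)
  have b: "integrable M ?b" using w1 w2 by simp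
  show i: "integrable M (\<lambda>\<omega>. c (X \<omega>) * (norm (n \<omega>))\<^sup>2)"
  proof (rule Bochner_Integration.integrable_bound[OF b])
    show "(\<lambda>\<omega>. c (X \<omega>) * (norm (n \<omega>))\<^sup>2) \<in> borel_measurable M"
      using n c(3) by measurable
    show "AE \<omega> in M. norm (c (X \<omega>) * (norm (n \<omega>))\<^sup>2) \<le> norm (?b \<omega>)"
      using cle c(2) order_trans[OF cle abs_ge_self] by simp
  qed
  have "(\<integral>\<omega>. c (X \<omega>) * (norm (n \<omega>))\<^sup>2 \<partial>M) \<le> (\<integral>\<omega>. ?b \<omega> \<partial>M)"
    by (rule integral_mono[OF i b]) (rule cle)
  also have "\<dots> = a * (\<integral>\<omega>. c (X \<omega>) * (norm (n1 \<omega>))\<^sup>2 \<partial>M) + b * (\<integral>\<omega>. c (X \<omega>) * (norm (n2 \<omega>))\<^sup>2 \<partial>M)"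
    using w1 w2 by simp
  also have "\<dots> \<le> a * (V1 * (\<integral>\<omega>. c (X \<omega>) \<partial>M)) + b * (V2 * (\<integral>\<omega>. c (X \<omega>) \<partial>M))"
    using w1(2) w2(2) ab by (intro add_mono mult_left_mono)
  also have "\<dots> = (a * V1 + b * V2) * (\<integral>\<omega>. c (X \<omega>) \<partial>M)" by (simp add: algebra_simps)
  also have "\<dots> \<le> V * (\<integral>\<omega>. c (X \<omega>) \<partial>M)"
    using V c(2) by (intro mult_right_mono integral_nonneg_AE) auto
  finally show "(\<integral>\<omega>. c (X \<omega>) * (norm (n \<omega>))\<^sup>2 \<partial>M) \<le> V * (\<integral>\<omega>. c (X \<omega>) \<partial>M)" .
qed

lemma cond_noise_scaleR:
  fixes X :: "'a \<Rightarrow> 's::euclidean_space"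
  assumes n: "cond_noise X n V"
  shows "cond_noise X (\<lambda>\<omega>. r *\<^sub>R n \<omega>) (r\<^sup>2 * V)"
proof (rule cond_noise_dominated[OF n n, where a = "r\<^sup>2" and b = 0])
  show "(\<integral>\<omega>. u (X \<omega>) \<bullet> (r *\<^sub>R n \<omega>) \<partial>M) = 0"
    if "u \<in> borel_measurable borel" "sqint M (\<lambda>\<omega>. u (X \<omega>))" for u
    using cond_noise_centred[OF n that] by simp
qed (use cond_noise_measurable[OF n] in \<open>simp_all add: power_mult_distrib\<close>)

lemma cond_noise_add:
  fixes X :: "'a \<Rightarrow> 's::euclidean_space"
  assumes n1: "cond_noise X n1 V1" and n2: "cond_noise X n2 V2" and V: "2 * (V1 + V2) \<le> V"
  shows "cond_noise X (\<lambda>\<omega>. n1 \<omega> + n2 \<omega>) V"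
proof (rule cond_noise_dominated[OF n1 n2, where a = 2 and b = 2])
  show "(\<integral>\<omega>. u (X \<omega>) \<bullet> (n1 \<omega> + n2 \<omega>) \<partial>M) = 0"
    if "u \<in> borel_measurable borel" "sqint M (\<lambda>\<omega>. u (X \<omega>))" for u
    using cond_noise_centred[OF n1 that] cond_noise_centred[OF n2 that]
      sqint_inner_integrable[OF that(2) cond_noise_sqint(1)[OF n1]]
      sqint_inner_integrable[OF that(2) cond_noise_sqint(1)[OF n2]]
    by (simp add: inner_add_right)
  show "(\<lambda>\<omega>. n1 \<omega> + n2 \<omega>) \<in> borel_measurable M"
    using cond_noise_measurable[OF n1] cond_noise_measurable[OF n2] by simp
  show "(norm (n1 \<omega> + n2 \<omega>))\<^sup>2 \<le> 2 * (norm (n1 \<omega>))\<^sup>2 + 2 * (norm (n2 \<omega>))\<^sup>2" for \<omega>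
    by (rule norm_add_sq_le)
qed (use V in simp_all)

text \<open>\<open>L'\<close> is the adjoint of \<open>L\<close>, which moves \<open>L\<close> from the noise to the test function.\<close>

lemma cond_noise_image:
  fixes X :: "'a \<Rightarrow> 's::euclidean_space" and n :: "'a \<Rightarrow> 'v::euclidean_space" and L :: "'v \<Rightarrow> 'u::euclidean_space"
  assumes n: "cond_noise X n V" and L: "bounded_linear L" "\<And>v. norm (L v) \<le> norm v"
    and L': "bounded_linear L'" "\<And>u v. L' u \<bullet> v = u \<bullet> L v"
  shows "cond_noise X (\<lambda>\<omega>. L (n \<omega>)) V"
proof (rule cond_noise_dominated[OF n n, where a = 1 and b = 0])
  interpret L: bounded_linear L by (rule L)
  interpret L': bounded_linear L' by (rule L')
  have Lm: "L \<in> borel_measurable borel"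
    by (intro borel_measurable_continuous_onI L.continuous_on continuous_on_id)
  have Lm': "L' \<in> borel_measurable borel"
    by (intro borel_measurable_continuous_onI L'.continuous_on continuous_on_id)
  show "(\<lambda>\<omega>. L (n \<omega>)) \<in> borel_measurable M"
    by (rule measurable_compose[OF cond_noise_measurable[OF n] Lm])
  show "(\<integral>\<omega>. u (X \<omega>) \<bullet> L (n \<omega>) \<partial>M) = 0"
    if u: "u \<in> borel_measurable borel" "sqint M (\<lambda>\<omega>. u (X \<omega>))" for u
  proof -
    obtain K where K: "\<And>x. norm (L' x) \<le> norm x * K" using L'.bounded by blast
    have "sqint M (\<lambda>\<omega>. L' (u (X \<omega>)))"
    proof (rule sqint_bound[OF _ u(2), where A = 0 and B = K])
      show "(\<lambda>\<omega>. L' (u (X \<omega>))) \<in> borel_measurable M"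
        by (rule measurable_compose[OF sqint_measurable[OF u(2)] Lm'])
      show "norm (L' (u (X \<omega>))) \<le> 0 + K * norm (u (X \<omega>))" for \<omega>
        using K by (simp add: mult.commute)
    qed
    moreover have "(\<lambda>s. L' (u s)) \<in> borel_measurable borel"
      using u(1) Lm' by (rule measurable_compose)
    ultimately have "(\<integral>\<omega>. L' (u (X \<omega>)) \<bullet> n \<omega> \<partial>M) = 0"
      using cond_noise_centred[OF n, of "\<lambda>s. L' (u s)"] by simp
    then show ?thesis by (simp add: L')
  qed
  show "(norm (L (n \<omega>)))\<^sup>2 \<le> 1 * (norm (n \<omega>))\<^sup>2 + 0 * (norm (n \<omega>))\<^sup>2" for \<omega>
    using L(2) by (simp add: power_mono)
qed simp_all

lemma cond_noise_fst:
  "cond_noise X n V \<Longrightarrow> cond_noise X (\<lambda>\<omega>. fst (n \<omega> :: 'u::euclidean_space \<times> 'v::euclidean_space)) V"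
  by (rule cond_noise_image[where L' = "\<lambda>u. (u, 0)"])
    (auto simp: norm_fst_le bounded_linear_fst inner_prod_def intro!: bounded_linear_intros bounded_linear_Pair bounded_linear_ident bounded_linear_zero)

lemma cond_noise_snd:
  "cond_noise X n V \<Longrightarrow> cond_noise X (\<lambda>\<omega>. snd (n \<omega> :: 'u::euclidean_space \<times> 'v::euclidean_space)) V"
  by (rule cond_noise_image[where L' = "\<lambda>u. (0, u)"])
    (auto simp: norm_snd_le bounded_linear_snd inner_prod_def intro!: bounded_linear_intros bounded_linear_Pair bounded_linear_ident bounded_linear_zero)

text \<open>As the sample \<open>Z\<close> is independent of \<open>X\<close>, the joint law is a product, and Fubini's theorem allows to
  integrate over the sample first, at a fixed value of \<open>X\<close>.\<close>

lemma cond_noise_oracle: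
  fixes h :: "'v::euclidean_space \<Rightarrow> real" and X :: "'a \<Rightarrow> 's::euclidean_space"
  assumes X: "X \<in> borel_measurable M" and Z: "Z \<in> measurable M D"
    and joint: "distr M (borel \<Otimes>\<^sub>M D) (\<lambda>\<omega>. (X \<omega>, Z \<omega>)) = distr M borel X \<Otimes>\<^sub>M D"
    and G: "unbiased_oracle D G h \<sigma>" and h: "nabla h \<in> borel_measurable borel"
    and pt: "pt \<in> borel_measurable borel"
  shows "cond_noise X (\<lambda>\<omega>. G (pt (X \<omega>)) (Z \<omega>) - nabla h (pt (X \<omega>))) (\<sigma>\<^sup>2)"
proof -
  interpret D: prob_space D using G by (simp add: unbiased_oracle_def)
  define Q where "Q = distr M borel X"
  interpret Q: prob_space Q unfolding Q_def by (rule prob_space_distr[OF X])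
  interpret QD: pair_prob_space Q D ..
  note joint = joint[folded Q_def]
  have XZ: "(\<lambda>\<omega>. (X \<omega>, Z \<omega>)) \<in> measurable M (borel \<Otimes>\<^sub>M D)" using X Z by measurable
  have sQ: "sets Q = sets borel" by (simp add: Q_def)
  have sQD: "sets (Q \<Otimes>\<^sub>M D) = sets (borel \<Otimes>\<^sub>M D)" by (simp add: sets_pair_measure_cong[OF sQ refl])
  define N where "N s z = G (pt s) z - nabla h (pt s)" for s z
  have "(\<lambda>p. (pt (fst p), snd p)) \<in> measurable (borel \<Otimes>\<^sub>M D) (borel \<Otimes>\<^sub>M D)"
    using pt by measurable
  moreover have "(\<lambda>(p, s). G p s) \<in> borel_measurable (borel \<Otimes>\<^sub>M D)"
    using G unfolding unbiased_oracle_def by blast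
  ultimately have "(\<lambda>p. (\<lambda>(p, s). G p s) (pt (fst p), snd p)) \<in> borel_measurable (borel \<Otimes>\<^sub>M D)"
    by (rule measurable_compose)
  moreover have "(\<lambda>p. nabla h (pt (fst p))) \<in> borel_measurable (borel \<Otimes>\<^sub>M D)"
    using h pt by measurable
  ultimately have Nm: "(\<lambda>p. N (fst p) (snd p)) \<in> borel_measurable (borel \<Otimes>\<^sub>M D)"
    unfolding N_def by (simp add: borel_measurable_diff)
  have Gi: "integrable D (G p)" "(\<integral>s. G p s \<partial>D) = nabla h p"
      "integrable D (\<lambda>s. (norm (G p s - nabla h p))\<^sup>2)"
      "(\<integral>s. (norm (G p s - nabla h p))\<^sup>2 \<partial>D) \<le> \<sigma>\<^sup>2" for p
    using G by (auto simp: unbiased_oracle_def)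
  have nm: "(\<lambda>\<omega>. N (X \<omega>) (Z \<omega>)) \<in> borel_measurable M"
    using measurable_compose[OF XZ Nm] by simp
  have weighted: "integrable M (\<lambda>\<omega>. c (X \<omega>) * (norm (N (X \<omega>) (Z \<omega>)))\<^sup>2) \<and>
        (\<integral>\<omega>. c (X \<omega>) * (norm (N (X \<omega>) (Z \<omega>)))\<^sup>2 \<partial>M) \<le> \<sigma>\<^sup>2 * (\<integral>\<omega>. c (X \<omega>) \<partial>M)"
    if c: "c \<in> borel_measurable borel" "\<forall>s. 0 \<le> c s" "integrable M (\<lambda>\<omega>. c (X \<omega>))" for c :: "'s \<Rightarrow> real"
  proof -
    have cm: "(\<lambda>p. ennreal (c (fst p) * (norm (N (fst p) (snd p)))\<^sup>2)) \<in> borel_measurable (borel \<Otimes>\<^sub>M D)"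
      using c(1) Nm by measurable
    have "(\<integral>\<^sup>+\<omega>. ennreal (c (X \<omega>) * (norm (N (X \<omega>) (Z \<omega>)))\<^sup>2) \<partial>M)
        = (\<integral>\<^sup>+p. ennreal (c (fst p) * (norm (N (fst p) (snd p)))\<^sup>2) \<partial>(Q \<Otimes>\<^sub>M D))"
      unfolding joint[symmetric] by (subst nn_integral_distr[OF XZ]) (use cm in simp_all)
    also have "\<dots> = (\<integral>\<^sup>+s. (\<integral>\<^sup>+z. ennreal (c s * (norm (N s z))\<^sup>2) \<partial>D) \<partial>Q)"
      using D.nn_integral_fst[of "\<lambda>p. ennreal (c (fst p) * (norm (N (fst p) (snd p)))\<^sup>2)" Q] cm
      by (simp add: measurable_cong_sets[OF sQD refl])
    also have "\<dots> \<le> (\<integral>\<^sup>+s. ennreal (c s * \<sigma>\<^sup>2) \<partial>Q)"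
    proof (rule nn_integral_mono)
      fix s
      have "(\<integral>\<^sup>+z. ennreal (c s * (norm (N s z))\<^sup>2) \<partial>D) = ennreal (\<integral>z. c s * (norm (N s z))\<^sup>2 \<partial>D)"
        using c(2) Gi(3) by (intro nn_integral_eq_integral) (auto simp: N_def)
      also have "\<dots> \<le> ennreal (c s * \<sigma>\<^sup>2)"
        using c(2) Gi(4)[of "pt s"] by (intro ennreal_leI) (simp add: N_def mult_left_mono)
      finally show "(\<integral>\<^sup>+z. ennreal (c s * (norm (N s z))\<^sup>2) \<partial>D) \<le> ennreal (c s * \<sigma>\<^sup>2)" .
    qed
    also have "\<dots> = (\<integral>\<^sup>+\<omega>. ennreal (c (X \<omega>) * \<sigma>\<^sup>2) \<partial>M)"
      unfolding Q_def using c(1) by (subst nn_integral_distr[OF X]) auto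
    also have "\<dots> = ennreal (\<integral>\<omega>. c (X \<omega>) * \<sigma>\<^sup>2 \<partial>M)"
      using c by (intro nn_integral_eq_integral) auto
    finally have le: "(\<integral>\<^sup>+\<omega>. ennreal (c (X \<omega>) * (norm (N (X \<omega>) (Z \<omega>)))\<^sup>2) \<partial>M) \<le> ennreal (\<sigma>\<^sup>2 * (\<integral>\<omega>. c (X \<omega>) \<partial>M))"
      using c(3) by (simp add: mult.commute)
    have m: "(\<lambda>\<omega>. c (X \<omega>) * (norm (N (X \<omega>) (Z \<omega>)))\<^sup>2) \<in> borel_measurable M"
      using nm c(3) by measurable
    have i: "integrable M (\<lambda>\<omega>. c (X \<omega>) * (norm (N (X \<omega>) (Z \<omega>)))\<^sup>2)"
      using le c(2) m by (intro integrableI_nonneg) (auto simp: order_le_less_trans)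
    moreover have "(\<integral>\<omega>. c (X \<omega>) * (norm (N (X \<omega>) (Z \<omega>)))\<^sup>2 \<partial>M) \<le> \<sigma>\<^sup>2 * (\<integral>\<omega>. c (X \<omega>) \<partial>M)"
      using le c nn_integral_eq_integral[OF i] by (simp add: integral_nonneg_AE)
    ultimately show ?thesis by blast
  qed
  have ns: "sqint M (\<lambda>\<omega>. N (X \<omega>) (Z \<omega>))"
  proof (rule sqintI[OF nm])
    have "integrable M (\<lambda>\<omega>. 1 * (norm (N (X \<omega>) (Z \<omega>)))\<^sup>2)"
      by (rule weighted[of "\<lambda>_. 1", THEN conjunct1]; simp)
    then show "integrable M (\<lambda>\<omega>. (norm (N (X \<omega>) (Z \<omega>)))\<^sup>2)" by simp
  qed
  have centred: "(\<integral>\<omega>. u (X \<omega>) \<bullet> N (X \<omega>) (Z \<omega>) \<partial>M) = 0"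
    if u: "u \<in> borel_measurable borel" "sqint M (\<lambda>\<omega>. u (X \<omega>))" for u
  proof -
    let ?k = "\<lambda>p. u (fst p) \<bullet> N (fst p) (snd p)"
    have km: "?k \<in> borel_measurable (borel \<Otimes>\<^sub>M D)" using u(1) Nm by measurable
    have "integrable M (\<lambda>\<omega>. ?k (X \<omega>, Z \<omega>))"
      using sqint_inner_integrable[OF u(2) ns] by simp
    then have ki: "integrable (Q \<Otimes>\<^sub>M D) ?k"
      unfolding joint[symmetric] by (rule integrable_distr_eq[OF XZ km, THEN iffD2])
    have "(\<integral>\<omega>. ?k (X \<omega>, Z \<omega>) \<partial>M) = (\<integral>p. ?k p \<partial>(Q \<Otimes>\<^sub>M D))"
      unfolding joint[symmetric] by (rule integral_distr[OF XZ km, symmetric])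
    also have "\<dots> = (\<integral>s. (\<integral>z. ?k (s, z) \<partial>D) \<partial>Q)"
      using QD.integral_fst'[OF ki] by simp
    also have "\<dots> = (\<integral>s. 0 \<partial>Q)"
    proof (rule Bochner_Integration.integral_cong[OF refl])
      fix s
      have "integrable D (N s)" "(\<integral>z. N s z \<partial>D) = 0"
        unfolding N_def using Gi(1,2) by (simp_all add: D.prob_space)
      then show "(\<integral>z. ?k (s, z) \<partial>D) = 0" by simp
    qed
    finally show ?thesis by simp
  qed
  show ?thesis
    unfolding cond_noise_def N_def[symmetric] using nm weighted centred by blast
qed

lemma cond_noise_expand:
  assumes n: "cond_noise X n V" and u: "u \<in> borel_measurable borel" "sqint M (\<lambda>\<omega>. u (X \<omega>))"
  shows "mean_sq (\<lambda>\<omega>. u (X \<omega>) - r *\<^sub>R n \<omega>) \<le> mean_sq (\<lambda>\<omega>. u (X \<omega>)) + r\<^sup>2 * V"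
proof -
  note ns = cond_noise_sqint[OF n]
  have "mean_sq (\<lambda>\<omega>. u (X \<omega>) - r *\<^sub>R n \<omega>)
      = (\<integral>\<omega>. (norm (u (X \<omega>)))\<^sup>2 + (r\<^sup>2 * (norm (n \<omega>))\<^sup>2 - 2 * r * (u (X \<omega>) \<bullet> n \<omega>)) \<partial>M)"
    by (intro Bochner_Integration.integral_cong refl) (simp add: norm_diff_scaleR_sq)
  also have "\<dots> = mean_sq (\<lambda>\<omega>. u (X \<omega>)) + r\<^sup>2 * mean_sq (\<lambda>\<omega>. n \<omega>)"
    using sqint_inner_integrable[OF u(2) ns(1)] sqint_integrable[OF ns(1)] sqint_integrable[OF u(2)]
      cond_noise_centred[OF n u]
    by simp
  also have "\<dots> \<le> mean_sq (\<lambda>\<omega>. u (X \<omega>)) + r\<^sup>2 * V"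
    using ns(2) by (simp add: mult_left_mono)
  finally show ?thesis .
qed

text \<open>A stochastic gradient step on \<open>h x\<close>: the deterministic step contracts towards the minimiser \<open>\<phi> x\<close>, and the
  noise, being centred, adds its variance.\<close>

lemma cond_noise_gradient_step:
  fixes x :: "'a \<Rightarrow> 'u::euclidean_space" and w :: "'a \<Rightarrow> 'v::euclidean_space"
  assumes n: "cond_noise (\<lambda>\<omega>. (x \<omega>, w \<omega>)) n V" and x: "sqint M x" and w: "sqint M w"
    and \<phi>: "L0-lipschitz_on UNIV \<phi>" and G: "G \<in> borel_measurable borel" "sqint M (\<lambda>\<omega>. G (x \<omega>, w \<omega>))"
    and q: "\<And>x. quad_bounded m L (h x) (\<lambda>y. G (x, y))" and min: "\<And>x y. h x (\<phi> x) \<le> h x y"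
    and a: "0 \<le> a" "a * L \<le> 1"
  shows "mean_sq (\<lambda>\<omega>. w \<omega> - a *\<^sub>R G (x \<omega>, w \<omega>) - a *\<^sub>R n \<omega> - \<phi> (x \<omega>))
    \<le> (1 - a * m) * mean_sq (\<lambda>\<omega>. w \<omega> - \<phi> (x \<omega>)) + a\<^sup>2 * V"
proof -
  define u where "u p = snd p - a *\<^sub>R G p - \<phi> (fst p)" for p
  have \<phi>m: "\<phi> \<in> borel_measurable borel"
    by (rule borel_measurable_continuous_onI[OF lipschitz_on_continuous_on[OF \<phi>]])
  have um: "u \<in> borel_measurable borel"
    unfolding u_def
    by (intro borel_measurable_diff borel_measurable_scaleR borel_measurable_const G(1) snd_borel_measurable
        measurable_compose[OF fst_borel_measurable \<phi>m])
  have us: "sqint M (\<lambda>\<omega>. u (x \<omega>, w \<omega>))"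
    unfolding u_def fst_conv snd_conv by (intro sqint_diff sqint_scaleR w G(2) sqint_lipschitz[OF x \<phi>])
  have "mean_sq (\<lambda>\<omega>. w \<omega> - a *\<^sub>R G (x \<omega>, w \<omega>) - a *\<^sub>R n \<omega> - \<phi> (x \<omega>))
      = mean_sq (\<lambda>\<omega>. u (x \<omega>, w \<omega>) - a *\<^sub>R n \<omega>)"
    unfolding u_def fst_conv snd_conv by (simp add: algebra_simps)
  also have "\<dots> \<le> mean_sq (\<lambda>\<omega>. u (x \<omega>, w \<omega>)) + a\<^sup>2 * V"
    by (rule cond_noise_expand[OF n um us])
  also have "mean_sq (\<lambda>\<omega>. u (x \<omega>, w \<omega>)) \<le> (\<integral>\<omega>. (1 - a * m) * (norm (w \<omega> - \<phi> (x \<omega>)))\<^sup>2 \<partial>M)"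
  proof (rule integral_mono[OF sqint_integrable[OF us]])
    show "integrable M (\<lambda>\<omega>. (1 - a * m) * (norm (w \<omega> - \<phi> (x \<omega>)))\<^sup>2)"
      by (intro integrable_mult_right sqint_integrable sqint_diff w sqint_lipschitz[OF x \<phi>])
    show "(norm (u (x \<omega>, w \<omega>)))\<^sup>2 \<le> (1 - a * m) * (norm (w \<omega> - \<phi> (x \<omega>)))\<^sup>2" for \<omega>
      unfolding u_def fst_conv snd_conv by (rule quad_bounded_gradient_step[OF q min a])
  qed
  finally show ?thesis by simp
qed

text \<open>A target \<open>\<phi>(x)\<close> is followed by \<open>v\<close> while \<open>x\<close> makes the noisy step \<open>- h (q + n)\<close>.  The motion of the
  target is split at the mean point \<open>x - h q\<close>.  The first part is at most \<open>L0 h |q|\<close>.  The second is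
  linear in \<open>n\<close>, hence invisible in expectation, up to a remainder \<open>L1 h\<^sup>2 |n|\<^sup>2\<close>.  So the noise costs
  \<open>O(h\<^sup>2)\<close>, where the Lipschitz constant alone would give \<open>O(h)\<close>.\<close>

lemma cond_noise_tracking:
  fixes \<phi> :: "'u::euclidean_space \<Rightarrow> 'v::euclidean_space" and N :: "'a \<Rightarrow> 's::euclidean_space"
  assumes T: "taylor_map L0 L1 \<phi> D" and n: "cond_noise N n V" and N: "N \<in> borel_measurable M"
    and x: "x \<in> borel_measurable borel" "sqint M (\<lambda>\<omega>. x (N \<omega>))"
    and q: "q \<in> borel_measurable borel" "sqint M (\<lambda>\<omega>. q (N \<omega>))"
    and v: "v \<in> borel_measurable borel" "sqint M (\<lambda>\<omega>. v (N \<omega>))"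
    and h: "h \<ge> 0" and s: "s > 0"
  shows "mean_sq (\<lambda>\<omega>. v (N \<omega>) - \<phi> (x (N \<omega>) - h *\<^sub>R (q (N \<omega>) + n \<omega>)))
    \<le> (1 + s / 8) * mean_sq (\<lambda>\<omega>. v (N \<omega>) - \<phi> (x (N \<omega>)))
      + (16 / s + 1) * L0\<^sup>2 * h\<^sup>2 * mean_sq (\<lambda>\<omega>. q (N \<omega>))
      + (16 / s * (L1 * h\<^sup>2 * V)\<^sup>2 + L0\<^sup>2 * h\<^sup>2 * V)"
proof -
  have lip: "L0-lipschitz_on UNIV \<phi>" and L1: "L1 \<ge> 0" using T by (auto simp: taylor_map_def)
  have L0: "L0 \<ge> 0" using lip by (rule lipschitz_on_nonneg)
  have \<phi>m: "\<phi> \<in> borel_measurable borel"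
    by (rule borel_measurable_continuous_onI[OF taylor_map_continuous[OF T]])
  have Dm: "(\<lambda>x. D x d) \<in> borel_measurable borel" for d
    by (rule taylor_map_derivative_measurable[OF T])
  define w where "w z = v z - \<phi> (x z)" for z
  define xm where "xm z = x z - h *\<^sub>R q z" for z
  \<comment> \<open>The adjoint of \<open>D\<close> at the mean point, applied to \<open>w\<close>; this form shows its measurability.\<close>
  define u where "u z = (\<Sum>b\<in>Basis. (w z \<bullet> D (xm z) b) *\<^sub>R b)" for z
  have wm: "w \<in> borel_measurable borel"
    unfolding w_def using v(1) measurable_compose[OF x(1) \<phi>m] by (rule borel_measurable_diff)
  have xmm: "xm \<in> borel_measurable borel"
    unfolding xm_def by (intro borel_measurable_diff borel_measurable_scaleR borel_measurable_const x q)
  have um: "u \<in> borel_measurable borel"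
    unfolding u_def
    by (intro borel_measurable_sum borel_measurable_scaleR borel_measurable_inner borel_measurable_const
        wm measurable_compose[OF xmm Dm])
  have ws: "sqint M (\<lambda>\<omega>. w (N \<omega>))"
    unfolding w_def by (rule sqint_diff[OF v(2) sqint_lipschitz[OF x(2) lip]])
  have u_inner: "u z \<bullet> d = w z \<bullet> D (xm z) d" for z d
  proof -
    have "D (xm z) d = D (xm z) (\<Sum>b\<in>Basis. (d \<bullet> b) *\<^sub>R b)" by (simp add: euclidean_representation)
    then show ?thesis
      by (simp add: u_def blinfun.sum_right blinfun.scaleR_right inner_sum_left inner_sum_right inner_commute mult.commute)
  qed
  have u_norm: "norm (u z) \<le> L0 * norm (w z)" for z
  proof -
    have "norm (u z) * norm (u z) = w z \<bullet> D (xm z) (u z)"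
      using u_inner[of z "u z"] by (simp add: dot_square_norm power2_eq_square)
    also have "\<dots> \<le> norm (w z) * (L0 * norm (u z))"
      using norm_cauchy_schwarz taylor_map_derivative_bound[OF T, of "xm z" "u z"]
      by (meson mult_left_mono norm_ge_zero order_trans)
    finally have "norm (u z) * norm (u z) \<le> (L0 * norm (w z)) * norm (u z)" by (simp add: mult_ac)
    then show ?thesis
      by (cases "norm (u z) = 0") (use L0 in auto)
  qed
  have us: "sqint M (\<lambda>\<omega>. u (N \<omega>))"
  proof (rule sqint_bound[OF _ ws, where A = 0 and B = L0])
    show "(\<lambda>\<omega>. u (N \<omega>)) \<in> borel_measurable M"
      by (rule measurable_compose[OF N um])
  qed (use u_norm in simp)
  note ns = cond_noise_sqint[OF n]
  define lin where "lin z = (2 * h) *\<^sub>R u z + (2 * L0\<^sup>2 * h\<^sup>2) *\<^sub>R q z" for z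
  define c where "c z = 2 * L1 * h\<^sup>2 * norm (w z) + L0\<^sup>2 * h\<^sup>2" for z
  define R where "R \<omega> = (1 + s / 16) * (norm (w (N \<omega>)))\<^sup>2 + (16 / s + 1) * L0\<^sup>2 * h\<^sup>2 * (norm (q (N \<omega>)))\<^sup>2" for \<omega>
  have linm: "lin \<in> borel_measurable borel"
    unfolding lin_def by (intro borel_measurable_add borel_measurable_scaleR borel_measurable_const um q)
  have lins: "sqint M (\<lambda>\<omega>. lin (N \<omega>))"
    unfolding lin_def by (intro sqint_add sqint_scaleR us q)
  have cm: "c \<in> borel_measurable borel" unfolding c_def using wm by measurable
  have c0: "0 \<le> c z" for z using L1 L0 by (simp add: c_def)
  have ci: "integrable M (\<lambda>\<omega>. c (N \<omega>))"
    unfolding c_def using sqint_norm_integrable[OF ws] by simp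
  have Ri: "integrable M R"
    unfolding R_def using sqint_integrable[OF ws] sqint_integrable[OF q(2)] by simp
  have pointwise: "(norm (v (N \<omega>) - \<phi> (x (N \<omega>) - h *\<^sub>R (q (N \<omega>) + n \<omega>))))\<^sup>2
      \<le> R \<omega> + lin (N \<omega>) \<bullet> n \<omega> + c (N \<omega>) * (norm (n \<omega>))\<^sup>2" for \<omega>
  proof -
    let ?z = "N \<omega>"
    \<comment> \<open>The motion of the target before and after the mean point, and the nonlinear part \<open>r\<close> of the latter.\<close>
    define e1 where "e1 = \<phi> (xm ?z) - \<phi> (x ?z)"
    define e2 where "e2 = \<phi> (xm ?z - h *\<^sub>R n \<omega>) - \<phi> (xm ?z)"
    define r where "r = e2 + h *\<^sub>R D (xm ?z) (n \<omega>)"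
    have x': "x ?z - h *\<^sub>R (q ?z + n \<omega>) = xm ?z - h *\<^sub>R n \<omega>"
      by (simp add: xm_def algebra_simps)
    have lhs: "v ?z - \<phi> (x ?z - h *\<^sub>R (q ?z + n \<omega>)) = w ?z - (e1 + e2)"
      by (simp add: x' w_def e1_def e2_def)
    have "norm (\<phi> (xm ?z - h *\<^sub>R n \<omega>) - \<phi> (xm ?z) - D (xm ?z) ((xm ?z - h *\<^sub>R n \<omega>) - xm ?z))
        \<le> L1 * (norm ((xm ?z - h *\<^sub>R n \<omega>) - xm ?z))\<^sup>2"
      using T unfolding taylor_map_def by blast
    then have nr: "norm r \<le> L1 * h\<^sup>2 * (norm (n \<omega>))\<^sup>2"
      by (simp add: r_def e2_def blinfun.minus_right blinfun.scaleR_right power_mult_distrib mult.assoc)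
    have ne1: "norm e1 \<le> L0 * h * norm (q ?z)"
      using lipschitz_onD[OF lip, of "xm ?z" "x ?z"] h by (simp add: e1_def xm_def dist_norm mult.assoc)
    have "e1 + e2 = \<phi> (x ?z - h *\<^sub>R (q ?z + n \<omega>)) - \<phi> (x ?z)"
      by (simp add: x' e1_def e2_def)
    then have "norm (e1 + e2) \<le> L0 * (h * norm (q ?z + n \<omega>))"
      using lipschitz_onD[OF lip, of "x ?z - h *\<^sub>R (q ?z + n \<omega>)" "x ?z"] h by (simp add: dist_norm)
    then have "(norm (e1 + e2))\<^sup>2 \<le> (L0 * (h * norm (q ?z + n \<omega>)))\<^sup>2"
      by (rule power_mono) simp
    also have "\<dots> = L0\<^sup>2 * h\<^sup>2 * (norm (q ?z - (-1) *\<^sub>R n \<omega>))\<^sup>2"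
      by (simp add: power_mult_distrib mult.assoc)
    also have "\<dots> = L0\<^sup>2 * h\<^sup>2 * (norm (q ?z))\<^sup>2 + 2 * L0\<^sup>2 * h\<^sup>2 * (q ?z \<bullet> n \<omega>) + L0\<^sup>2 * h\<^sup>2 * (norm (n \<omega>))\<^sup>2"
      unfolding norm_diff_scaleR_sq by (simp add: algebra_simps)
    finally have b1: "(norm (e1 + e2))\<^sup>2 \<le> L0\<^sup>2 * h\<^sup>2 * (norm (q ?z))\<^sup>2 + 2 * L0\<^sup>2 * h\<^sup>2 * (q ?z \<bullet> n \<omega>)
        + L0\<^sup>2 * h\<^sup>2 * (norm (n \<omega>))\<^sup>2" .
    have "- (w ?z \<bullet> e1) \<le> norm (w ?z) * norm e1"
      using norm_cauchy_schwarz[of "w ?z" "- e1"] by simp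
    also have "\<dots> \<le> norm (w ?z) * (L0 * h * norm (q ?z))"
      using ne1 by (rule mult_left_mono) simp
    finally have "- 2 * (w ?z \<bullet> e1) \<le> 2 * (norm (w ?z) * (L0 * h * norm (q ?z)))" by linarith
    also have "\<dots> = 2 * norm (w ?z) * (L0 * h * norm (q ?z))" by (rule mult.assoc[symmetric])
    also have "\<dots> \<le> s / 16 * (norm (w ?z))\<^sup>2 + 16 / s * (L0 * h * norm (q ?z))\<^sup>2"
      by (rule weighted_young[OF s])
    finally have b2: "- 2 * (w ?z \<bullet> e1) \<le> s / 16 * (norm (w ?z))\<^sup>2 + 16 / s * (L0\<^sup>2 * h\<^sup>2 * (norm (q ?z))\<^sup>2)"
      by (simp add: power_mult_distrib)
    have "- (w ?z \<bullet> r) \<le> norm (w ?z) * norm r"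
      using norm_cauchy_schwarz[of "w ?z" "- r"] by simp
    also have "\<dots> \<le> norm (w ?z) * (L1 * h\<^sup>2 * (norm (n \<omega>))\<^sup>2)"
      using nr by (rule mult_left_mono) simp
    finally have b3: "- (w ?z \<bullet> r) \<le> L1 * h\<^sup>2 * norm (w ?z) * (norm (n \<omega>))\<^sup>2"
      by (simp add: mult_ac)
    have e2: "w ?z \<bullet> e2 = w ?z \<bullet> r - h * (u ?z \<bullet> n \<omega>)"
      by (simp add: r_def inner_add_right u_inner)
    have "(norm (w ?z - (e1 + e2)))\<^sup>2 = (norm (w ?z - 1 *\<^sub>R (e1 + e2)))\<^sup>2" by simp
    also have "\<dots> = (norm (w ?z))\<^sup>2 - 2 * (w ?z \<bullet> e1) - 2 * (w ?z \<bullet> r) + 2 * h * (u ?z \<bullet> n \<omega>) + (norm (e1 + e2))\<^sup>2"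
      unfolding norm_diff_scaleR_sq by (simp add: inner_add_right e2 algebra_simps)
    also have "\<dots> \<le> (norm (w ?z))\<^sup>2 + (s / 16 * (norm (w ?z))\<^sup>2 + 16 / s * (L0\<^sup>2 * h\<^sup>2 * (norm (q ?z))\<^sup>2))
        + 2 * (L1 * h\<^sup>2 * norm (w ?z) * (norm (n \<omega>))\<^sup>2) + 2 * h * (u ?z \<bullet> n \<omega>)
        + (L0\<^sup>2 * h\<^sup>2 * (norm (q ?z))\<^sup>2 + 2 * L0\<^sup>2 * h\<^sup>2 * (q ?z \<bullet> n \<omega>) + L0\<^sup>2 * h\<^sup>2 * (norm (n \<omega>))\<^sup>2)"
      using b1 b2 b3 by linarith
    also have "\<dots> = R \<omega> + lin ?z \<bullet> n \<omega> + c ?z * (norm (n \<omega>))\<^sup>2"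
      by (simp add: R_def lin_def c_def inner_add_left algebra_simps)
    finally show ?thesis unfolding lhs .
  qed
  note wgt = cond_noise_weighted[OF n cm c0 ci]
  have i2: "integrable M (\<lambda>\<omega>. lin (N \<omega>) \<bullet> n \<omega>)" by (rule sqint_inner_integrable[OF lins ns(1)])
  have lhs_i: "integrable M (\<lambda>\<omega>. (norm (v (N \<omega>) - \<phi> (x (N \<omega>) - h *\<^sub>R (q (N \<omega>) + n \<omega>))))\<^sup>2)"
    by (intro sqint_integrable sqint_diff sqint_add sqint_scaleR sqint_lipschitz[OF _ lip] x q v ns(1))
  have "mean_sq (\<lambda>\<omega>. v (N \<omega>) - \<phi> (x (N \<omega>) - h *\<^sub>R (q (N \<omega>) + n \<omega>)))
      \<le> (\<integral>\<omega>. R \<omega> + lin (N \<omega>) \<bullet> n \<omega> + c (N \<omega>) * (norm (n \<omega>))\<^sup>2 \<partial>M)"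
    by (rule integral_mono[OF lhs_i]) (use Ri i2 wgt(1) pointwise in auto)
  also have "\<dots> = (\<integral>\<omega>. R \<omega> \<partial>M) + (\<integral>\<omega>. c (N \<omega>) * (norm (n \<omega>))\<^sup>2 \<partial>M)"
    using Ri i2 wgt(1) cond_noise_centred[OF n linm lins] by simp
  also have "\<dots> \<le> (\<integral>\<omega>. R \<omega> \<partial>M) + V * (\<integral>\<omega>. c (N \<omega>) \<partial>M)" using wgt(2) by simp
  also have "V * (\<integral>\<omega>. c (N \<omega>) \<partial>M) = (\<integral>\<omega>. V * c (N \<omega>) \<partial>M)" by simp
  also have "\<dots> \<le> (\<integral>\<omega>. s / 16 * (norm (w (N \<omega>)))\<^sup>2 + (16 / s * (L1 * h\<^sup>2 * V)\<^sup>2 + L0\<^sup>2 * h\<^sup>2 * V) \<partial>M)"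
  proof (rule integral_mono)
    show "integrable M (\<lambda>\<omega>. V * c (N \<omega>))" using ci by simp
    show "integrable M (\<lambda>\<omega>. s / 16 * (norm (w (N \<omega>)))\<^sup>2 + (16 / s * (L1 * h\<^sup>2 * V)\<^sup>2 + L0\<^sup>2 * h\<^sup>2 * V))"
      using sqint_integrable[OF ws] by simp
    show "V * c (N \<omega>) \<le> s / 16 * (norm (w (N \<omega>)))\<^sup>2 + (16 / s * (L1 * h\<^sup>2 * V)\<^sup>2 + L0\<^sup>2 * h\<^sup>2 * V)" for \<omega>
      using weighted_young[OF s, of "norm (w (N \<omega>))" "L1 * h\<^sup>2 * V"] by (simp add: c_def algebra_simps)
  qed
  also have "\<dots> = s / 16 * mean_sq (\<lambda>\<omega>. w (N \<omega>)) + (16 / s * (L1 * h\<^sup>2 * V)\<^sup>2 + L0\<^sup>2 * h\<^sup>2 * V)"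
    using sqint_integrable[OF ws] by (simp add: prob_space)
  also have "(\<integral>\<omega>. R \<omega> \<partial>M) = (1 + s / 16) * mean_sq (\<lambda>\<omega>. w (N \<omega>))
      + (16 / s + 1) * L0\<^sup>2 * h\<^sup>2 * mean_sq (\<lambda>\<omega>. q (N \<omega>))"
    unfolding R_def using sqint_integrable[OF ws] sqint_integrable[OF q(2)] by simp
  finally show ?thesis unfolding w_def[symmetric] by (simp add: algebra_simps)
qed

text \<open>The descent lemma with \<open>-\<langle>\<nabla>F, q\<rangle> = (|q - \<nabla>F|\<^sup>2 - |\<nabla>F|\<^sup>2 - |q|\<^sup>2) / 2\<close>.  The condition on \<open>h\<close> lets
  half of the term \<open>- h/2 |q|\<^sup>2\<close> survive the quadratic term; it is needed to absorb the motion of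
  the targets.\<close>

lemma cond_noise_descent:
  fixes F :: "'u::euclidean_space \<Rightarrow> real" and N :: "'a \<Rightarrow> 's::euclidean_space"
  assumes F: "F differentiable_on UNIV" "L-lipschitz_on UNIV (nabla F)" and n: "cond_noise N n V"
    and x: "x \<in> borel_measurable borel" "sqint M (\<lambda>\<omega>. x (N \<omega>))"
    and q: "q \<in> borel_measurable borel" "sqint M (\<lambda>\<omega>. q (N \<omega>))"
    and h: "h \<ge> 0" "2 * L * h \<le> 1"
    and Fi: "integrable M (\<lambda>\<omega>. F (x (N \<omega>)))"
      "integrable M (\<lambda>\<omega>. F (x (N \<omega>) - h *\<^sub>R (q (N \<omega>) + n \<omega>)))"
  shows "(\<integral>\<omega>. F (x (N \<omega>) - h *\<^sub>R (q (N \<omega>) + n \<omega>)) \<partial>M)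
    \<le> (\<integral>\<omega>. F (x (N \<omega>)) \<partial>M) - h / 2 * mean_sq (\<lambda>\<omega>. nabla F (x (N \<omega>)))
      - h / 4 * mean_sq (\<lambda>\<omega>. q (N \<omega>))
      + h / 2 * mean_sq (\<lambda>\<omega>. q (N \<omega>) - nabla F (x (N \<omega>))) + L / 2 * h\<^sup>2 * V"
proof -
  have L: "L \<ge> 0" using F(2) by (rule lipschitz_on_nonneg)
  note ns = cond_noise_sqint[OF n]
  define G where "G z = nabla F (x z)" for z
  have Gm: "G \<in> borel_measurable borel"
    unfolding G_def
    by (rule measurable_compose[OF x(1) borel_measurable_continuous_onI[OF lipschitz_on_continuous_on[OF F(2)]]])
  have Gs: "sqint M (\<lambda>\<omega>. G (N \<omega>))" unfolding G_def by (rule sqint_lipschitz[OF x(2) F(2)])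
  have qGs: "sqint M (\<lambda>\<omega>. q (N \<omega>) - G (N \<omega>))" by (rule sqint_diff[OF q(2) Gs])
  define lin where "lin z = (L * h\<^sup>2) *\<^sub>R q z - h *\<^sub>R G z" for z
  have linm: "lin \<in> borel_measurable borel"
    unfolding lin_def by (intro borel_measurable_diff borel_measurable_scaleR borel_measurable_const Gm q)
  have lins: "sqint M (\<lambda>\<omega>. lin (N \<omega>))"
    unfolding lin_def by (intro sqint_diff sqint_scaleR Gs q)
  define R where "R \<omega> = F (x (N \<omega>)) - h / 2 * (norm (G (N \<omega>)))\<^sup>2 - h / 4 * (norm (q (N \<omega>)))\<^sup>2
      + h / 2 * (norm (q (N \<omega>) - G (N \<omega>)))\<^sup>2" for \<omega>
  have pointwise: "F (x (N \<omega>) - h *\<^sub>R (q (N \<omega>) + n \<omega>))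
      \<le> R \<omega> + lin (N \<omega>) \<bullet> n \<omega> + L / 2 * h\<^sup>2 * (norm (n \<omega>))\<^sup>2" for \<omega>
  proof -
    let ?z = "N \<omega>" and ?d = "q (N \<omega>) + n \<omega>"
    have 1: "F (x ?z - h *\<^sub>R ?d) \<le> F (x ?z) - h * (G ?z \<bullet> ?d) + L / 2 * (h\<^sup>2 * (norm ?d)\<^sup>2)"
      using quadratic_upper_bound[OF F, of "x ?z - h *\<^sub>R ?d" "x ?z"]
      by (simp add: G_def power_mult_distrib)
    have 2: "(norm ?d)\<^sup>2 = (norm (q ?z))\<^sup>2 + 2 * (q ?z \<bullet> n \<omega>) + (norm (n \<omega>))\<^sup>2"
      using norm_diff_scaleR_sq[of "q ?z" "-1" "n \<omega>"] by simp
    have 3: "(norm (q ?z - G ?z))\<^sup>2 = (norm (q ?z))\<^sup>2 - 2 * (G ?z \<bullet> q ?z) + (norm (G ?z))\<^sup>2"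
      using norm_diff_scaleR_sq[of "q ?z" 1 "G ?z"] by (simp add: inner_commute)
    have "(2 * L * h) * (h * (norm (q ?z))\<^sup>2) \<le> 1 * (h * (norm (q ?z))\<^sup>2)"
      using h by (intro mult_right_mono) auto
    then have 4: "L / 2 * h\<^sup>2 * (norm (q ?z))\<^sup>2 \<le> h / 4 * (norm (q ?z))\<^sup>2"
      by (simp add: power2_eq_square)
    have "R \<omega> + lin ?z \<bullet> n \<omega> + L / 2 * h\<^sup>2 * (norm (n \<omega>))\<^sup>2
        = F (x ?z) - h * (G ?z \<bullet> ?d) + L / 2 * (h\<^sup>2 * (norm ?d)\<^sup>2)
          + (h / 4 * (norm (q ?z))\<^sup>2 - L / 2 * h\<^sup>2 * (norm (q ?z))\<^sup>2)"
      unfolding R_def 2 3 by (simp add: lin_def inner_diff_left inner_add_right algebra_simps)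
    then show ?thesis using 1 4 by linarith
  qed
  have Ri: "integrable M R"
    unfolding R_def using Fi(1) sqint_integrable[OF Gs] sqint_integrable[OF q(2)] sqint_integrable[OF qGs] by simp
  have i2: "integrable M (\<lambda>\<omega>. lin (N \<omega>) \<bullet> n \<omega>)" by (rule sqint_inner_integrable[OF lins ns(1)])
  have "(\<integral>\<omega>. F (x (N \<omega>) - h *\<^sub>R (q (N \<omega>) + n \<omega>)) \<partial>M)
      \<le> (\<integral>\<omega>. R \<omega> + lin (N \<omega>) \<bullet> n \<omega> + L / 2 * h\<^sup>2 * (norm (n \<omega>))\<^sup>2 \<partial>M)"
    by (rule integral_mono[OF Fi(2)]) (use Ri i2 sqint_integrable[OF ns(1)] pointwise in auto)
  also have "\<dots> = (\<integral>\<omega>. R \<omega> \<partial>M) + L / 2 * h\<^sup>2 * mean_sq (\<lambda>\<omega>. n \<omega>)"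
    using Ri i2 sqint_integrable[OF ns(1)] cond_noise_centred[OF n linm lins] by simp
  also have "\<dots> \<le> (\<integral>\<omega>. R \<omega> \<partial>M) + L / 2 * h\<^sup>2 * V"
    using ns(2) L by (intro add_left_mono mult_left_mono) auto
  also have "(\<integral>\<omega>. R \<omega> \<partial>M) = (\<integral>\<omega>. F (x (N \<omega>)) \<partial>M) - h / 2 * mean_sq (\<lambda>\<omega>. G (N \<omega>))
      - h / 4 * mean_sq (\<lambda>\<omega>. q (N \<omega>)) + h / 2 * mean_sq (\<lambda>\<omega>. q (N \<omega>) - G (N \<omega>))"
    unfolding R_def
    using Fi(1) sqint_integrable[OF Gs] sqint_integrable[OF q(2)] sqint_integrable[OF qGs] by simp
  finally show ?thesis by (simp add: G_def)
qed

lemma smooth_function_integrable: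
  fixes F :: "'u::euclidean_space \<Rightarrow> real"
  assumes F: "F differentiable_on UNIV" "L-lipschitz_on UNIV (nabla F)" and x: "sqint M x"
  shows "integrable M (\<lambda>\<omega>. F (x \<omega>))"
proof (rule Bochner_Integration.integrable_bound)
  let ?b = "\<lambda>\<omega>. \<bar>F 0\<bar> + norm (nabla F 0) * norm (x \<omega>) + L / 2 * (norm (x \<omega>))\<^sup>2"
  show "integrable M ?b" using sqint_norm_integrable[OF x] sqint_integrable[OF x] by simp
  show "(\<lambda>\<omega>. F (x \<omega>)) \<in> borel_measurable M"
    by (rule borel_measurable_continuous_on[OF differentiable_imp_continuous_on[OF F(1)] sqint_measurable[OF x]])
  show "AE \<omega> in M. norm (F (x \<omega>)) \<le> norm (?b \<omega>)"
  proof (rule AE_I2)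
    fix \<omega>
    have "\<bar>nabla F 0 \<bullet> x \<omega>\<bar> \<le> norm (nabla F 0) * norm (x \<omega>)" by (rule Cauchy_Schwarz_ineq2)
    then have "\<bar>F (x \<omega>)\<bar> \<le> ?b \<omega>"
      using quadratic_upper_bound[OF F, of "x \<omega>" 0] quadratic_lower_bound[OF F, of 0 "x \<omega>"]
      by simp
    then show "norm (F (x \<omega>)) \<le> norm (?b \<omega>)" by simp
  qed
qed

end


section \<open>The iterates as functions of the samples\<close>

text \<open>A functional of the family of all samples that reads the coordinates in \<open>J\<close> only.  Then it is
  independent of every sample outside \<open>J\<close>.\<close>

definition adapted ::
  "(sample \<Rightarrow> 'z measure) \<Rightarrow> sample set \<Rightarrow> ((sample \<Rightarrow> 'z) \<Rightarrow> 'n::euclidean_space) \<Rightarrow> bool" where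
  "adapted D J \<Phi> \<longleftrightarrow> \<Phi> \<in> borel_measurable (PiM J D) \<and> (\<forall>s. \<Phi> (restrict s J) = \<Phi> s)"

lemma adapted_const: "adapted D J (\<lambda>s. c)"
  by (simp add: adapted_def)

lemma adapted_compose:
  assumes "adapted D J \<Phi>" "h \<in> borel_measurable borel"
  shows "adapted D J (\<lambda>s. h (\<Phi> s))"
  using assms by (auto simp: adapted_def intro: measurable_compose)

lemma adapted_Pair:
  assumes "adapted D J \<Phi>" "adapted D J \<Psi>"
  shows "adapted D J (\<lambda>s. (\<Phi> s, \<Psi> s))"
  using assms by (simp add: adapted_def borel_measurable_Pair)

lemma adapted_add:
  assumes "adapted D J \<Phi>" "adapted D J \<Psi>"
  shows "adapted D J (\<lambda>s. \<Phi> s + \<Psi> s)"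
  using assms unfolding adapted_def by (auto intro: borel_measurable_add)

lemma adapted_diff:
  assumes "adapted D J \<Phi>" "adapted D J \<Psi>"
  shows "adapted D J (\<lambda>s. \<Phi> s - \<Psi> s)"
  using assms unfolding adapted_def by (auto intro: borel_measurable_diff)

lemma adapted_scaleR:
  assumes "adapted D J \<Phi>"
  shows "adapted D J (\<lambda>s. r *\<^sub>R \<Phi> s)"
  using assms unfolding adapted_def by (auto intro: borel_measurable_scaleR)

lemmas adapted_fst = adapted_compose[OF _ fst_borel_measurable]
  and adapted_snd = adapted_compose[OF _ snd_borel_measurable]

lemma adapted_oracle:
  assumes p: "adapted D J p" and i: "i \<in> J" and G: "unbiased_oracle (D i) G h \<sigma>"
  shows "adapted D J (\<lambda>s. G (p s) (s i))"
proof -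
  have "(\<lambda>s. (p s, s i)) \<in> measurable (PiM J D) (borel \<Otimes>\<^sub>M D i)"
    using p i by (auto simp: adapted_def intro!: measurable_Pair measurable_component_singleton)
  moreover have "(\<lambda>(p, s). G p s) \<in> borel_measurable (borel \<Otimes>\<^sub>M D i)"
    using G unfolding unbiased_oracle_def by blast
  ultimately have "(\<lambda>s. (\<lambda>(p, s). G p s) (p s, s i)) \<in> borel_measurable (PiM J D)"
    by (rule measurable_compose)
  then show ?thesis using p i by (simp add: adapted_def)
qed

lemma adapted_random_variable:
  assumes P: "prob_space P" and ind: "prob_space.indep_vars P D S UNIV" and \<Phi>: "adapted D J \<Phi>"
  shows "(\<lambda>\<omega>. \<Phi> (\<lambda>j. S j \<omega>)) \<in> borel_measurable P"
proof -
  interpret prob_space P by (rule P)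
  have "S j \<in> measurable P (D j)" for j
    using ind by (auto simp: indep_vars_def)
  then have "(\<lambda>\<omega>. restrict (\<lambda>j. S j \<omega>) J) \<in> measurable P (PiM J D)"
    by (intro measurable_restrict)
  moreover have "\<Phi> \<in> borel_measurable (PiM J D)" using \<Phi> by (simp add: adapted_def)
  ultimately have "(\<lambda>\<omega>. \<Phi> (restrict (\<lambda>j. S j \<omega>) J)) \<in> borel_measurable P"
    by (rule measurable_compose)
  moreover have "\<Phi> (restrict (\<lambda>j. S j \<omega>) J) = \<Phi> (\<lambda>j. S j \<omega>)" for \<omega>
    using \<Phi> by (simp add: adapted_def)
  ultimately show ?thesis by simp
qed

text \<open>The restrictions of the family of samples to the disjoint sets \<open>J\<close> and \<open>{i}\<close> are independent.  Their
  product law is pushed forward along \<open>\<Phi>\<close> and the projection to \<open>i\<close>.\<close>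

lemma adapted_joint_law:
  assumes P: "prob_space P" and ind: "prob_space.indep_vars P D S UNIV"
    and law: "distr P (D i) (S i) = D i" and \<Phi>: "adapted D J \<Phi>" and i: "i \<notin> J"
  shows "distr P (borel \<Otimes>\<^sub>M D i) (\<lambda>\<omega>. (\<Phi> (\<lambda>j. S j \<omega>), S i \<omega>))
    = distr P borel (\<lambda>\<omega>. \<Phi> (\<lambda>j. S j \<omega>)) \<Otimes>\<^sub>M D i"
proof -
  interpret prob_space P by (rule P)
  let ?R = "\<lambda>J \<omega>. restrict (\<lambda>j. S j \<omega>) J"
  have S: "S j \<in> measurable P (D j)" for j
    using ind by (auto simp: indep_vars_def)
  have R: "?R J \<in> measurable P (PiM J D)" for J
    using S by (intro measurable_restrict)
  have \<Phi>m: "\<Phi> \<in> borel_measurable (PiM J D)" and \<Phi>R: "\<Phi> (?R J \<omega>) = \<Phi> (\<lambda>j. S j \<omega>)" for \<omega>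
    using \<Phi> by (simp_all add: adapted_def)
  have im: "(\<lambda>x. x i) \<in> measurable (PiM {i} D) (D i)" by (rule measurable_component_singleton) simp
  have "indep_var (PiM J D) (?R J) (PiM {i} D) (?R {i})"
    using i by (intro indep_var_restrict[OF ind]) auto
  then have RR: "distr P (PiM J D \<Otimes>\<^sub>M PiM {i} D) (\<lambda>\<omega>. (?R J \<omega>, ?R {i} \<omega>))
      = distr P (PiM J D) (?R J) \<Otimes>\<^sub>M distr P (PiM {i} D) (?R {i})"
    unfolding indep_var_distribution_eq by simp
  have d1: "distr (distr P (PiM J D) (?R J)) borel \<Phi> = distr P borel (\<lambda>\<omega>. \<Phi> (\<lambda>j. S j \<omega>))"
    by (simp add: distr_distr[OF \<Phi>m R] comp_def \<Phi>R)
  have d2: "distr (distr P (PiM {i} D) (?R {i})) (D i) (\<lambda>x. x i) = D i"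
    by (simp add: distr_distr[OF im R] comp_def law)
  have "prob_space (D i)" using prob_space_distr[OF S, of i] law by simp
  then have sf: "sigma_finite_measure (distr (distr P (PiM {i} D) (?R {i})) (D i) (\<lambda>x. x i))"
    unfolding d2 by (rule prob_space_imp_sigma_finite)
  have pm: "(\<lambda>(x, y). (\<Phi> x, y i)) \<in> measurable (PiM J D \<Otimes>\<^sub>M PiM {i} D) (borel \<Otimes>\<^sub>M D i)"
    using measurable_compose[OF measurable_fst \<Phi>m] measurable_compose[OF measurable_snd im]
    unfolding split_def by (rule measurable_Pair)
  have "distr P borel (\<lambda>\<omega>. \<Phi> (\<lambda>j. S j \<omega>)) \<Otimes>\<^sub>M D i
      = distr (distr P (PiM J D) (?R J) \<Otimes>\<^sub>M distr P (PiM {i} D) (?R {i})) (borel \<Otimes>\<^sub>M D i) (\<lambda>(x, y). (\<Phi> x, y i))"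
    using pair_measure_distr[OF _ _ sf, of \<Phi> "distr P (PiM J D) (?R J)" borel] \<Phi>m im
    unfolding d1 d2 by simp
  also have "\<dots> = distr P (borel \<Otimes>\<^sub>M D i) ((\<lambda>(x, y). (\<Phi> x, y i)) \<circ> (\<lambda>\<omega>. (?R J \<omega>, ?R {i} \<omega>)))"
    unfolding RR[symmetric] by (rule distr_distr[OF pm measurable_Pair[OF R R]])
  also have "\<dots> = distr P (borel \<Otimes>\<^sub>M D i) (\<lambda>\<omega>. (\<Phi> (\<lambda>j. S j \<omega>), S i \<omega>))"
    by (simp add: comp_def \<Phi>R)
  finally show ?thesis by simp
qed

primrec sample_round :: "sample \<Rightarrow> nat" where
  "sample_round (Zeta_y k t) = k"
| "sample_round (Zeta_x k) = k"
| "sample_round (Phi_y k t) = k"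
| "sample_round (Phi_z k t) = k"
| "sample_round (Phi_xy k) = k"
| "sample_round (Phi_xz k) = k"

definition past :: "nat \<Rightarrow> sample set" where
  "past k = {i. sample_round i < k}"

definition y_past :: "nat \<Rightarrow> nat \<Rightarrow> sample set" where
  "y_past k t = Zeta_y k ` {..<t} \<union> Phi_y k ` {..<t}"

definition z_past :: "nat \<Rightarrow> nat \<Rightarrow> sample set" where
  "z_past k t = Phi_z k ` {..<t}"

locale oracles =
  fixes Df Dg :: "'z measure" and f g :: "'a::euclidean_space \<times> 'b::euclidean_space \<Rightarrow> real"
    and Gf Gg :: "'a \<times> 'b \<Rightarrow> 'z \<Rightarrow> 'a \<times> 'b" and \<sigma>f \<sigma>g :: real
  assumes Gf: "unbiased_oracle Df Gf f \<sigma>f" and Gg: "unbiased_oracle Dg Gg g \<sigma>g"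
begin

abbreviation "D \<equiv> sample_law Df Dg"

lemma y_inner_adapted:
  assumes "adapted D J x" "adapted D J y" "y_past k t \<subseteq> J"
  shows "adapted D J (\<lambda>s. y_inner Gf Gg a l s k (x s) (y s) t)"
  using assms(3)
proof (induction t)
  case 0
  then show ?case using assms by simp
next
  case (Suc t)
  then have sub: "y_past k t \<subseteq> J" "Zeta_y k t \<in> J" "Phi_y k t \<in> J"
    by (auto simp: y_past_def)
  note p = adapted_Pair[OF assms(1) Suc.IH[OF sub(1)]]
  have "adapted D J (\<lambda>s. Gf (x s, y_inner Gf Gg a l s k (x s) (y s) t) (s (Zeta_y k t)))"
    by (rule adapted_oracle[OF p sub(2)]) (simp, rule Gf)
  moreover have "adapted D J (\<lambda>s. Gg (x s, y_inner Gf Gg a l s k (x s) (y s) t) (s (Phi_y k t)))"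
    by (rule adapted_oracle[OF p sub(3)]) (simp, rule Gg)
  ultimately show ?case
    unfolding y_inner.simps Let_def
    by (intro adapted_diff adapted_add adapted_scaleR adapted_snd Suc.IH sub)
qed

lemma z_inner_adapted:
  assumes "adapted D J x" "adapted D J z" "z_past k t \<subseteq> J"
  shows "adapted D J (\<lambda>s. z_inner Gg c s k (x s) (z s) t)"
  using assms(3)
proof (induction t)
  case 0
  then show ?case using assms by simp
next
  case (Suc t)
  then have sub: "z_past k t \<subseteq> J" "Phi_z k t \<in> J"
    by (auto simp: z_past_def)
  note p = adapted_Pair[OF assms(1) Suc.IH[OF sub(1)]]
  have "adapted D J (\<lambda>s. Gg (x s, z_inner Gg c s k (x s) (z s) t) (s (Phi_z k t)))"
    by (rule adapted_oracle[OF p sub(2)]) (simp, rule Gg)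
  then show ?case
    unfolding z_inner.simps Let_def
    by (intro adapted_diff adapted_add adapted_scaleR adapted_snd Suc.IH sub)
qed

lemma F2SA_adapted:
  assumes "past k \<subseteq> J"
  shows "adapted D J (\<lambda>s. F2SA Gf Gg \<alpha> \<gamma> \<delta> T \<xi> l0 x0 y0 z0 s k)"
  using assms
proof (induction k)
  case 0
  then show ?case by (simp add: adapted_const)
next
  case (Suc k)
  let ?F = "\<lambda>s. F2SA Gf Gg \<alpha> \<gamma> \<delta> T \<xi> l0 x0 y0 z0 s k"
  let ?x = "\<lambda>s. fst (?F s)" and ?y = "\<lambda>s. fst (snd (?F s))" and ?z = "\<lambda>s. snd (snd (?F s))"
  let ?l = "lam l0 \<delta> k"
  let ?y' = "\<lambda>s. y_inner Gf Gg (\<alpha> k) ?l s k (?x s) (?y s) T"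
  let ?z' = "\<lambda>s. z_inner Gg (\<gamma> k) s k (?x s) (?z s) T"
  have sub: "past k \<subseteq> J" "y_past k T \<subseteq> J" "z_past k T \<subseteq> J"
    "Zeta_x k \<in> J" "Phi_xy k \<in> J" "Phi_xz k \<in> J"
    using Suc.prems by (auto simp: past_def y_past_def z_past_def)
  note F = Suc.IH[OF sub(1)]
  have x: "adapted D J ?x" and y: "adapted D J ?y" and z: "adapted D J ?z"
    by (intro adapted_fst adapted_snd F)+
  have y': "adapted D J ?y'" by (rule y_inner_adapted[OF x y sub(2)])
  have z': "adapted D J ?z'" by (rule z_inner_adapted[OF x z sub(3)])
  have "adapted D J (\<lambda>s. Gf (?x s, ?y' s) (s (Zeta_x k)))"
    by (rule adapted_oracle[OF adapted_Pair[OF x y'] sub(4)]) (simp, rule Gf)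
  moreover have "adapted D J (\<lambda>s. Gg (?x s, ?y' s) (s (Phi_xy k)))"
    by (rule adapted_oracle[OF adapted_Pair[OF x y'] sub(5)]) (simp, rule Gg)
  moreover have "adapted D J (\<lambda>s. Gg (?x s, ?z' s) (s (Phi_xz k)))"
    by (rule adapted_oracle[OF adapted_Pair[OF x z'] sub(6)]) (simp, rule Gg)
  ultimately have "adapted D J (\<lambda>s. (?x s - (\<xi> * \<alpha> k) *\<^sub>R (fst (Gf (?x s, ?y' s) (s (Zeta_x k)))
        + ?l *\<^sub>R (fst (Gg (?x s, ?y' s) (s (Phi_xy k))) - fst (Gg (?x s, ?z' s) (s (Phi_xz k))))),
        ?y' s, ?z' s))"
    by (intro adapted_Pair adapted_diff adapted_add adapted_scaleR adapted_fst x y' z')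
  then show ?case by (simp add: Let_def split_def)
qed

end

locale f2sa = bilevel f g lf0 lf1 lf2 lg0 lg1 lg2 \<mu> l0 lF1 ll0 ll1 + oracles Df Dg f g Gf Gg \<sigma>f \<sigma>g
  for f g :: "'a::euclidean_space \<times> 'b::euclidean_space \<Rightarrow> real"
    and lf0 lf1 lf2 lg0 lg1 lg2 \<mu> l0 lF1 ll0 ll1 and Df Dg :: "'z measure" and Gf Gg and \<sigma>f \<sigma>g +
  fixes P :: "'w measure" and S :: "sample \<Rightarrow> 'w \<Rightarrow> 'z"
    and \<alpha> \<gamma> \<delta> :: "nat \<Rightarrow> real" and T :: nat and \<xi> :: real and x0 :: 'a and y0 z0 :: 'b
  assumes samples: "independent_samples P Df Dg S"
    and steps: "step_conditions \<alpha> \<gamma> \<delta> T \<xi> l0 lf1 lg1 \<mu> lF1"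
    and T_pos: "T \<ge> 1" and xi_pos: "\<xi> > 0"
begin

sublocale prob_space P
  using samples by (simp add: independent_samples_def)

lemma indep: "indep_vars D S UNIV" and law: "distr P (D i) (S i) = D i"
  using samples by (auto simp: independent_samples_def)

abbreviation "\<Lambda> k \<equiv> lam l0 \<delta> k"

abbreviation "sample_var k \<equiv> \<sigma>f\<^sup>2 + (\<Lambda> k)\<^sup>2 * \<sigma>g\<^sup>2"

definition "iter k \<omega> = F2SA Gf Gg \<alpha> \<gamma> \<delta> T \<xi> l0 x0 y0 z0 (\<lambda>i. S i \<omega>) k"
definition "X k \<omega> = fst (iter k \<omega>)"
definition "Y k \<omega> = fst (snd (iter k \<omega>))"
definition "Z k \<omega> = snd (snd (iter k \<omega>))"
definition "Yi k t \<omega> = y_inner Gf Gg (\<alpha> k) (\<Lambda> k) (\<lambda>i. S i \<omega>) k (X k \<omega>) (Y k \<omega>) t"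
definition "Zi k t \<omega> = z_inner Gg (\<gamma> k) (\<lambda>i. S i \<omega>) k (X k \<omega>) (Z k \<omega>) t"

lemma X_0: "X 0 \<omega> = x0" and Y_0: "Y 0 \<omega> = y0" and Z_0: "Z 0 \<omega> = z0"
  by (simp_all add: X_def Y_def Z_def iter_def)

lemma Yi_0: "Yi k 0 \<omega> = Y k \<omega>" and Zi_0: "Zi k 0 \<omega> = Z k \<omega>"
  by (simp_all add: Yi_def Zi_def)

lemma Y_Suc: "Y (Suc k) \<omega> = Yi k T \<omega>" and Z_Suc: "Z (Suc k) \<omega> = Zi k T \<omega>"
  by (simp_all add: X_def Y_def Z_def Yi_def Zi_def iter_def Let_def split_def)

definition "grad_y k p = snd (nabla f p) + \<Lambda> k *\<^sub>R snd (nabla g p)"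

definition "noise_y k t \<omega> = snd (Gf (X k \<omega>, Yi k t \<omega>) (S (Zeta_y k t) \<omega>) - nabla f (X k \<omega>, Yi k t \<omega>))
   + \<Lambda> k *\<^sub>R snd (Gg (X k \<omega>, Yi k t \<omega>) (S (Phi_y k t) \<omega>) - nabla g (X k \<omega>, Yi k t \<omega>))"

definition "noise_z k t \<omega> = snd (Gg (X k \<omega>, Zi k t \<omega>) (S (Phi_z k t) \<omega>) - nabla g (X k \<omega>, Zi k t \<omega>))"

lemma Yi_Suc: "Yi k (Suc t) \<omega> =
    Yi k t \<omega> - \<alpha> k *\<^sub>R grad_y k (X k \<omega>, Yi k t \<omega>) - \<alpha> k *\<^sub>R noise_y k t \<omega>"
  by (simp add: Yi_def noise_y_def grad_y_def Let_def algebra_simps)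

lemma Zi_Suc: "Zi k (Suc t) \<omega> =
    Zi k t \<omega> - \<gamma> k *\<^sub>R snd (nabla g (X k \<omega>, Zi k t \<omega>)) - \<gamma> k *\<^sub>R noise_z k t \<omega>"
  by (simp add: Zi_def noise_z_def Let_def algebra_simps)

text \<open>The iterates from which the \<open>x\<close>-step is taken.\<close>

definition "W k \<omega> = (X k \<omega>, Y (Suc k) \<omega>, Z (Suc k) \<omega>)"

definition "grad_x k p = (case p of (x, y, z) \<Rightarrow>
   fst (nabla f (x, y)) + \<Lambda> k *\<^sub>R (fst (nabla g (x, y)) - fst (nabla g (x, z))))"

definition "noise_x k \<omega> = fst (Gf (X k \<omega>, Y (Suc k) \<omega>) (S (Zeta_x k) \<omega>) - nabla f (X k \<omega>, Y (Suc k) \<omega>))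
   + (\<Lambda> k *\<^sub>R fst (Gg (X k \<omega>, Y (Suc k) \<omega>) (S (Phi_xy k) \<omega>) - nabla g (X k \<omega>, Y (Suc k) \<omega>))
   + (- \<Lambda> k) *\<^sub>R fst (Gg (X k \<omega>, Z (Suc k) \<omega>) (S (Phi_xz k) \<omega>) - nabla g (X k \<omega>, Z (Suc k) \<omega>)))"

lemma X_Suc: "X (Suc k) \<omega> = X k \<omega> - (\<xi> * \<alpha> k) *\<^sub>R (grad_x k (W k \<omega>) + noise_x k \<omega>)"
proof -
  have "X (Suc k) \<omega> = X k \<omega> - (\<xi> * \<alpha> k) *\<^sub>R
                 (fst (Gf (X k \<omega>, Yi k T \<omega>) (S (Zeta_x k) \<omega>))
                  + \<Lambda> k *\<^sub>R (fst (Gg (X k \<omega>, Yi k T \<omega>) (S (Phi_xy k) \<omega>))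
                           - fst (Gg (X k \<omega>, Zi k T \<omega>) (S (Phi_xz k) \<omega>))))"
    by (simp add: X_def Y_def Z_def Yi_def Zi_def iter_def Let_def split_def)
  then show ?thesis
    by (simp add: grad_x_def noise_x_def W_def Y_Suc Z_Suc algebra_simps)
qed

lemma Yi_adapted:
  assumes "past k \<subseteq> J" "y_past k t \<subseteq> J"
  shows "\<exists>\<Phi>. adapted D J \<Phi> \<and> (\<forall>\<omega>. \<Phi> (\<lambda>i. S i \<omega>) = (X k \<omega>, Yi k t \<omega>))"
proof -
  let ?F = "\<lambda>s. F2SA Gf Gg \<alpha> \<gamma> \<delta> T \<xi> l0 x0 y0 z0 s k"
  have x: "adapted D J (\<lambda>s. fst (?F s))" and y: "adapted D J (\<lambda>s. fst (snd (?F s)))"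
    by (intro adapted_fst adapted_snd F2SA_adapted assms)+
  show ?thesis
    by (rule exI, rule conjI, rule adapted_Pair[OF x y_inner_adapted[OF x y assms(2), of "\<alpha> k" "\<Lambda> k"]])
      (simp add: X_def Y_def Yi_def iter_def)
qed

lemma Zi_adapted:
  assumes "past k \<subseteq> J" "z_past k t \<subseteq> J"
  shows "\<exists>\<Phi>. adapted D J \<Phi> \<and> (\<forall>\<omega>. \<Phi> (\<lambda>i. S i \<omega>) = (X k \<omega>, Zi k t \<omega>))"
proof -
  let ?F = "\<lambda>s. F2SA Gf Gg \<alpha> \<gamma> \<delta> T \<xi> l0 x0 y0 z0 s k"
  have x: "adapted D J (\<lambda>s. fst (?F s))" and z: "adapted D J (\<lambda>s. snd (snd (?F s)))"
    by (intro adapted_fst adapted_snd F2SA_adapted assms)+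
  show ?thesis
    by (rule exI, rule conjI, rule adapted_Pair[OF x z_inner_adapted[OF x z assms(2), of "\<gamma> k"]])
      (simp add: X_def Z_def Zi_def iter_def)
qed

lemma W_adapted:
  assumes "past k \<subseteq> J" "y_past k T \<subseteq> J" "z_past k T \<subseteq> J"
  shows "\<exists>\<Phi>. adapted D J \<Phi> \<and> (\<forall>\<omega>. \<Phi> (\<lambda>i. S i \<omega>) = W k \<omega>)"
proof -
  obtain \<Phi> \<Psi> where \<Phi>: "adapted D J \<Phi>" "\<And>\<omega>. \<Phi> (\<lambda>i. S i \<omega>) = (X k \<omega>, Yi k T \<omega>)"
    and \<Psi>: "adapted D J \<Psi>" "\<And>\<omega>. \<Psi> (\<lambda>i. S i \<omega>) = (X k \<omega>, Zi k T \<omega>)"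
    using Yi_adapted[OF assms(1,2)] Zi_adapted[OF assms(1,3)] by metis
  have "adapted D J (\<lambda>s. (fst (\<Phi> s), snd (\<Phi> s), snd (\<Psi> s)))"
    by (intro adapted_Pair adapted_fst adapted_snd \<Phi> \<Psi>)
  then show ?thesis
    by (intro exI[of _ "\<lambda>s. (fst (\<Phi> s), snd (\<Phi> s), snd (\<Psi> s))"] conjI allI)
      (simp_all add: \<Phi> \<Psi> W_def Y_Suc Z_Suc)
qed

lemma nabla_f_measurable: "nabla f \<in> borel_measurable borel"
  and nabla_g_measurable: "nabla g \<in> borel_measurable borel"
  using lipschitz_on_continuous_on[OF f_smooth(2)] lipschitz_on_continuous_on[OF g_smooth(2)]
  by (auto intro: borel_measurable_continuous_onI)

lemma adapted_noise:
  fixes V :: "'w \<Rightarrow> 's::euclidean_space" and pt :: "'s \<Rightarrow> 'v::euclidean_space"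
  assumes \<Phi>: "adapted D J \<Phi>" "\<And>\<omega>. \<Phi> (\<lambda>i. S i \<omega>) = V \<omega>" and i: "i \<notin> J"
    and G: "unbiased_oracle (D i) G h \<sigma>" and h: "nabla h \<in> borel_measurable borel"
    and pt: "pt \<in> borel_measurable borel"
  shows "cond_noise V (\<lambda>\<omega>. G (pt (V \<omega>)) (S i \<omega>) - nabla h (pt (V \<omega>))) (\<sigma>\<^sup>2)"
proof (rule cond_noise_oracle[OF _ _ _ G h pt])
  show "V \<in> borel_measurable P"
    using adapted_random_variable[OF prob_space_axioms indep \<Phi>(1)] by (simp add: \<Phi>(2))
  show "S i \<in> measurable P (D i)" using indep by (auto simp: indep_vars_def)
  show "distr P (borel \<Otimes>\<^sub>M D i) (\<lambda>\<omega>. (V \<omega>, S i \<omega>)) = distr P borel V \<Otimes>\<^sub>M D i"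
    using adapted_joint_law[OF prob_space_axioms indep law \<Phi>(1) i] by (simp add: \<Phi>(2))
qed

lemma noise_y_cond:
  "cond_noise (\<lambda>\<omega>. (X k \<omega>, Yi k t \<omega>)) (noise_y k t) (2 * (sample_var k))"
proof -
  let ?J = "past k \<union> y_past k t"
  obtain \<Phi> where \<Phi>: "adapted D ?J \<Phi>" "\<And>\<omega>. \<Phi> (\<lambda>i. S i \<omega>) = (X k \<omega>, Yi k t \<omega>)"
    using Yi_adapted[of k ?J t] by auto
  have i: "Zeta_y k t \<notin> ?J" "Phi_y k t \<notin> ?J" by (auto simp: past_def y_past_def)
  have G: "unbiased_oracle (D (Zeta_y k t)) Gf f \<sigma>f" "unbiased_oracle (D (Phi_y k t)) Gg g \<sigma>g"
    using Gf Gg by simp_all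
  note 1 = cond_noise_snd[OF adapted_noise[OF \<Phi> i(1) G(1) nabla_f_measurable measurable_ident]]
  note 2 = cond_noise_snd[OF adapted_noise[OF \<Phi> i(2) G(2) nabla_g_measurable measurable_ident]]
  show ?thesis
    using cond_noise_add[OF 1 cond_noise_scaleR[OF 2, of "\<Lambda> k"] order_refl] by (simp add: noise_y_def[abs_def])
qed

lemma noise_z_cond:
  "cond_noise (\<lambda>\<omega>. (X k \<omega>, Zi k t \<omega>)) (noise_z k t) (\<sigma>g\<^sup>2)"
proof -
  let ?J = "past k \<union> z_past k t"
  obtain \<Phi> where \<Phi>: "adapted D ?J \<Phi>" "\<And>\<omega>. \<Phi> (\<lambda>i. S i \<omega>) = (X k \<omega>, Zi k t \<omega>)"
    using Zi_adapted[of k ?J t] by auto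
  have i: "Phi_z k t \<notin> ?J" by (auto simp: past_def z_past_def)
  have G: "unbiased_oracle (D (Phi_z k t)) Gg g \<sigma>g" using Gg by simp
  from cond_noise_snd[OF adapted_noise[OF \<Phi> i G nabla_g_measurable measurable_ident]]
  show ?thesis by (simp add: noise_z_def[abs_def])
qed

lemma noise_x_cond:
  "cond_noise (W k) (noise_x k) (8 * (sample_var k))"
proof -
  define J where "J = past k \<union> y_past k T \<union> z_past k T"
  obtain \<Phi> where \<Phi>: "adapted D J \<Phi>" "\<And>\<omega>. \<Phi> (\<lambda>i. S i \<omega>) = W k \<omega>"
    using W_adapted[of k J] by (auto simp: J_def)
  have i: "Zeta_x k \<notin> J" "Phi_xy k \<notin> J" "Phi_xz k \<notin> J"
    by (auto simp: J_def past_def y_past_def z_past_def)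
  have pt: "(\<lambda>w :: 'a \<times> 'b \<times> 'b. (fst w, fst (snd w))) \<in> borel_measurable borel"
    "(\<lambda>w :: 'a \<times> 'b \<times> 'b. (fst w, snd (snd w))) \<in> borel_measurable borel"
    by (intro borel_measurable_continuous_onI continuous_intros)+
  have G: "unbiased_oracle (D (Zeta_x k)) Gf f \<sigma>f" "unbiased_oracle (D (Phi_xy k)) Gg g \<sigma>g"
    "unbiased_oracle (D (Phi_xz k)) Gg g \<sigma>g"
    using Gf Gg by simp_all
  note 1 = cond_noise_fst[OF adapted_noise[OF \<Phi> i(1) G(1) nabla_f_measurable pt(1)]]
  note 2 = cond_noise_fst[OF adapted_noise[OF \<Phi> i(2) G(2) nabla_g_measurable pt(1)]]
  note 3 = cond_noise_fst[OF adapted_noise[OF \<Phi> i(3) G(3) nabla_g_measurable pt(2)]]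
  note 23 = cond_noise_add[OF cond_noise_scaleR[OF 2, of "\<Lambda> k"] cond_noise_scaleR[OF 3, of "- \<Lambda> k"] order_refl]
  show ?thesis
    using cond_noise_add[OF 1 23, of "8 * (sample_var k)"]
    by (simp add: noise_x_def[abs_def] W_def[abs_def])
qed


section \<open>Consequences of the step size conditions\<close>

lemma alpha_pos: "\<alpha> k > 0" and gamma_pos: "\<gamma> k > 0" and delta_nonneg: "\<delta> k \<ge> 0"
  and beta_le: "\<alpha> k * \<Lambda> k \<le> \<gamma> k"
  and gamma_le: "\<gamma> k \<le> 1 / (4 * lg1)" "\<gamma> k \<le> 1 / (4 * real T * \<mu>)"
  and alpha_le: "8 * lf1 * \<alpha> k \<le> 1" "2 * \<xi> * lF1 * \<alpha> k \<le> 1"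
  and delta_le: "\<delta> k / \<Lambda> k \<le> real T * \<mu> * (\<alpha> k * \<Lambda> k) / 16"
  using steps by (auto simp: step_conditions_def Let_def)

lemma lam_ge: "l0 \<le> \<Lambda> k"
proof (induction k)
  case (Suc k)
  then show ?case using delta_nonneg[of k] by simp
qed simp

lemma lam_pos: "\<Lambda> k > 0"
  using lam_ge[of k] l0_pos by simp

lemma lg1_pos: "lg1 > 0"
  using mu_pos mu_le_lg1 by simp

text \<open>\<open>T \<mu> \<beta>\<^sub>k\<close> measures, up to a constant factor, the contraction of the inner loops over a whole outer
  iteration; all losses are compared to it.\<close>

definition "rate k = real T * \<mu> * (\<alpha> k * \<Lambda> k)"

lemma rate_pos: "rate k > 0"
  using T_pos mu_pos alpha_pos lam_pos by (simp add: rate_def)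

lemma rate_le: "rate k \<le> 1 / 4"
proof -
  have "real T * \<mu> * (\<alpha> k * \<Lambda> k) \<le> real T * \<mu> * (1 / (4 * real T * \<mu>))"
    using T_pos mu_pos order_trans[OF beta_le gamma_le(2)] by (intro mult_left_mono) auto
  then show ?thesis using T_pos mu_pos by (simp add: rate_def)
qed

lemma lam_Suc_le: "\<Lambda> (Suc k) \<le> \<Lambda> k * (1 + rate k / 16)"
proof -
  have "\<delta> k \<le> \<Lambda> k * (rate k / 16)"
    using delta_le[of k] lam_pos[of k] by (simp add: rate_def field_simps)
  then show ?thesis by (simp add: distrib_left)
qed

section \<open>Square integrability of the iterates\<close>

lemma grad_y_sqint: "sqint P V \<Longrightarrow> sqint P (\<lambda>\<omega>. grad_y k (V \<omega>))"
  unfolding grad_y_def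
  by (intro sqint_add sqint_scaleR sqint_snd sqint_lipschitz[OF _ f_smooth(2)] sqint_lipschitz[OF _ g_smooth(2)])

lemma Yi_sqint:
  assumes "sqint P (X k)" "sqint P (Y k)"
  shows "sqint P (Yi k t)"
proof (induction t)
  case 0
  have "Yi k 0 = Y k" by (rule ext) (rule Yi_0)
  then show ?case using assms by simp
next
  case (Suc t)
  have "sqint P (\<lambda>\<omega>. Yi k t \<omega> - \<alpha> k *\<^sub>R grad_y k (X k \<omega>, Yi k t \<omega>) - \<alpha> k *\<^sub>R noise_y k t \<omega>)"
    by (intro sqint_diff sqint_scaleR grad_y_sqint sqint_Pair Suc assms cond_noise_sqint(1)[OF noise_y_cond])
  moreover have "Yi k (Suc t) = (\<lambda>\<omega>. Yi k t \<omega> - \<alpha> k *\<^sub>R grad_y k (X k \<omega>, Yi k t \<omega>) - \<alpha> k *\<^sub>R noise_y k t \<omega>)"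
    by (rule ext) (rule Yi_Suc)
  ultimately show ?case by simp
qed

lemma Zi_sqint:
  assumes "sqint P (X k)" "sqint P (Z k)"
  shows "sqint P (Zi k t)"
proof (induction t)
  case 0
  have "Zi k 0 = Z k" by (rule ext) (rule Zi_0)
  then show ?case using assms by simp
next
  case (Suc t)
  have "sqint P (\<lambda>\<omega>. Zi k t \<omega> - \<gamma> k *\<^sub>R snd (nabla g (X k \<omega>, Zi k t \<omega>)) - \<gamma> k *\<^sub>R noise_z k t \<omega>)"
    by (intro sqint_diff sqint_scaleR sqint_snd sqint_lipschitz[OF _ g_smooth(2)] sqint_Pair Suc assms
        cond_noise_sqint(1)[OF noise_z_cond])
  moreover have "Zi k (Suc t) = (\<lambda>\<omega>. Zi k t \<omega> - \<gamma> k *\<^sub>R snd (nabla g (X k \<omega>, Zi k t \<omega>)) - \<gamma> k *\<^sub>R noise_z k t \<omega>)"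
    by (rule ext) (rule Zi_Suc)
  ultimately show ?case by simp
qed

lemma grad_x_split: "grad_x k p = fst (nabla f (fst p, fst (snd p)))
    + \<Lambda> k *\<^sub>R (fst (nabla g (fst p, fst (snd p))) - fst (nabla g (fst p, snd (snd p))))"
  by (simp add: grad_x_def split_def)

lemma grad_x_sqint:
  assumes "sqint P V"
  shows "sqint P (\<lambda>\<omega>. grad_x k (V \<omega>))"
  unfolding grad_x_split
  by (intro sqint_add sqint_diff sqint_scaleR sqint_fst[where X = "\<lambda>\<omega>. nabla f (p \<omega>)" for p]
      sqint_fst[where X = "\<lambda>\<omega>. nabla g (p \<omega>)" for p]
      sqint_lipschitz[OF _ f_smooth(2)] sqint_lipschitz[OF _ g_smooth(2)]
      sqint_Pair sqint_fst[OF assms] sqint_fst[OF sqint_snd[OF assms]] sqint_snd[OF sqint_snd[OF assms]])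

lemma iter_sqint: "sqint P (X k) \<and> sqint P (Y k) \<and> sqint P (Z k)"
proof (induction k)
  case 0
  have "X 0 = (\<lambda>_. x0)" "Y 0 = (\<lambda>_. y0)" "Z 0 = (\<lambda>_. z0)"
    by (rule ext, simp add: X_0 Y_0 Z_0)+
  then show ?case by (simp add: sqint_const)
next
  case (Suc k)
  have e: "Y (Suc k) = Yi k T" "Z (Suc k) = Zi k T"
    by (rule ext, simp add: Y_Suc Z_Suc)+
  have y: "sqint P (Y (Suc k))" and z: "sqint P (Z (Suc k))"
    unfolding e using Suc by (auto intro: Yi_sqint Zi_sqint)
  have "sqint P (W k)"
    unfolding W_def[abs_def] using Suc y z by (intro sqint_Pair) auto
  then have "sqint P (\<lambda>\<omega>. X k \<omega> - (\<xi> * \<alpha> k) *\<^sub>R (grad_x k (W k \<omega>) + noise_x k \<omega>))"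
    using Suc by (intro sqint_diff sqint_scaleR sqint_add grad_x_sqint cond_noise_sqint(1)[OF noise_x_cond]) auto
  moreover have "X (Suc k) = (\<lambda>\<omega>. X k \<omega> - (\<xi> * \<alpha> k) *\<^sub>R (grad_x k (W k \<omega>) + noise_x k \<omega>))"
    by (rule ext) (rule X_Suc)
  ultimately show ?case using y z by simp
qed

lemma X_sqint: "sqint P (X k)" and Y_sqint: "sqint P (Y k)" and Z_sqint: "sqint P (Z k)"
  using iter_sqint by blast+

lemma W_sqint: "sqint P (W k)"
  unfolding W_def[abs_def] by (intro sqint_Pair X_sqint Y_sqint Z_sqint)

section \<open>The inner loops\<close>

abbreviation "ylam k \<equiv> ystar_lam f g (\<Lambda> k)"

lemma ylam_lipschitz: "ll0-lipschitz_on UNIV (ystar_lam f g (\<Lambda> k))"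
  and ystar_lipschitz: "ll0-lipschitz_on UNIV (ystar g)"
  using ystar_lam_taylor[OF lam_ge] ystar_taylor by (auto simp: taylor_map_def)

lemma Yi_step:
  "mean_sq (\<lambda>\<omega>. Yi k (Suc t) \<omega> - ylam k (X k \<omega>))
    \<le> (1 - \<alpha> k * \<Lambda> k * \<mu> / 2) * mean_sq (\<lambda>\<omega>. Yi k t \<omega> - ylam k (X k \<omega>))
      + (\<alpha> k)\<^sup>2 * (2 * sample_var k)"
proof -
  note yi = Yi_sqint[OF X_sqint Y_sqint, of k t]
  have gm: "grad_y k \<in> borel_measurable borel"
    unfolding grad_y_def
    by (intro borel_measurable_add borel_measurable_scaleR borel_measurable_const
        measurable_compose[OF nabla_f_measurable snd_borel_measurable] measurable_compose[OF nabla_g_measurable snd_borel_measurable])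
  have q: "quad_bounded (\<Lambda> k * \<mu> / 2) (lf1 + \<Lambda> k * lg1) (\<lambda>y. lagr f g (\<Lambda> k) (x, y)) (\<lambda>y. grad_y k (x, y))" for x
    using lagr_quad_bounded[OF lam_ge[of k], of x] by (simp add: grad_y_def)
  have "\<alpha> k * (\<Lambda> k * lg1) \<le> \<gamma> k * lg1"
    using beta_le[of k] lg1_pos by (simp add: mult.assoc[symmetric] mult_right_mono)
  also have "\<dots> \<le> 1 / 4" using gamma_le(1)[of k] lg1_pos by (simp add: field_simps)
  finally have 1: "\<alpha> k * (\<Lambda> k * lg1) \<le> 1 / 4" .
  have "8 * (\<alpha> k * lf1) \<le> 1" using alpha_le(1)[of k] by (simp add: mult_ac)
  then have "\<alpha> k * lf1 + \<alpha> k * (\<Lambda> k * lg1) \<le> 1" using 1 by linarith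
  then have a: "\<alpha> k * (lf1 + \<Lambda> k * lg1) \<le> 1" by (simp only: distrib_left)
  have "\<alpha> k * (\<Lambda> k * \<mu> / 2) = \<alpha> k * \<Lambda> k * \<mu> / 2" by simp
  with cond_noise_gradient_step[OF noise_y_cond X_sqint yi ylam_lipschitz gm grad_y_sqint[OF sqint_Pair[OF X_sqint yi]]
      q ystar_lam_minimal[OF lam_ge] less_imp_le[OF alpha_pos] a]
  show ?thesis unfolding Yi_Suc by metis
qed

lemma Zi_step:
  "mean_sq (\<lambda>\<omega>. Zi k (Suc t) \<omega> - ystar g (X k \<omega>))
    \<le> (1 - \<gamma> k * \<mu>) * mean_sq (\<lambda>\<omega>. Zi k t \<omega> - ystar g (X k \<omega>)) + (\<gamma> k)\<^sup>2 * \<sigma>g\<^sup>2"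
proof -
  note zi = Zi_sqint[OF X_sqint Z_sqint, of k t]
  have a: "\<gamma> k * lg1 \<le> 1" using gamma_le(1)[of k] lg1_pos by (simp add: field_simps)
  show ?thesis
    unfolding Zi_Suc
    by (rule cond_noise_gradient_step[OF noise_z_cond X_sqint zi ystar_lipschitz
          measurable_compose[OF nabla_g_measurable snd_borel_measurable]
          sqint_snd[OF sqint_lipschitz[OF sqint_Pair[OF X_sqint zi] g_smooth(2)]]
          g_quad_bounded ystar_g_minimal less_imp_le[OF gamma_pos] a])
qed

end

lemma contraction_iterate:
  fixes r :: "nat \<Rightarrow> real"
  assumes step: "\<And>t. r (Suc t) \<le> (1 - p) * r t + v" and p: "0 \<le> p" "p \<le> 1" and v: "0 \<le> v"
  shows "r t \<le> (1 - p) ^ t * r 0 + real t * v"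
proof (induction t)
  case (Suc t)
  have "r (Suc t) \<le> (1 - p) * r t + v" by (rule step)
  also have "\<dots> \<le> (1 - p) * ((1 - p) ^ t * r 0 + real t * v) + v"
    using p Suc by (intro add_right_mono mult_left_mono) auto
  also have "\<dots> \<le> (1 - p) ^ Suc t * r 0 + real (Suc t) * v"
    using mult_nonneg_nonneg[OF p(1) mult_nonneg_nonneg[of "real t" v]] v by (simp add: algebra_simps)
  finally show ?case .
qed simp

text \<open>Bernoulli's inequality for \<open>(1 + p)\<^sup>n\<close> gives \<open>(1 - p)\<^sup>n \<le> 1 / (1 + n p)\<close>.\<close>

lemma power_one_minus_le:
  fixes p :: real
  assumes p: "0 \<le> p" "real n * p \<le> 1 / 8"
  shows "(1 - p) ^ n \<le> 1 - 7 / 8 * (real n * p)"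
proof (cases "n = 0")
  case False
  let ?u = "real n * p"
  have "1 * p \<le> real n * p" using False p by (intro mult_right_mono) auto
  then have p1: "p \<le> 1" using p by simp
  have "(1 - p) ^ n * (1 + ?u) \<le> (1 - p) ^ n * (1 + p) ^ n"
    using p p1 Bernoulli_inequality[of p n] by (intro mult_left_mono) auto
  also have "\<dots> = (1 - p\<^sup>2) ^ n" by (simp add: power_mult_distrib[symmetric] power2_eq_square algebra_simps)
  also have "\<dots> \<le> 1" using p p1 by (intro power_le_one) (auto simp: power_le_one)
  finally have 1: "(1 - p) ^ n * (1 + ?u) \<le> 1" .
  have u: "0 \<le> ?u" using p by simp
  have "?u * ?u \<le> 1 / 8 * ?u" using u p by (intro mult_right_mono) auto
  moreover have "(1 - 7 / 8 * x) * (1 + x) = 1 + (1 / 8 * x - 7 / 8 * (x * x))" for x :: real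
    by (simp add: field_simps)
  note this[of ?u]
  moreover have "0 \<le> ?u * ?u" by simp
  ultimately have "1 \<le> (1 - 7 / 8 * ?u) * (1 + ?u)" by linarith
  then have "(1 - p) ^ n * (1 + ?u) \<le> (1 - 7 / 8 * ?u) * (1 + ?u)" using 1 by linarith
  then show ?thesis using u by simp
qed simp

context f2sa
begin

text \<open>Mean squared distances to the targets before the inner loops and, with suffix \<open>end\<close>, after them.
  The targets are those at \<open>x\<^sub>k\<close> and \<open>\<lambda>\<^sub>k\<close> in both cases.\<close>

definition "y_gap k = mean_sq (\<lambda>\<omega>. Y k \<omega> - ylam k (X k \<omega>))"
definition "y_gap_end k = mean_sq (\<lambda>\<omega>. Y (Suc k) \<omega> - ylam k (X k \<omega>))"
definition "z_gap k = mean_sq (\<lambda>\<omega>. Z k \<omega> - ystar g (X k \<omega>))"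
definition "z_gap_end k = mean_sq (\<lambda>\<omega>. Z (Suc k) \<omega> - ystar g (X k \<omega>))"

lemma gap_nonneg: "y_gap k \<ge> 0" "y_gap_end k \<ge> 0" "z_gap k \<ge> 0" "z_gap_end k \<ge> 0"
  by (simp_all add: y_gap_def y_gap_end_def z_gap_def z_gap_end_def)

lemma half_beta: "0 \<le> \<alpha> k * \<Lambda> k * \<mu> / 2" "real T * (\<alpha> k * \<Lambda> k * \<mu> / 2) \<le> 1 / 8"
  "real T * (\<alpha> k * \<Lambda> k * \<mu> / 2) = rate k / 2" "\<alpha> k * \<Lambda> k * \<mu> / 2 \<le> 1"
proof -
  show 1: "0 \<le> \<alpha> k * \<Lambda> k * \<mu> / 2" using alpha_pos lam_pos mu_pos by (simp add: less_imp_le)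
  show e: "real T * (\<alpha> k * \<Lambda> k * \<mu> / 2) = rate k / 2" by (simp add: rate_def)
  show 2: "real T * (\<alpha> k * \<Lambda> k * \<mu> / 2) \<le> 1 / 8"
    using rate_le[of k] unfolding e by simp
  have "1 * (\<alpha> k * \<Lambda> k * \<mu> / 2) \<le> real T * (\<alpha> k * \<Lambda> k * \<mu> / 2)"
    using T_pos 1 by (intro mult_right_mono) auto
  then show "\<alpha> k * \<Lambda> k * \<mu> / 2 \<le> 1" using 2 by linarith
qed

lemma y_gap_end_le: "y_gap_end k \<le> (1 - 7 / 16 * rate k) * y_gap k + real T * ((\<alpha> k)\<^sup>2 * (2 * sample_var k))"
proof -
  let ?p = "\<alpha> k * \<Lambda> k * \<mu> / 2"
  define r where "r t = mean_sq (\<lambda>\<omega>. Yi k t \<omega> - ylam k (X k \<omega>))" for t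
  have "r T \<le> (1 - ?p) ^ T * r 0 + real T * ((\<alpha> k)\<^sup>2 * (2 * sample_var k))"
    by (rule contraction_iterate[where r = r]) (use Yi_step half_beta in \<open>auto simp: r_def\<close>)
  moreover have "(1 - ?p) ^ T * r 0 \<le> (1 - 7 / 16 * rate k) * r 0"
    using power_one_minus_le[OF half_beta(1,2)[of k]] half_beta(3)[of k] by (intro mult_right_mono) (auto simp: r_def)
  ultimately show ?thesis by (simp add: r_def y_gap_def y_gap_end_def Yi_0 Y_Suc)
qed

text \<open>The \<open>z\<close>-loop contracts with \<open>\<gamma>\<^sub>k \<mu> \<ge> \<beta>\<^sub>k \<mu>\<close> per step.  The weaker rate \<open>\<beta>\<^sub>k \<mu> / 2\<close> of the
  \<open>y\<close>-loop is used, so that both distances can be treated alike.\<close>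

lemma z_gap_end_le: "z_gap_end k \<le> (1 - 7 / 16 * rate k) * z_gap k + real T * ((\<gamma> k)\<^sup>2 * \<sigma>g\<^sup>2)"
proof -
  let ?p = "\<alpha> k * \<Lambda> k * \<mu> / 2"
  define r where "r t = mean_sq (\<lambda>\<omega>. Zi k t \<omega> - ystar g (X k \<omega>))" for t
  have r0: "r t \<ge> 0" for t by (simp add: r_def)
  have "?p \<le> \<alpha> k * \<Lambda> k * \<mu>" using half_beta(1)[of k] by linarith
  also have "\<dots> \<le> \<gamma> k * \<mu>" using beta_le[of k] mu_pos by (intro mult_right_mono) auto
  finally have "?p \<le> \<gamma> k * \<mu>" .
  then have m: "(1 - \<gamma> k * \<mu>) * r t \<le> (1 - ?p) * r t" for t using r0 by (intro mult_right_mono) auto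
  have step: "r (Suc t) \<le> (1 - ?p) * r t + (\<gamma> k)\<^sup>2 * \<sigma>g\<^sup>2" for t
    using Zi_step[of k t, folded r_def] m[of t] by linarith
  have "r T \<le> (1 - ?p) ^ T * r 0 + real T * ((\<gamma> k)\<^sup>2 * \<sigma>g\<^sup>2)"
    by (rule contraction_iterate[where r = r, OF step half_beta(1,4)]) simp
  moreover have "(1 - ?p) ^ T * r 0 \<le> (1 - 7 / 16 * rate k) * r 0"
    using power_one_minus_le[OF half_beta(1,2)[of k]] half_beta(3)[of k] r0 by (intro mult_right_mono) auto
  ultimately show ?thesis by (simp add: r_def z_gap_def z_gap_end_def Zi_0 Z_Suc)
qed


section \<open>One outer iteration\<close>

abbreviation "F \<equiv> hyper_obj f g"

definition "x_step k = \<xi> * \<alpha> k"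
definition "noise_var k = 8 * sample_var k"
definition "mean_F k = (\<integral>\<omega>. F (X k \<omega>) \<partial>P)"
definition "mean_dir_sq k = mean_sq (\<lambda>\<omega>. grad_x k (W k \<omega>))"
definition "mean_grad_sq k = mean_sq (\<lambda>\<omega>. nabla F (X k \<omega>))"
definition "mean_bias_sq k = mean_sq (\<lambda>\<omega>. grad_x k (W k \<omega>) - nabla F (X k \<omega>))"
definition "track_noise k = 16 / rate k * (ll1 * (x_step k)\<^sup>2 * noise_var k)\<^sup>2 + ll0\<^sup>2 * (x_step k)\<^sup>2 * noise_var k"

lemma x_step_pos: "x_step k > 0"
  using xi_pos alpha_pos by (simp add: x_step_def)

lemma F_smooth: "F differentiable_on UNIV" "lF1-lipschitz_on UNIV (nabla F)"
  using hyper_obj_differentiable derived by (auto simp: derived_constants_def)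

lemma grad_x_measurable: "grad_x k \<in> borel_measurable borel"
proof -
  have c: "continuous_on UNIV (\<lambda>p. nabla f (fst p, fst (snd p)))" "continuous_on UNIV (\<lambda>p. nabla g (fst p, fst (snd p)))"
     "continuous_on UNIV (\<lambda>p. nabla g (fst p, snd (snd p)))"
    by (intro continuous_on_compose2[OF lipschitz_on_continuous_on[OF f_smooth(2)]]
        continuous_on_compose2[OF lipschitz_on_continuous_on[OF g_smooth(2)]] continuous_intros; simp)+
  have "grad_x k = (\<lambda>p. fst (nabla f (fst p, fst (snd p)))
    + \<Lambda> k *\<^sub>R (fst (nabla g (fst p, fst (snd p))) - fst (nabla g (fst p, snd (snd p)))))"
    by (rule ext) (rule grad_x_split)
  then show ?thesis
    by (simp only:) (intro borel_measurable_continuous_onI continuous_intros c)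
qed

lemma X_Suc_W: "X (Suc k) \<omega> = X k \<omega> - x_step k *\<^sub>R (grad_x k (W k \<omega>) + noise_x k \<omega>)"
  by (simp add: X_Suc x_step_def W_def)

lemma W_simps: "fst (W k \<omega>) = X k \<omega>" "fst (snd (W k \<omega>)) = Y (Suc k) \<omega>" "snd (snd (W k \<omega>)) = Z (Suc k) \<omega>"
  by (simp_all add: W_def)

lemma noise_x_V: "cond_noise (W k) (noise_x k) (noise_var k)"
  unfolding noise_var_def by (rule noise_x_cond)

lemma Y_tracking:
  "mean_sq (\<lambda>\<omega>. Y (Suc k) \<omega> - ylam k (X (Suc k) \<omega>))
     \<le> (1 + rate k / 8) * y_gap_end k + (16 / rate k + 1) * ll0\<^sup>2 * (x_step k)\<^sup>2 * mean_dir_sq k + track_noise k"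
proof -
  have v: "(\<lambda>p. fst (snd p)) \<in> borel_measurable (borel :: ('a \<times> 'b \<times> 'b) measure)"
    by (intro borel_measurable_continuous_onI continuous_intros)
  show ?thesis
    using cond_noise_tracking[OF ystar_lam_taylor[OF lam_ge[of k]] noise_x_V[of k] sqint_measurable[OF W_sqint[of k]]
        fst_borel_measurable sqint_fst[OF W_sqint[of k]] grad_x_measurable[of k] grad_x_sqint[OF W_sqint[of k]]
        v sqint_fst[OF sqint_snd[OF W_sqint[of k]]] less_imp_le[OF x_step_pos[of k]] rate_pos[of k]]
    unfolding X_Suc_W[symmetric] W_simps y_gap_end_def mean_dir_sq_def track_noise_def .
qed

lemma Z_tracking:
  "z_gap (Suc k) \<le> (1 + rate k / 8) * z_gap_end k + (16 / rate k + 1) * ll0\<^sup>2 * (x_step k)\<^sup>2 * mean_dir_sq k + track_noise k"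
proof -
  have v: "(\<lambda>p. snd (snd p)) \<in> borel_measurable (borel :: ('a \<times> 'b \<times> 'b) measure)"
    by (intro borel_measurable_continuous_onI continuous_intros)
  show ?thesis
    using cond_noise_tracking[OF ystar_taylor noise_x_V[of k] sqint_measurable[OF W_sqint[of k]]
        fst_borel_measurable sqint_fst[OF W_sqint[of k]] grad_x_measurable[of k] grad_x_sqint[OF W_sqint[of k]]
        v sqint_snd[OF sqint_snd[OF W_sqint[of k]]] less_imp_le[OF x_step_pos[of k]] rate_pos[of k]]
    unfolding X_Suc_W[symmetric] W_simps z_gap_end_def z_gap_def mean_dir_sq_def track_noise_def .
qed

definition "drift k = 2 * lf0 * \<delta> k / (\<mu> * \<Lambda> k * \<Lambda> (Suc k))"

text \<open>The target of \<open>y\<close> also moves with the multiplier; Young's inequality separates this from the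
  motion with \<open>x\<close>.\<close>

lemma y_gap_Suc_le:
  "y_gap (Suc k) \<le> (1 + rate k / 16) * mean_sq (\<lambda>\<omega>. Y (Suc k) \<omega> - ylam k (X (Suc k) \<omega>))
     + (1 + 16 / rate k) * (drift k)\<^sup>2"
proof -
  have s: "rate k > 0" by (rule rate_pos)
  have si: "sqint P (\<lambda>\<omega>. Y (Suc k) \<omega> - ylam k (X (Suc k) \<omega>))" for k
    by (intro sqint_diff Y_sqint sqint_lipschitz[OF X_sqint ylam_lipschitz])
  have si': "sqint P (\<lambda>\<omega>. Y (Suc k) \<omega> - ylam (Suc k) (X (Suc k) \<omega>))"
    by (intro sqint_diff Y_sqint sqint_lipschitz[OF X_sqint ylam_lipschitz])
  have "y_gap (Suc k) \<le> (\<integral>\<omega>. (1 + rate k / 16) * (norm (Y (Suc k) \<omega> - ylam k (X (Suc k) \<omega>)))\<^sup>2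
      + (1 + 16 / rate k) * (drift k)\<^sup>2 \<partial>P)"
    unfolding y_gap_def
  proof (rule integral_mono[OF sqint_integrable[OF si']])
    show "integrable P (\<lambda>\<omega>. (1 + rate k / 16) * (norm (Y (Suc k) \<omega> - ylam k (X (Suc k) \<omega>)))\<^sup>2
      + (1 + 16 / rate k) * (drift k)\<^sup>2)"
      using sqint_integrable[OF si[of k]] by simp
    fix \<omega>
    let ?x = "X (Suc k) \<omega>"
    let ?a = "Y (Suc k) \<omega> - ylam k ?x" and ?b = "ylam (Suc k) ?x - ylam k ?x"
    have "norm ?b \<le> drift k"
      using ystar_lam_change[OF lam_ge[of k], of "\<Lambda> (Suc k)" ?x] delta_nonneg[of k]
      by (simp add: drift_def)
    then have b: "(norm ?b)\<^sup>2 \<le> (drift k)\<^sup>2" by (rule power_mono) simp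
    have e: "Y (Suc k) \<omega> - ylam (Suc k) ?x = ?a - 1 *\<^sub>R ?b" by simp
    have "(norm (Y (Suc k) \<omega> - ylam (Suc k) ?x))\<^sup>2 = (norm ?a)\<^sup>2 - 2 * (?a \<bullet> ?b) + (norm ?b)\<^sup>2"
      by (simp only: e norm_diff_scaleR_sq) simp
    moreover have "- (?a \<bullet> ?b) \<le> norm ?a * norm ?b"
      using Cauchy_Schwarz_ineq2[of ?a ?b] by linarith
    moreover have "2 * norm ?a * norm ?b \<le> rate k / 16 * (norm ?a)\<^sup>2 + 16 / rate k * (norm ?b)\<^sup>2"
      by (rule weighted_young[OF s])
    ultimately have "(norm (Y (Suc k) \<omega> - ylam (Suc k) ?x))\<^sup>2
        \<le> (norm ?a)\<^sup>2 + (rate k / 16 * (norm ?a)\<^sup>2 + 16 / rate k * (norm ?b)\<^sup>2) + (norm ?b)\<^sup>2"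
      by linarith
    also have "\<dots> = (1 + rate k / 16) * (norm ?a)\<^sup>2 + (1 + 16 / rate k) * (norm ?b)\<^sup>2"
      by (simp add: algebra_simps)
    also have "\<dots> \<le> (1 + rate k / 16) * (norm ?a)\<^sup>2 + (1 + 16 / rate k) * (drift k)\<^sup>2"
      using b s by (intro add_left_mono mult_left_mono) auto
    finally show "(norm (Y (Suc k) \<omega> - ylam (Suc k) ?x))\<^sup>2
        \<le> (1 + rate k / 16) * (norm ?a)\<^sup>2 + (1 + 16 / rate k) * (drift k)\<^sup>2" .
  qed
  also have "\<dots> = (1 + rate k / 16) * mean_sq (\<lambda>\<omega>. Y (Suc k) \<omega> - ylam k (X (Suc k) \<omega>))
     + (1 + 16 / rate k) * (drift k)\<^sup>2"
    using sqint_integrable[OF si[of k]] by (simp add: prob_space)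
  finally show ?thesis .
qed

text \<open>The direction minus \<open>\<nabla>F\<close> consists of the bias of the penalised gradient and of the errors caused by
  \<open>y\<close> and by \<open>z\<close>.  As \<open>lf1 \<le> \<lambda> lg1 / 2\<close>, the gradient in \<open>x\<close> of \<open>f + \<lambda> g\<close> has Lipschitz constant
  \<open>3/2 \<lambda> lg1\<close>, whence the factor \<open>9/4\<close>.\<close>

lemma gradient_error:
  "mean_bias_sq k \<le> 3 * (bias_const\<^sup>2 / (\<Lambda> k)\<^sup>2 + (\<Lambda> k)\<^sup>2 * lg1\<^sup>2 * (9 / 4 * y_gap_end k + z_gap_end k))"
proof -
  let ?l = "\<Lambda> k"
  have l: "?l > 0" by (rule lam_pos)
  have sa: "sqint P (\<lambda>\<omega>. Y (Suc k) \<omega> - ylam k (X k \<omega>))"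
    by (intro sqint_diff Y_sqint sqint_lipschitz[OF X_sqint ylam_lipschitz])
  have sb: "sqint P (\<lambda>\<omega>. Z (Suc k) \<omega> - ystar g (X k \<omega>))"
    by (intro sqint_diff Z_sqint sqint_lipschitz[OF X_sqint ystar_lipschitz])
  have se: "sqint P (\<lambda>\<omega>. grad_x k (W k \<omega>) - nabla F (X k \<omega>))"
    by (intro sqint_diff grad_x_sqint W_sqint sqint_lipschitz[OF X_sqint F_smooth(2)])
  have "mean_bias_sq k \<le> (\<integral>\<omega>. 3 * (bias_const\<^sup>2 / ?l\<^sup>2) + 3 * (?l\<^sup>2 * lg1\<^sup>2) * (9 / 4 * (norm (Y (Suc k) \<omega> - ylam k (X k \<omega>)))\<^sup>2)
      + 3 * (?l\<^sup>2 * lg1\<^sup>2) * (norm (Z (Suc k) \<omega> - ystar g (X k \<omega>)))\<^sup>2 \<partial>P)"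
    unfolding mean_bias_sq_def
  proof (rule integral_mono[OF sqint_integrable[OF se]])
    show "integrable P (\<lambda>\<omega>. 3 * (bias_const\<^sup>2 / ?l\<^sup>2) + 3 * (?l\<^sup>2 * lg1\<^sup>2) * (9 / 4 * (norm (Y (Suc k) \<omega> - ylam k (X k \<omega>)))\<^sup>2)
      + 3 * (?l\<^sup>2 * lg1\<^sup>2) * (norm (Z (Suc k) \<omega> - ystar g (X k \<omega>)))\<^sup>2)"
      using sqint_integrable[OF sa] sqint_integrable[OF sb] by simp
    fix \<omega>
    let ?x = "X k \<omega>" and ?y = "Y (Suc k) \<omega>" and ?z = "Z (Suc k) \<omega>"
    let ?yl = "ylam k ?x" and ?ys = "ystar g ?x"
    define e0 where "e0 = penalised_grad ?l ?x - nabla F ?x"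
    define e1 where "e1 = fst (nabla f (?x, ?y) - nabla f (?x, ?yl)) + ?l *\<^sub>R fst (nabla g (?x, ?y) - nabla g (?x, ?yl))"
    define e2 where "e2 = - (?l *\<^sub>R fst (nabla g (?x, ?z) - nabla g (?x, ?ys)))"
    have eq: "grad_x k (W k \<omega>) - nabla F ?x = e0 + (e1 + e2)"
      by (simp add: e0_def e1_def e2_def penalised_grad_def grad_x_split W_simps algebra_simps)
    have n0: "(norm e0)\<^sup>2 \<le> bias_const\<^sup>2 / ?l\<^sup>2"
      using power_mono[OF penalised_grad_bias[OF lam_ge[of k], of ?x] norm_ge_zero, of 2]
      by (simp add: e0_def power_divide)
    have df: "norm (fst (nabla f (?x, ?y) - nabla f (?x, ?yl))) \<le> lf1 * norm (?y - ?yl)"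
    proof -
      have "norm (fst (nabla f (?x, ?y) - nabla f (?x, ?yl))) \<le> norm (nabla f (?x, ?y) - nabla f (?x, ?yl))"
        by (metis norm_fst_le prod.collapse)
      also have "\<dots> \<le> lf1 * norm (?y - ?yl)"
        using lipschitz_onD[OF f_smooth(2), of "(?x, ?y)" "(?x, ?yl)"] by (simp add: dist_norm norm_prod_def)
      finally show ?thesis .
    qed
    have dg: "norm (fst (nabla g (?x, a) - nabla g (?x, b))) \<le> lg1 * norm (a - b)" for a b
    proof -
      have "norm (fst (nabla g (?x, a) - nabla g (?x, b))) \<le> norm (nabla g (?x, a) - nabla g (?x, b))"
        by (metis norm_fst_le prod.collapse)
      also have "\<dots> \<le> lg1 * norm (a - b)"
        using lipschitz_onD[OF g_smooth(2), of "(?x, a)" "(?x, b)"] by (simp add: dist_norm norm_prod_def)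
      finally show ?thesis .
    qed
    have "lf1 \<le> ?l * \<mu> / 2" by (rule lf1_le[OF lam_ge])
    also have "\<dots> \<le> ?l * lg1 / 2" using l mu_le_lg1 by simp
    finally have lf: "lf1 \<le> ?l * lg1 / 2" .
    have "norm e1 \<le> norm (fst (nabla f (?x, ?y) - nabla f (?x, ?yl))) + norm (?l *\<^sub>R fst (nabla g (?x, ?y) - nabla g (?x, ?yl)))"
      unfolding e1_def by (rule norm_triangle_ineq)
    also have "\<dots> \<le> lf1 * norm (?y - ?yl) + ?l * (lg1 * norm (?y - ?yl))"
      using df mult_left_mono[OF dg[of ?y ?yl], of ?l] l by (intro add_mono) auto
    also have "\<dots> \<le> (?l * lg1 / 2) * norm (?y - ?yl) + ?l * (lg1 * norm (?y - ?yl))"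
      using lf by (intro add_right_mono mult_right_mono) auto
    finally have "norm e1 \<le> 3 / 2 * (?l * lg1 * norm (?y - ?yl))" by (simp add: mult_ac)
    then have n1: "(norm e1)\<^sup>2 \<le> (3 / 2 * (?l * lg1 * norm (?y - ?yl)))\<^sup>2" by (rule power_mono) simp
    have "norm e2 \<le> ?l * lg1 * norm (?z - ?ys)"
      using mult_left_mono[OF dg[of ?z ?ys], of ?l] l by (simp add: e2_def mult.assoc)
    then have n2: "(norm e2)\<^sup>2 \<le> (?l * lg1 * norm (?z - ?ys))\<^sup>2" by (rule power_mono) simp
    have "(norm (e0 + (e1 + e2)))\<^sup>2 \<le> 3 * (norm e0)\<^sup>2 + 3 * (norm e1)\<^sup>2 + 3 * (norm e2)\<^sup>2"
    proof -
      have "norm (e0 + (e1 + e2)) \<le> norm e0 + (norm e1 + norm e2)"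
        using norm_triangle_ineq[of e0 "e1 + e2"] norm_triangle_ineq[of e1 e2] by linarith
      then have "(norm (e0 + (e1 + e2)))\<^sup>2 \<le> (norm e0 + (norm e1 + norm e2))\<^sup>2"
        by (rule power_mono) simp
      also have "\<dots> \<le> 3 * (norm e0)\<^sup>2 + 3 * (norm e1)\<^sup>2 + 3 * (norm e2)\<^sup>2"
        using sum_squares_bound[of "norm e0" "norm e1"] sum_squares_bound[of "norm e0" "norm e2"]
          sum_squares_bound[of "norm e1" "norm e2"]
        by (simp add: power2_sum distrib_left)
      finally show ?thesis .
    qed
    also have "\<dots> \<le> 3 * (bias_const\<^sup>2 / ?l\<^sup>2) + 3 * (3 / 2 * (?l * lg1 * norm (?y - ?yl)))\<^sup>2 + 3 * (?l * lg1 * norm (?z - ?ys))\<^sup>2"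
      using n0 n1 n2 by linarith
    also have "\<dots> = 3 * (bias_const\<^sup>2 / ?l\<^sup>2) + 3 * (?l\<^sup>2 * lg1\<^sup>2) * (9 / 4 * (norm (?y - ?yl))\<^sup>2)
        + 3 * (?l\<^sup>2 * lg1\<^sup>2) * (norm (?z - ?ys))\<^sup>2"
      by (simp add: power_mult_distrib power2_eq_square)
    finally show "(norm (grad_x k (W k \<omega>) - nabla F ?x))\<^sup>2
      \<le> 3 * (bias_const\<^sup>2 / ?l\<^sup>2) + 3 * (?l\<^sup>2 * lg1\<^sup>2) * (9 / 4 * (norm (?y - ?yl))\<^sup>2)
        + 3 * (?l\<^sup>2 * lg1\<^sup>2) * (norm (?z - ?ys))\<^sup>2" unfolding eq .
  qed
  also have "\<dots> = 3 * (bias_const\<^sup>2 / ?l\<^sup>2) + 3 * (?l\<^sup>2 * lg1\<^sup>2) * (9 / 4 * y_gap_end k) + 3 * (?l\<^sup>2 * lg1\<^sup>2) * z_gap_end k"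
    unfolding y_gap_end_def z_gap_end_def using sqint_integrable[OF sa] sqint_integrable[OF sb] by (simp add: prob_space)
  finally show ?thesis by (simp add: algebra_simps)
qed

lemma mean_F_Suc_le:
  "mean_F (Suc k) \<le> mean_F k - x_step k / 2 * mean_grad_sq k - x_step k / 4 * mean_dir_sq k + x_step k / 2 * mean_bias_sq k + lF1 / 2 * (x_step k)\<^sup>2 * noise_var k"
proof -
  have Fi: "integrable P (\<lambda>\<omega>. F (X k \<omega>))" for k
    by (rule smooth_function_integrable[OF F_smooth X_sqint])
  have hl: "2 * lF1 * x_step k \<le> 1"
    using alpha_le(2)[of k] by (simp add: x_step_def mult_ac)
  note d = cond_noise_descent[OF F_smooth noise_x_V[of k] fst_borel_measurable sqint_fst[OF W_sqint[of k]]
        grad_x_measurable[of k] grad_x_sqint[OF W_sqint[of k]] less_imp_le[OF x_step_pos[of k]] hl]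
  show ?thesis
    using d[unfolded W_simps X_Suc_W[symmetric], OF Fi[of k] Fi[of "Suc k"]]
    unfolding mean_F_def mean_dir_sq_def mean_grad_sq_def mean_bias_sq_def .
qed

end


section \<open>Descent of the potential\<close>

text \<open>One outer iteration multiplies a squared distance by \<open>1 + s/16\<close> for the growth of the multiplier,
  by \<open>1 + s/16\<close> for the motion of the target with the multiplier and by \<open>1 + s/8\<close> for its motion with
  \<open>x\<close>.  The total loss \<open>9/32 s\<close> stays below the gain \<open>7/16 s\<close> of the inner loops.\<close>

lemma growth_factor_bounds:
  fixes s :: real
  assumes s: "0 \<le> s" "s \<le> 1 / 4"
  shows "(1 + s / 16)\<^sup>2 \<le> 9 / 8" "(1 + s / 16)\<^sup>2 * (1 + s / 8) \<le> 1 + 9 / 32 * s"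
proof -
  have s2: "s * s \<le> 1 / 4 * s" and "s * (s * s) \<le> 1 / 4 * (s * s)"
    using s by (intro mult_right_mono; simp)+
  then have s3: "s * (s * s) \<le> 1 / 16 * s" by linarith
  have "(1 + s / 16)\<^sup>2 = 1 + s / 8 + 1 / 256 * (s * s)"
    by (simp add: power2_eq_square field_simps)
  then show "(1 + s / 16)\<^sup>2 \<le> 9 / 8" using s s2 by linarith
  have "(1 + s / 16)\<^sup>2 * (1 + s / 8) = 1 + s / 4 + 5 / 256 * (s * s) + 1 / 2048 * (s * (s * s))"
    by (simp add: power2_eq_square field_simps)
  then show "(1 + s / 16)\<^sup>2 * (1 + s / 8) \<le> 1 + 9 / 32 * s" using s s2 s3 by linarith
qed

context f2sa
begin

text \<open>The margin \<open>7/16 s - 9/32 s = 5/32 s\<close>, weighted by this factor and \<open>\<lambda>\<^sub>k\<close>, has to exceed the error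
  \<open>27/8 \<xi> \<beta>\<^sub>k \<lambda>\<^sub>k lg1\<^sup>2\<close> of the direction: \<open>24 \<cdot> 5/32 = 30/8\<close>.\<close>

definition "weight = 24 * \<xi> * lg1\<^sup>2 / (real T * \<mu>)"

definition "noise_const = 4 * lF1 * \<xi>\<^sup>2 / l0 + 27 / 8 * weight * real T
   + 9 / 4 * weight * (256 * ll1\<^sup>2 * \<xi> ^ 4 * ((\<sigma>f\<^sup>2 / l0\<^sup>2 + \<sigma>g\<^sup>2) / (real T * \<mu>)\<^sup>2) + 8 * ll0\<^sup>2 * \<xi>\<^sup>2)"

definition "drift_const = 17 / 4 * weight * lf0\<^sup>2 / \<mu>\<^sup>2"

definition "noise k = \<sigma>f\<^sup>2 * ((\<alpha> k)\<^sup>2 * \<Lambda> k) + \<sigma>g\<^sup>2 * ((\<gamma> k)\<^sup>2 * \<Lambda> k)"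

definition "potential k = mean_F k + weight * \<Lambda> k * (y_gap k + z_gap k) + drift_const / \<Lambda> k"

lemma Tmu_pos: "real T * \<mu> > 0"
  using T_pos mu_pos by simp

lemma weight_pos: "weight > 0"
  using xi_pos lg1_pos Tmu_pos by (simp add: weight_def)

text \<open>One factor \<open>\<delta>\<^sub>k / \<lambda>\<^sub>k\<close> of the squared motion cancels \<open>1 / s\<close>, by the bound on the increments.  The
  other one makes the sum telescope.\<close>

lemma drift_bound:
  "weight * \<Lambda> (Suc k) * ((1 + 16 / rate k) * (drift k)\<^sup>2) \<le> drift_const / \<Lambda> k - drift_const / \<Lambda> (Suc k)"
proof -
  let ?l = "\<Lambda> k" and ?l' = "\<Lambda> (Suc k)" and ?s = "rate k" and ?d = "\<delta> k"
  have l: "?l > 0" "?l' > 0" by (rule lam_pos)+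
  have s: "?s > 0" "?s \<le> 1 / 4" and d: "?d \<ge> 0"
    by (rule rate_pos rate_le delta_nonneg)+
  have dl: "?d \<le> ?s / 16 * ?l" using delta_le[of k] l by (simp add: rate_def field_simps)
  have s17: "1 + 16 / ?s \<le> 17 / ?s" using s by (simp add: field_simps)
  have dr: "(drift k)\<^sup>2 = 4 * lf0\<^sup>2 * ?d\<^sup>2 / (\<mu>\<^sup>2 * ?l\<^sup>2 * ?l'\<^sup>2)"
    by (simp only: drift_def power_divide power_mult_distrib) simp
  have "weight * ?l' * ((1 + 16 / ?s) * (drift k)\<^sup>2) \<le> weight * ?l' * ((17 / ?s) * (drift k)\<^sup>2)"
    using s17 weight_pos l by (intro mult_left_mono mult_right_mono) auto
  also have "\<dots> = (68 * weight * lf0\<^sup>2 / (\<mu>\<^sup>2 * ?s * ?l\<^sup>2 * ?l')) * (?d * ?d)"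
  proof -
    have "weight * r * ((17 / ?s) * (4 * lf0\<^sup>2 * ?d\<^sup>2 / (\<mu>\<^sup>2 * ?l\<^sup>2 * r\<^sup>2)))
        = (68 * weight * lf0\<^sup>2 / (\<mu>\<^sup>2 * ?s * ?l\<^sup>2 * r)) * (?d * ?d)" if "r > 0" for r
      using that by (simp add: power2_eq_square mult_ac)
    then show ?thesis unfolding dr using l(2) .
  qed
  also have "\<dots> \<le> (68 * weight * lf0\<^sup>2 / (\<mu>\<^sup>2 * ?s * ?l\<^sup>2 * ?l')) * (?d * (?s / 16 * ?l))"
    using dl d l s weight_pos by (intro mult_left_mono) auto
  also have "\<dots> = drift_const * (?d / (?l * ?l'))"
  proof -
    have "(68 * weight * lf0\<^sup>2 / (\<mu>\<^sup>2 * ?s * ?l\<^sup>2 * r)) * (?d * (?s / 16 * ?l)) = drift_const * (?d / (?l * r))"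
      if "r > 0" for r
      using l(1) s mu_pos that by (simp add: drift_const_def field_simps power2_eq_square)
    then show ?thesis using l(2) .
  qed
  also have "?d / (?l * ?l') = 1 / ?l - 1 / ?l'"
  proof -
    have "1 / ?l - 1 / ?l' = (?l' - ?l) / (?l * ?l')"
      using l by (simp only: diff_frac_eq) simp
    then show ?thesis by simp
  qed
  finally show ?thesis by (simp add: right_diff_distrib)
qed

text \<open>The variances of the \<open>x\<close>-step carry \<open>\<beta>\<^sub>k\<^sup>2 \<sigma>g\<^sup>2\<close>, which is at most \<open>\<gamma>\<^sub>k\<^sup>2 \<sigma>g\<^sup>2\<close>.  Powers of \<open>\<lambda>\<^sub>k\<close> that are too
  low are raised at the cost of \<open>1 / l0\<close>.  The term of fourth order in the noise has an additional
  factor \<open>\<beta>\<^sub>k / (T \<mu>)\<close>, which is bounded.\<close>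

lemma noise_terms:
  "lF1 / 2 * (x_step k)\<^sup>2 * noise_var k
     + 9 / 8 * (weight * \<Lambda> k * (real T * ((\<alpha> k)\<^sup>2 * (2 * sample_var k)) + real T * ((\<gamma> k)\<^sup>2 * \<sigma>g\<^sup>2)))
     + 9 / 4 * (weight * \<Lambda> k * track_noise k) \<le> noise_const * noise k"
proof -
  let ?l = "\<Lambda> k" and ?s = "rate k" and ?a = "\<alpha> k" and ?b = "\<alpha> k * \<Lambda> k" and ?n = "noise k"
  define v where "v = ?a\<^sup>2 * (\<sigma>f\<^sup>2 + ?l\<^sup>2 * \<sigma>g\<^sup>2)"
  have l: "?l > 0" and l0l: "l0 \<le> ?l" and a: "?a > 0" and s: "?s > 0"
    using lam_pos lam_ge alpha_pos rate_pos by auto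
  have lF1: "lF1 \<ge> 0" using F_smooth(2) by (rule lipschitz_on_nonneg)
  have b: "?b > 0" "?b \<le> \<gamma> k" using a l beta_le by auto
  have v0: "v \<ge> 0" by (simp add: v_def)
  have V: "?a\<^sup>2 * noise_var k = 8 * v" by (simp add: noise_var_def v_def)
  have "?b\<^sup>2 \<le> (\<gamma> k)\<^sup>2" using b by (intro power_mono) auto
  then have bg: "\<sigma>g\<^sup>2 * (?b\<^sup>2 * ?l) \<le> \<sigma>g\<^sup>2 * ((\<gamma> k)\<^sup>2 * ?l)"
    using l by (intro mult_left_mono mult_right_mono) auto
  have "?l * v = \<sigma>f\<^sup>2 * (?a\<^sup>2 * ?l) + \<sigma>g\<^sup>2 * (?b\<^sup>2 * ?l)"
    by (simp add: v_def algebra_simps power_mult_distrib)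
  with bg have lv: "?l * v \<le> ?n" unfolding noise_def by linarith
  have "0 \<le> ?l * v" using l v0 by simp
  with lv have n0: "?n \<ge> 0" by linarith
  have "l0 * v \<le> ?l * v" using l0l v0 by (rule mult_right_mono)
  with lv have l0v: "l0 * v \<le> ?n" by linarith
  have 1: "lF1 / 2 * (x_step k)\<^sup>2 * noise_var k \<le> 4 * lF1 * \<xi>\<^sup>2 / l0 * ?n"
  proof -
    have "lF1 / 2 * (x_step k)\<^sup>2 * noise_var k = lF1 / 2 * \<xi>\<^sup>2 * (?a\<^sup>2 * noise_var k)"
      by (simp add: x_step_def power_mult_distrib)
    also have "\<dots> = 4 * lF1 * \<xi>\<^sup>2 / l0 * (l0 * v)" unfolding V using l0_pos by simp
    also have "\<dots> \<le> 4 * lF1 * \<xi>\<^sup>2 / l0 * ?n"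
      using l0v lF1 l0_pos by (intro mult_left_mono) auto
    finally show ?thesis .
  qed
  have 2: "?l * (real T * (?a\<^sup>2 * (2 * (\<sigma>f\<^sup>2 + ?l\<^sup>2 * \<sigma>g\<^sup>2))) + real T * ((\<gamma> k)\<^sup>2 * \<sigma>g\<^sup>2)) \<le> 3 * real T * ?n"
  proof -
    have g: "\<sigma>g\<^sup>2 * ((\<gamma> k)\<^sup>2 * ?l) \<le> ?n" using l by (simp add: noise_def)
    have "?l * (real T * (?a\<^sup>2 * (2 * (\<sigma>f\<^sup>2 + ?l\<^sup>2 * \<sigma>g\<^sup>2))) + real T * ((\<gamma> k)\<^sup>2 * \<sigma>g\<^sup>2))
        = real T * (2 * (?l * v) + \<sigma>g\<^sup>2 * ((\<gamma> k)\<^sup>2 * ?l))"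
      by (simp add: v_def algebra_simps)
    also have "\<dots> \<le> real T * (3 * ?n)"
      using lv g by (intro mult_left_mono) auto
    finally show ?thesis by simp
  qed
  define K where "K = (\<sigma>f\<^sup>2 / l0\<^sup>2 + \<sigma>g\<^sup>2) / (real T * \<mu>)\<^sup>2"
  have vs: "v / ?s \<le> K / 4"
  proof -
    have "v / ?s = ?b * (\<sigma>f\<^sup>2 / ?l\<^sup>2 + \<sigma>g\<^sup>2) / (real T * \<mu>)"
    proof -
      have "v = ?b * (?b * (\<sigma>f\<^sup>2 / ?l\<^sup>2 + \<sigma>g\<^sup>2))"
        using l by (simp add: v_def field_simps power2_eq_square)
      then have "v / ?s = ?b * (?b * (\<sigma>f\<^sup>2 / ?l\<^sup>2 + \<sigma>g\<^sup>2)) / (?b * (real T * \<mu>))"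
        by (simp only: rate_def mult.commute)
      then show ?thesis using b by simp
    qed
    also have "\<dots> \<le> (1 / (4 * real T * \<mu>)) * (\<sigma>f\<^sup>2 / l0\<^sup>2 + \<sigma>g\<^sup>2) / (real T * \<mu>)"
    proof (intro divide_right_mono mult_mono add_right_mono divide_left_mono power_mono)
      show "?b \<le> 1 / (4 * real T * \<mu>)" using b gamma_le(2)[of k] by simp
    qed (use l0l l0_pos l Tmu_pos mu_pos in auto)
    also have "\<dots> = K / 4" using Tmu_pos by (simp add: K_def power2_eq_square)
    finally show ?thesis .
  qed
  have 3: "?l * track_noise k \<le> (256 * ll1\<^sup>2 * \<xi> ^ 4 * K + 8 * ll0\<^sup>2 * \<xi>\<^sup>2) * ?n"
  proof -
    have hv: "(x_step k)\<^sup>2 * noise_var k = 8 * \<xi>\<^sup>2 * v"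
      using V by (simp add: x_step_def power_mult_distrib mult.assoc)
    have "?l * track_noise k = ?l * (16 / ?s * (ll1 * ((x_step k)\<^sup>2 * noise_var k))\<^sup>2 + ll0\<^sup>2 * ((x_step k)\<^sup>2 * noise_var k))"
      by (simp add: track_noise_def mult.assoc)
    also have "\<dots> = 1024 * ll1\<^sup>2 * \<xi> ^ 4 * ((v / ?s) * (?l * v)) + 8 * ll0\<^sup>2 * \<xi>\<^sup>2 * (?l * v)"
      unfolding hv by (simp add: power2_eq_square power4_eq_xxxx algebra_simps)
    also have "\<dots> \<le> 1024 * ll1\<^sup>2 * \<xi> ^ 4 * (K / 4 * ?n) + 8 * ll0\<^sup>2 * \<xi>\<^sup>2 * ?n"
    proof (intro add_mono mult_left_mono mult_mono)
      show "v / ?s \<le> K / 4" by (rule vs)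
      show "?l * v \<le> ?n" "?l * v \<le> ?n" by (rule lv)+
      show "0 \<le> K / 4" by (simp add: K_def)
    qed (use l v0 s in auto)
    also have "\<dots> = (256 * ll1\<^sup>2 * \<xi> ^ 4 * K + 8 * ll0\<^sup>2 * \<xi>\<^sup>2) * ?n" by (simp add: algebra_simps)
    finally show ?thesis .
  qed
  have c: "weight \<ge> 0" using weight_pos by simp
  have "noise_const * ?n = 4 * lF1 * \<xi>\<^sup>2 / l0 * ?n + 9 / 8 * (weight * (3 * real T * ?n))
      + 9 / 4 * (weight * ((256 * ll1\<^sup>2 * \<xi> ^ 4 * K + 8 * ll0\<^sup>2 * \<xi>\<^sup>2) * ?n))"
    unfolding noise_const_def K_def[symmetric] by (simp add: algebra_simps)
  then show ?thesis
    using 1 mult_left_mono[OF 2 c] mult_left_mono[OF 3 c] unfolding mult.assoc[of weight ?l] by linarith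
qed

text \<open>The coefficients of the distances add up to at most \<open>weight \<cdot> \<lambda>\<^sub>k\<close>, and those of the squared mean
  direction cancel against \<open>- \<xi> \<alpha>\<^sub>k / 4\<close> from the descent of \<open>F\<close>.  The latter is the only place where
  \<open>\<xi> / T\<close> has to be small.\<close>

lemma potential_decrease:
  assumes small: "\<xi> * lg1 * ll0 / (real T * \<mu>) \<le> 1 / 1000"
  shows "potential (Suc k) \<le> potential k - x_step k / 2 * mean_grad_sq k
    + 3 / 2 * (x_step k * (bias_const\<^sup>2 / (\<Lambda> k)\<^sup>2)) + noise_const * noise k"
proof -
  let ?l = "\<Lambda> k" and ?l' = "\<Lambda> (Suc k)" and ?s = "rate k" and ?h = "x_step k"
  let ?\<nu>a = "real T * ((\<alpha> k)\<^sup>2 * (2 * sample_var k))"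
  let ?\<nu>b = "real T * ((\<gamma> k)\<^sup>2 * \<sigma>g\<^sup>2)"
  have l: "?l > 0" "?l' > 0" by (rule lam_pos)+
  have s: "?s > 0" "?s \<le> 1 / 4" and h: "?h > 0" and c: "weight > 0"
    by (rule rate_pos rate_le x_step_pos weight_pos)+
  have dir0: "mean_dir_sq k \<ge> 0" by (simp add: mean_dir_sq_def)
  have track0: "track_noise k \<ge> 0"
    using s h by (simp add: track_noise_def noise_var_def)
  define E where "E = (16 / ?s + 1) * ll0\<^sup>2 * ?h\<^sup>2 * mean_dir_sq k + track_noise k"
  have E0: "E \<ge> 0" using s dir0 track0 by (simp add: E_def)
  define tY where "tY = mean_sq (\<lambda>\<omega>. Y (Suc k) \<omega> - ylam k (X (Suc k) \<omega>))"
  have tY: "tY \<le> (1 + ?s / 8) * y_gap_end k + E" using Y_tracking[of k] by (simp add: tY_def E_def)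
  have tZ: "z_gap (Suc k) \<le> (1 + ?s / 8) * z_gap_end k + E" using Z_tracking[of k] by (simp add: E_def)
  have grow: "p * ((1 + ?s / 8) * w + E) \<le> ?l * ((1 + 9 / 32 * ?s) * w + 9 / 8 * E)"
    if p: "p \<le> ?l * (1 + ?s / 16)\<^sup>2" and w: "w \<ge> 0" for p w
  proof -
    have "p * ((1 + ?s / 8) * w + E) \<le> ?l * (1 + ?s / 16)\<^sup>2 * ((1 + ?s / 8) * w + E)"
      using p w s E0 by (intro mult_right_mono) auto
    also have "\<dots> = ?l * (((1 + ?s / 16)\<^sup>2 * (1 + ?s / 8)) * w + (1 + ?s / 16)\<^sup>2 * E)"
      by (simp add: algebra_simps)
    also have "\<dots> \<le> ?l * ((1 + 9 / 32 * ?s) * w + 9 / 8 * E)"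
      using growth_factor_bounds[of ?s] s w E0 l by (intro mult_left_mono add_mono mult_right_mono) auto
    finally show ?thesis .
  qed
  have lA: "?l' * y_gap (Suc k) \<le> ?l * ((1 + 9 / 32 * ?s) * y_gap_end k + 9 / 8 * E) + ?l' * ((1 + 16 / ?s) * (drift k)\<^sup>2)"
  proof -
    have "?l' * y_gap (Suc k) \<le> ?l' * ((1 + ?s / 16) * tY + (1 + 16 / ?s) * (drift k)\<^sup>2)"
      using y_gap_Suc_le[of k] l by (intro mult_left_mono) (auto simp: tY_def)
    also have "\<dots> = ?l' * (1 + ?s / 16) * tY + ?l' * ((1 + 16 / ?s) * (drift k)\<^sup>2)"
      by (simp add: distrib_left mult.assoc)
    also have "?l' * (1 + ?s / 16) * tY \<le> ?l' * (1 + ?s / 16) * ((1 + ?s / 8) * y_gap_end k + E)"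
      using tY l s by (intro mult_left_mono) auto
    also have "\<dots> \<le> ?l * ((1 + 9 / 32 * ?s) * y_gap_end k + 9 / 8 * E)"
    proof (rule grow[OF _ gap_nonneg(2)])
      have "?l' * (1 + ?s / 16) \<le> ?l * (1 + ?s / 16) * (1 + ?s / 16)"
        using lam_Suc_le[of k] s by (intro mult_right_mono) auto
      then show "?l' * (1 + ?s / 16) \<le> ?l * (1 + ?s / 16)\<^sup>2" by (simp only: power2_eq_square mult.assoc)
    qed
    finally show ?thesis by simp
  qed
  have lB: "?l' * z_gap (Suc k) \<le> ?l * ((1 + 9 / 32 * ?s) * z_gap_end k + 9 / 8 * E)"
  proof -
    have "?l' * z_gap (Suc k) \<le> ?l' * ((1 + ?s / 8) * z_gap_end k + E)"
      using tZ l by (intro mult_left_mono) auto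
    also have "\<dots> \<le> ?l * ((1 + 9 / 32 * ?s) * z_gap_end k + 9 / 8 * E)"
    proof (rule grow[OF _ gap_nonneg(4)])
      have "?l * (1 + ?s / 16) * 1 \<le> ?l * (1 + ?s / 16) * (1 + ?s / 16)"
        using l s by (intro mult_left_mono) auto
      then show "?l' \<le> ?l * (1 + ?s / 16)\<^sup>2" using lam_Suc_le[of k] by (simp add: power2_eq_square mult.assoc)
    qed
    finally show ?thesis .
  qed
  \<comment> \<open>Smallness of \<open>\<xi> / T\<close>: the motion of both targets costs at most a quarter of the squared direction.\<close>
  have QE: "9 / 4 * (weight * ?l * E) \<le> ?h / 4 * mean_dir_sq k + 9 / 4 * (weight * ?l * track_noise k)"
  proof -
    have "16 / ?s + 1 \<le> 65 / 4 / ?s" using s by (simp add: field_simps)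
    then have "9 / 4 * (weight * ?l * ((16 / ?s + 1) * (ll0\<^sup>2 * ?h\<^sup>2))) \<le> 9 / 4 * (weight * ?l * (65 / 4 / ?s * (ll0\<^sup>2 * ?h\<^sup>2)))"
      using c l by (intro mult_left_mono mult_right_mono) auto
    also have "\<dots> = 1755 / 2 * (\<xi> * lg1 * ll0 / (real T * \<mu>))\<^sup>2 * ?h"
      using l alpha_pos[of k] Tmu_pos mu_pos T_pos
      by (simp add: weight_def rate_def x_step_def field_simps power2_eq_square)
    also have "\<dots> \<le> 1755 / 2 * (1 / 1000)\<^sup>2 * ?h"
    proof -
      have "0 \<le> \<xi> * lg1 * ll0 / (real T * \<mu>)" using xi_pos lg1_pos ll0_nonneg Tmu_pos by simp
      then have "(\<xi> * lg1 * ll0 / (real T * \<mu>))\<^sup>2 \<le> (1 / 1000)\<^sup>2" by (intro power_mono small) auto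
      then show ?thesis using h by (intro mult_right_mono mult_left_mono) auto
    qed
    also have "\<dots> \<le> ?h / 4" using h by (simp add: power2_eq_square)
    finally have "9 / 4 * (weight * ?l * ((16 / ?s + 1) * (ll0\<^sup>2 * ?h\<^sup>2))) * mean_dir_sq k \<le> ?h / 4 * mean_dir_sq k"
      using dir0 by (rule mult_right_mono)
    then show ?thesis by (simp add: E_def algebra_simps)
  qed
  \<comment> \<open>The choice of the weight: the error of the direction is within the margin of the contraction.\<close>
  have cls: "3 / 2 * (?h * (?l\<^sup>2 * lg1\<^sup>2)) * (9 / 4) \<le> weight * ?l * (5 / 32 * ?s)"
  proof -
    have "weight * ?l * (5 / 32 * ?s) = 15 / 4 * (?h * (?l\<^sup>2 * lg1\<^sup>2))"
      using Tmu_pos mu_pos T_pos by (simp add: weight_def rate_def x_step_def field_simps power2_eq_square)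
    moreover have "0 \<le> ?h * (?l\<^sup>2 * lg1\<^sup>2)" using h by simp
    ultimately show ?thesis by linarith
  qed
  have er: "?h / 2 * mean_bias_sq k \<le> 3 / 2 * (?h * (bias_const\<^sup>2 / ?l\<^sup>2)) + weight * ?l * (5 / 32 * ?s) * (y_gap_end k + z_gap_end k)"
  proof -
    have h0: "0 \<le> 3 / 2 * (?h * (?l\<^sup>2 * lg1\<^sup>2))" using h by simp
    have "?h / 2 * mean_bias_sq k \<le> ?h / 2 * (3 * (bias_const\<^sup>2 / ?l\<^sup>2 + ?l\<^sup>2 * lg1\<^sup>2 * (9 / 4 * y_gap_end k + z_gap_end k)))"
      using h gradient_error[of k] by (intro mult_left_mono) auto
    also have "\<dots> = 3 / 2 * (?h * (bias_const\<^sup>2 / ?l\<^sup>2)) + 3 / 2 * (?h * (?l\<^sup>2 * lg1\<^sup>2)) * (9 / 4 * y_gap_end k + z_gap_end k)"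
      by (simp add: algebra_simps)
    also have "3 / 2 * (?h * (?l\<^sup>2 * lg1\<^sup>2)) * (9 / 4 * y_gap_end k + z_gap_end k)
        \<le> 3 / 2 * (?h * (?l\<^sup>2 * lg1\<^sup>2)) * (9 / 4 * (y_gap_end k + z_gap_end k))"
      using h0 gap_nonneg(4)[of k] by (intro mult_left_mono) auto
    also have "\<dots> = (3 / 2 * (?h * (?l\<^sup>2 * lg1\<^sup>2)) * (9 / 4)) * (y_gap_end k + z_gap_end k)" by simp
    also have "\<dots> \<le> weight * ?l * (5 / 32 * ?s) * (y_gap_end k + z_gap_end k)"
      using cls gap_nonneg[of k] by (intro mult_right_mono) auto
    finally show ?thesis by simp
  qed
  have shrink: "(1 + 7 / 16 * ?s) * w' \<le> w + 9 / 8 * n"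
    if w': "w' \<le> (1 - 7 / 16 * ?s) * w + n" and w: "w \<ge> 0" and n: "n \<ge> 0" for w w' n
  proof -
    have "(1 + 7 / 16 * ?s) * w' \<le> (1 + 7 / 16 * ?s) * ((1 - 7 / 16 * ?s) * w + n)"
      using w' s by (intro mult_left_mono) auto
    also have "\<dots> = (1 - (7 / 16 * ?s)\<^sup>2) * w + (1 + 7 / 16 * ?s) * n"
    proof -
      have "(1 + x) * ((1 - x) * w + n) = (1 - x\<^sup>2) * w + (1 + x) * n" for x :: real
        by (simp add: power2_eq_square algebra_simps)
      then show ?thesis .
    qed
    also have "\<dots> \<le> 1 * w + 9 / 8 * n"
      using w n s by (intro add_mono mult_right_mono) auto
    finally show ?thesis by simp
  qed
  have cl: "weight * ?l \<ge> 0" using c l by simp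
  have fA: "weight * ?l * ((1 + 7 / 16 * ?s) * y_gap_end k) \<le> weight * ?l * (y_gap k + 9 / 8 * ?\<nu>a)"
    using shrink[OF y_gap_end_le[of k] gap_nonneg(1)] cl by (intro mult_left_mono) auto
  have fB: "weight * ?l * ((1 + 7 / 16 * ?s) * z_gap_end k) \<le> weight * ?l * (z_gap k + 9 / 8 * ?\<nu>b)"
    using shrink[OF z_gap_end_le[of k] gap_nonneg(3)] cl by (intro mult_left_mono) auto
  have c0: "weight \<ge> 0" using c by simp
  let ?rest = "mean_F k - ?h / 2 * mean_grad_sq k + lF1 / 2 * ?h\<^sup>2 * noise_var k + 3 / 2 * (?h * (bias_const\<^sup>2 / ?l\<^sup>2))"
  let ?grown = "weight * ?l * ((1 + 9 / 32 * ?s) * y_gap_end k) + weight * ?l * ((1 + 9 / 32 * ?s) * z_gap_end k)"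
  have "potential (Suc k) = mean_F (Suc k) + weight * (?l' * y_gap (Suc k)) + weight * (?l' * z_gap (Suc k)) + drift_const / ?l'"
    by (simp add: potential_def algebra_simps)
  also have "\<dots> \<le> (mean_F k - ?h / 2 * mean_grad_sq k - ?h / 4 * mean_dir_sq k + ?h / 2 * mean_bias_sq k + lF1 / 2 * ?h\<^sup>2 * noise_var k)
      + weight * (?l * ((1 + 9 / 32 * ?s) * y_gap_end k + 9 / 8 * E) + ?l' * ((1 + 16 / ?s) * (drift k)\<^sup>2))
      + weight * (?l * ((1 + 9 / 32 * ?s) * z_gap_end k + 9 / 8 * E)) + drift_const / ?l'"
    by (intro add_mono mult_left_mono mean_F_Suc_le lA lB c0 order_refl)
  also have "\<dots> = mean_F k - ?h / 2 * mean_grad_sq k - ?h / 4 * mean_dir_sq k + ?h / 2 * mean_bias_sq k + lF1 / 2 * ?h\<^sup>2 * noise_var k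
      + ?grown
      + 9 / 4 * (weight * ?l * E) + weight * ?l' * ((1 + 16 / ?s) * (drift k)\<^sup>2) + drift_const / ?l'"
    by (simp add: algebra_simps)
  also have "\<dots> \<le> ?rest
      + (?grown + weight * ?l * (5 / 32 * ?s) * (y_gap_end k + z_gap_end k))
      + 9 / 4 * (weight * ?l * track_noise k) + drift_const / ?l"
    using QE er drift_bound[of k] by linarith
  also have "?grown + weight * ?l * (5 / 32 * ?s) * (y_gap_end k + z_gap_end k)
      \<le> weight * ?l * (y_gap k + 9 / 8 * ?\<nu>a) + weight * ?l * (z_gap k + 9 / 8 * ?\<nu>b)"
  proof -
    have "?grown + weight * ?l * (5 / 32 * ?s) * (y_gap_end k + z_gap_end k)
      = weight * ?l * ((1 + 7 / 16 * ?s) * y_gap_end k) + weight * ?l * ((1 + 7 / 16 * ?s) * z_gap_end k)"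
      by (simp add: field_simps)
    then show ?thesis using fA fB by linarith
  qed
  also have "?rest
      + (weight * ?l * (y_gap k + 9 / 8 * ?\<nu>a) + weight * ?l * (z_gap k + 9 / 8 * ?\<nu>b)) + 9 / 4 * (weight * ?l * track_noise k) + drift_const / ?l
      = potential k - ?h / 2 * mean_grad_sq k + 3 / 2 * (?h * (bias_const\<^sup>2 / ?l\<^sup>2))
      + (lF1 / 2 * ?h\<^sup>2 * noise_var k + 9 / 8 * (weight * ?l * (?\<nu>a + ?\<nu>b)) + 9 / 4 * (weight * ?l * track_noise k))"
    by (simp add: potential_def algebra_simps)
  also have "\<dots> \<le> potential k - ?h / 2 * mean_grad_sq k + 3 / 2 * (?h * (bias_const\<^sup>2 / ?l\<^sup>2)) + noise_const * noise k"
    using noise_terms[of k] by linarith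
  finally show ?thesis by simp
qed

lemma potential_initial:
  "potential 0 = F x0 + weight * l0 * ((norm (y0 - ystar_lam f g l0 x0))\<^sup>2 + (norm (z0 - ystar g x0))\<^sup>2) + drift_const / l0"
  by (simp add: potential_def mean_F_def y_gap_def z_gap_def X_0 Y_0 Z_0 prob_space)

lemma potential_lower:
  assumes m: "\<And>x. m \<le> F x"
  shows "m \<le> potential k"
proof -
  have "integrable P (\<lambda>\<omega>. F (X k \<omega>))" by (rule smooth_function_integrable[OF F_smooth X_sqint])
  then have "(\<integral>\<omega>. m \<partial>P) \<le> mean_F k"
    unfolding mean_F_def by (intro integral_mono m) auto
  moreover have "0 \<le> weight * \<Lambda> k * (y_gap k + z_gap k)" "0 \<le> drift_const / \<Lambda> k"
    using weight_pos lam_pos[of k] gap_nonneg[of k] by (simp_all add: drift_const_def)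
  ultimately show ?thesis by (simp add: potential_def prob_space)
qed

lemma gradient_sum_bound:
  assumes small: "\<xi> * lg1 * ll0 / (real T * \<mu>) \<le> 1 / 1000" and m: "\<And>x. m \<le> F x"
  shows "(\<Sum>k<K. \<xi> * \<alpha> k * mean_grad_sq k)
    \<le> 3 * bias_const\<^sup>2 * (\<Sum>k<K. \<xi> * \<alpha> k * (1 / (\<Lambda> k)\<^sup>2))
      + 2 * noise_const * \<sigma>f\<^sup>2 * (\<Sum>k<K. (\<alpha> k)\<^sup>2 * \<Lambda> k)
      + 2 * noise_const * \<sigma>g\<^sup>2 * (\<Sum>k<K. (\<gamma> k)\<^sup>2 * \<Lambda> k)
      + 2 * (potential 0 - m)"
proof -
  have "(\<Sum>k<K. \<xi> * \<alpha> k * mean_grad_sq k) + 2 * potential K \<le> 2 * potential 0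
      + 3 * bias_const\<^sup>2 * (\<Sum>k<K. \<xi> * \<alpha> k * (1 / (\<Lambda> k)\<^sup>2))
      + 2 * noise_const * \<sigma>f\<^sup>2 * (\<Sum>k<K. (\<alpha> k)\<^sup>2 * \<Lambda> k)
      + 2 * noise_const * \<sigma>g\<^sup>2 * (\<Sum>k<K. (\<gamma> k)\<^sup>2 * \<Lambda> k)"
  proof (induction K)
    case (Suc K)
    have "2 * potential (Suc K) + x_step K * mean_grad_sq K \<le> 2 * potential K + 3 * (x_step K * (bias_const\<^sup>2 / (\<Lambda> K)\<^sup>2)) + 2 * (noise_const * noise K)"
      using potential_decrease[OF small, of K] by linarith
    also have "\<dots> = 2 * potential K + 3 * bias_const\<^sup>2 * (\<xi> * \<alpha> K * (1 / (\<Lambda> K)\<^sup>2))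
        + 2 * noise_const * \<sigma>f\<^sup>2 * ((\<alpha> K)\<^sup>2 * \<Lambda> K) + 2 * noise_const * \<sigma>g\<^sup>2 * ((\<gamma> K)\<^sup>2 * \<Lambda> K)"
      by (simp add: x_step_def noise_def algebra_simps)
    finally have "2 * potential (Suc K) + \<xi> * \<alpha> K * mean_grad_sq K \<le> \<dots>" by (simp add: x_step_def)
    then show ?case
      using Suc unfolding sum.lessThan_Suc distrib_left by linarith
  qed simp
  moreover have "a \<le> b + c + d + 2 * (q - m)" if "a + 2 * r \<le> 2 * q + b + c + d" "m \<le> r" for a b c d q r :: real
    using that by simp
  ultimately show ?thesis using potential_lower[OF m, of K] by blast
qed

end

section \<open>The convergence theorem\<close>

text \<open>\<open>lg1 ll0 \<le> lg1 (max 1 ll0)\<^sup>2\<close>.\<close>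

lemma step_ratio_small:
  assumes T: "T \<ge> 1" and mu: "\<mu> > 0" and lg1: "lg1 > 0" and xi: "\<xi> > 0" and ll0: "ll0 \<ge> 0"
    and ratio: "\<xi> / real T < c_xi * \<mu> * inverse (max (lg1 * (max 1 ll0)\<^sup>2) b)"
  shows "\<xi> * lg1 * ll0 / (real T * \<mu>) \<le> 1 / 1000"
proof -
  let ?m = "max (lg1 * (max 1 ll0)\<^sup>2) b"
  have "ll0 * 1 \<le> max 1 ll0 * max 1 ll0" using ll0 by (intro mult_mono) auto
  then have "lg1 * ll0 \<le> lg1 * (max 1 ll0)\<^sup>2" using lg1 by (simp add: power2_eq_square)
  then have le: "lg1 * ll0 \<le> ?m" by simp
  have "0 < lg1 * (max 1 ll0)\<^sup>2" using lg1 by simp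
  then have m: "?m > 0" by (simp add: less_max_iff_disj)
  have "\<xi> / real T * (lg1 * ll0) \<le> \<xi> / real T * ?m"
    using le xi by (intro mult_left_mono) auto
  also have "\<dots> \<le> c_xi * \<mu> * inverse ?m * ?m"
    using ratio m by (intro mult_right_mono) auto
  also have "\<dots> = c_xi * \<mu>" using m by simp
  finally show ?thesis using mu T by (simp add: c_xi_def field_simps)
qed

theorem theorem4p1:
  fixes lf0 lf1 lf2 lg0 lg1 lg2 \<mu> \<sigma>f \<sigma>g lF1 ll0 ll1 \<xi> l0 :: real and T :: nat
    and x0 :: "'a::euclidean_space" and y0 z0 :: "'b::euclidean_space"
  assumes "T \<ge> 1" and "\<xi> > 0" and "l0 > 0" and "l0 \<ge> 2 * lf1 / \<mu>"
    and "\<xi> / real T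
           < c_xi * \<mu> * inverse (max (lg1 * (max 1 ll0)\<^sup>2) (ll1 * sqrt (moment_bound lf0 \<sigma>f lg0 \<sigma>g)))"
  shows "c_xi > 0 \<and>
    (\<exists>C1 C2 C3. \<forall>f g :: 'a \<times> 'b \<Rightarrow> real.
      bilevel_assms f g lf0 lf1 lf2 lg0 lg1 lg2 \<mu> \<longrightarrow>
      derived_constants f g lf2 lg1 lg2 \<mu> l0 lF1 ll0 ll1 \<longrightarrow>
      (\<exists>C4. \<forall>(P :: 'w measure) (Df :: 'z measure) (Dg :: 'z measure) Gf Gg S \<alpha> \<gamma> \<delta>.
        unbiased_oracle Df Gf f \<sigma>f \<longrightarrow>
        unbiased_oracle Dg Gg g \<sigma>g \<longrightarrow>
        independent_samples P Df Dg S \<longrightarrow>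
        step_conditions \<alpha> \<gamma> \<delta> T \<xi> l0 lf1 lg1 \<mu> lF1 \<longrightarrow>
        (\<forall>K\<ge>1.
          (\<Sum>k<K. \<xi> * \<alpha> k *
             (\<integral>\<omega>. (norm (nabla (hyper_obj f g)
                  (fst (F2SA Gf Gg \<alpha> \<gamma> \<delta> T \<xi> l0 x0 y0 z0 (\<lambda>i. S i \<omega>) k))))\<^sup>2 \<partial>P))
          \<le> C1 * (\<Sum>k<K. \<xi> * \<alpha> k * (1 / (lam l0 \<delta> k)\<^sup>2))
            + C2 * \<sigma>f\<^sup>2 * (\<Sum>k<K. (\<alpha> k)\<^sup>2 * lam l0 \<delta> k)
            + C3 * \<sigma>g\<^sup>2 * (\<Sum>k<K. (\<gamma> k)\<^sup>2 * lam l0 \<delta> k)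
            + C4)))"
proof (rule conjI, goal_cases)
  case 1
  show ?case by (simp add: c_xi_def)
next
  case 2
  let ?bias = "bilevel.bias_const lf0 lf1 lg2 \<mu> ll0"
  let ?noise = "f2sa.noise_const lg1 \<mu> l0 lF1 ll0 ll1 \<sigma>f \<sigma>g T \<xi>"
  show ?case
  proof (rule exI[of _ "3 * ?bias\<^sup>2"], rule exI[of _ "2 * ?noise"], rule exI[of _ "2 * ?noise"],
      intro allI impI, goal_cases)
    case (1 f g)
    interpret bilevel f g lf0 lf1 lf2 lg0 lg1 lg2 \<mu> l0 lF1 ll0 ll1
      using 1 assms by unfold_locales
    obtain m where m: "\<And>x. m \<le> hyper_obj f g x"
      using 1(1) by (auto simp: bilevel_assms_def bdd_below_def)
    have "lg1 > 0" using mu_pos mu_le_lg1 by simp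
    note small = step_ratio_small[OF assms(1) mu_pos this assms(2) ll0_nonneg assms(5)]
    let ?c = "f2sa.weight lg1 \<mu> T \<xi>" and ?d = "f2sa.drift_const lf0 lg1 \<mu> T \<xi>"
    \<comment> \<open>\<open>C4\<close> is twice the initial potential above a lower bound of \<open>F\<close>.\<close>
    show ?case
    proof (rule exI[of _ "2 * (hyper_obj f g x0
          + ?c * l0 * ((norm (y0 - ystar_lam f g l0 x0))\<^sup>2 + (norm (z0 - ystar g x0))\<^sup>2) + ?d / l0 - m)"],
        intro allI impI, goal_cases)
      case (1 P Df Dg Gf Gg S \<alpha> \<gamma> \<delta> K)
      interpret f2sa f g lf0 lf1 lf2 lg0 lg1 lg2 \<mu> l0 lF1 ll0 ll1 Df Dg Gf Gg \<sigma>f \<sigma>g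
          P S \<alpha> \<gamma> \<delta> T \<xi> x0 y0 z0
        using 1 assms by unfold_locales
      show ?case
        using gradient_sum_bound[OF small m, of K]
        unfolding potential_initial mean_grad_sq_def X_def iter_def .
    qed
  qed
qed

end
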